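(* Let $(W,S)$ be of type $B_n$, with Artin–Tits group $B(W)$ identified with the group $\mathcal{B}_{2n}^B=\mathcal{B}_{2n}^\tau$ of symmetric braids on $2n$ strands. Let $\beta\in\mathcal{B}_{2n}^B$. Then $\beta$ is a Mikado braid of type $B_n$ if and only if $\beta=\mathbf{x}^{-1}\mathbf{y}$ for some $\mathbf{x},\mathbf{y}\in\mathbf{W}$; hence $\beta$ is a Mikado braid of type $B_n$ if and only if $\beta$ is a rational permutation braid. (Here $\mathbf{W}$ is the positive lift of the Coxeter group $W$ of type $B_n$ in the Artin–Tits group of type $B_n$.)
   Context: Let $W'$ be the Coxeter group of type $A_{2n-1}$ with generators $s_1,\ldots,s_{2n-1}$, and $\tau$ the diagram automorphism exchanging $s_i$ and $s_{2n-i}$. $W$ is the fixed-point group $W'^\tau$, with Coxeter generators $t_0=s_n$, $t_i=s_is_{2n-i}$ ($1\le i\le n-1$). This lifts to Artin–Tits groups: $B(W)$ is identified with the fixed points $\mathcal{B}_{2n}^B:=\mathcal{B}_{2n}^\tau$ in $B(W')=\mathcal{B}_{2n}$ of the automorphism $\tau:\mathbf{s}_i\mapsto\mathbf{s}_{2n-i}$, with generators $\mathbf{t}_0=\mathbf{s}_n$, $\mathbf{t}_i=\mathbf{s}_i\mathbf{s}_{2n-i}$. Topologically these are the symmetric braids on $2n$ strands labelled $-n,\ldots,-1,1,\ldots,n$: the symmetry exchanges the strands $i$ and $-i$ and exchanges under- and over-crossings. For the finite Coxeter system $(W,S)$, $S=\{t_0,\ldots,t_{n-1}\}$: $B^+(W)$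 is the submonoid of $B(W)$ generated by the $\mathbf{t}_i$; $\mathbf{W}\subset B^+(W)$ is the set of lifts of the elements of $W$ obtained by lifting reduced expressions; $\Delta$ is the lift of the longest element of $W$; $u\preccurlyeq v$ means $u^{-1}v\in B^+(W)$; a rational permutation braid is $\beta\in B(W)$ with $\Delta^{-1}\preccurlyeq\beta\preccurlyeq\Delta$. A braid $\beta\in\mathcal{B}_{2n}^B$ is a Mikado braid of type $B_n$ if, when viewed in $\mathcal{B}_{2n}$, starting from any diagram $D$ for $\beta$ one can inductively remove pairs of symmetric strands, one being above all the other strands (so that its symmetric is under all the other strands). Equivalently, the set of Mikado braids of type $B_n$ is the intersection of $\mathcal{B}_{2n}^B$ with the set of Mikado braids of $\mathcal{B}_{2n}$, where Mikado braids of $\mathcal{B}_m$ are defined recursively: the trivial braid in $\mathcal{B}_1$ is Mikado; a braid in $\mathcal{B}_{m}$, $m\geq 2$, is Mikado if in any reduced diagram (one with minimal number of crossings) for it there is at least one good strand (a strand that is over all other strands it crosses), and removing any such strand yields a Mikado braid in $\mathcal{B}_{m-1}$. *)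

theory Defs
  imports "HOL-Algebra.Group" "HOL-Combinatorics.Permutations"
begin

section \<open>Braid groups and braid diagrams\<close>

text \<open>A letter \<open>(i, True)\<close> is the Artin generator \<open>s\<^sub>i\<close> and \<open>(i, False)\<close> is its inverse.  A word over the
  letters with \<open>1 \<le> i < m\<close> is at the same time a braid diagram on \<open>m\<close> strands, its letters being the
  crossings from top to bottom.  Braids are equivalence classes of words, so \<open>D \<in> \<beta>\<close> says that
  \<open>D\<close> is a diagram for \<open>\<beta>\<close>.\<close>

type_synonym braid_word = "(nat \<times> bool) list"
type_synonym braid = "braid_word set"

definition braid_words :: "nat \<Rightarrow> braid_word set" where
  "braid_words m = lists ({1..<m} \<times> UNIV)"

inductive braid_equiv :: "nat \<Rightarrow> braid_word \<Rightarrow> braid_word \<Rightarrow> bool" for m where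
  refl: "u \<in> braid_words m \<Longrightarrow> braid_equiv m u u"
| sym: "braid_equiv m u v \<Longrightarrow> braid_equiv m v u"
| trans: "braid_equiv m u v \<Longrightarrow> braid_equiv m v w \<Longrightarrow> braid_equiv m u w"
| cong: "braid_equiv m u v \<Longrightarrow> a \<in> braid_words m \<Longrightarrow> b \<in> braid_words m
    \<Longrightarrow> braid_equiv m (a @ u @ b) (a @ v @ b)"
| cancel: "1 \<le> i \<Longrightarrow> i < m \<Longrightarrow> braid_equiv m [(i, e), (i, \<not> e)] []"
| commute: "1 \<le> i \<Longrightarrow> i + 1 < j \<Longrightarrow> j < m
    \<Longrightarrow> braid_equiv m [(i, True), (j, True)] [(j, True), (i, True)]"
| braid: "1 \<le> i \<Longrightarrow> i + 1 < m
    \<Longrightarrow> braid_equiv m [(i, True), (i + 1, True), (i, True)] [(i + 1, True), (i, True), (i + 1, True)]"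

definition braid_class :: "nat \<Rightarrow> braid_word \<Rightarrow> braid" where
  "braid_class m u = {v. braid_equiv m u v}"

definition braid_group :: "nat \<Rightarrow> braid monoid" where
  "braid_group m =
    \<lparr>carrier = braid_class m ` braid_words m,
     monoid.mult = (\<lambda>X Y. \<Union>u\<in>X. \<Union>v\<in>Y. braid_class m (u @ v)),
     one = braid_class m []\<rparr>"

definition artin_gen :: "nat \<Rightarrow> nat \<Rightarrow> braid" where
  "artin_gen m i = braid_class m [(i, True)]"

lemma braid_words_iff: "u \<in> braid_words m \<longleftrightarrow> (\<forall>i e. (i, e) \<in> set u \<longrightarrow> 1 \<le> i \<and> i < m)"
  unfolding braid_words_def in_lists_conv_set Ball_def split_paired_All mem_Sigma_iff by simp

lemma braid_equiv_words:
  assumes "braid_equiv m u v"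
  shows "u \<in> braid_words m" "v \<in> braid_words m"
  using assms by (induction rule: braid_equiv.induct) (auto simp: braid_words_def)

lemma braid_class_eq_iff:
  assumes "u \<in> braid_words m"
  shows "braid_class m u = braid_class m v \<longleftrightarrow> braid_equiv m u v"
proof
  assume "braid_class m u = braid_class m v"
  moreover have "u \<in> braid_class m u"
    using assms by (simp add: braid_class_def braid_equiv.refl)
  ultimately have "braid_equiv m v u"
    by (simp add: braid_class_def)
  then show "braid_equiv m u v" by (rule braid_equiv.sym)
next
  assume uv: "braid_equiv m u v"
  show "braid_class m u = braid_class m v"
    unfolding braid_class_def
    by (intro Collect_cong iffI, erule braid_equiv.trans[OF braid_equiv.sym[OF uv]],
        erule braid_equiv.trans[OF uv])
qed

lemma braid_equiv_append:
  assumes "braid_equiv m u u'" "braid_equiv m v v'"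
  shows "braid_equiv m (u @ v) (u' @ v')"
proof -
  have "[] \<in> braid_words m" by (simp add: braid_words_def)
  then have "braid_equiv m (u @ v) (u' @ v)" "braid_equiv m (u' @ v) (u' @ v')"
    using braid_equiv.cong[OF assms(1), of "[]" v] braid_equiv.cong[OF assms(2), of u' "[]"]
      braid_equiv_words[OF assms(1)] braid_equiv_words[OF assms(2)] by simp_all
  then show ?thesis by (rule braid_equiv.trans)
qed

lemma braid_group_mult_class:
  assumes "u \<in> braid_words m" "v \<in> braid_words m"
  shows "braid_class m u \<otimes>\<^bsub>braid_group m\<^esub> braid_class m v = braid_class m (u @ v)"
proof -
  have *: "braid_class m (u' @ v') = braid_class m (u @ v)"
    if "u' \<in> braid_class m u" "v' \<in> braid_class m v" for u' v'
  proof -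
    have e: "braid_equiv m (u @ v) (u' @ v')"
      using that braid_equiv_append by (simp add: braid_class_def)
    from e show ?thesis by (simp flip: braid_class_eq_iff[OF braid_equiv_words(1)[OF e]])
  qed
  have "(\<Union>u'\<in>braid_class m u. \<Union>v'\<in>braid_class m v. braid_class m (u' @ v')) =
      (\<Union>u'\<in>braid_class m u. \<Union>v'\<in>braid_class m v. braid_class m (u @ v))"
    by (rule SUP_cong[OF HOL.refl SUP_cong[OF HOL.refl *]])
  moreover have "u \<in> braid_class m u" "v \<in> braid_class m v"
    using assms by (simp_all add: braid_class_def braid_equiv.refl)
  then have "braid_class m u \<noteq> {}" "braid_class m v \<noteq> {}" by blast+
  ultimately show ?thesis by (simp add: braid_group_def)
qed

lemma braid_word_inverse:
  assumes "u \<in> braid_words m"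
  shows "braid_equiv m (rev (map (apsnd Not) u) @ u) []"
  using assms
proof (induction u)
  case Nil
  then show ?case by (simp add: braid_equiv.refl)
next
  case (Cons x u)
  obtain i e where x: "x = (i, e)" by (cases x)
  have u: "u \<in> braid_words m" "rev (map (apsnd Not) u) \<in> braid_words m" and i: "1 \<le> i" "i < m"
  proof -
    have w: "1 \<le> j \<and> j < m" if "(j, d) \<in> set (x # u)" for j d
      using Cons.prems that unfolding braid_words_iff by blast
    show "u \<in> braid_words m"
      unfolding braid_words_iff by (meson w list.set_intros(2))
    show "rev (map (apsnd Not) u) \<in> braid_words m"
      unfolding braid_words_iff using w by fastforce
    show "1 \<le> i" "i < m" using w[of i e] x by simp_all
  qed
  have "braid_equiv m (rev (map (apsnd Not) u) @ [(i, \<not> e), (i, \<not> \<not> e)] @ u)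
      (rev (map (apsnd Not) u) @ [] @ u)"
    by (rule braid_equiv.cong[OF braid_equiv.cancel[OF i] u(2,1)])
  then have "braid_equiv m (rev (map (apsnd Not) (x # u)) @ x # u) (rev (map (apsnd Not) u) @ u)"
    by (simp add: x)
  then show ?case using Cons.IH[OF u(1)] by (rule braid_equiv.trans)
qed

lemma group_braid_group: "group (braid_group m)"
proof (rule groupI)
  have nil: "[] \<in> braid_words m" by (simp add: braid_words_def)
  have app: "u @ v \<in> braid_words m" if "u \<in> braid_words m" "v \<in> braid_words m" for u v
    using that by (simp add: braid_words_def)
  have carrier: "carrier (braid_group m) = braid_class m ` braid_words m"
    and one: "\<one>\<^bsub>braid_group m\<^esub> = braid_class m []"
    by (simp_all add: braid_group_def)
  show "\<one>\<^bsub>braid_group m\<^esub> \<in> carrier (braid_group m)"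
    using nil by (simp add: carrier one)
  fix x assume "x \<in> carrier (braid_group m)"
  then obtain u where u: "u \<in> braid_words m" "x = braid_class m u" by (auto simp: carrier)
  show "\<one>\<^bsub>braid_group m\<^esub> \<otimes>\<^bsub>braid_group m\<^esub> x = x"
    using u nil by (simp add: one braid_group_mult_class)
  have inv: "rev (map (apsnd Not) u) \<in> braid_words m"
    using u(1) unfolding braid_words_iff by fastforce
  show "\<exists>y\<in>carrier (braid_group m). y \<otimes>\<^bsub>braid_group m\<^esub> x = \<one>\<^bsub>braid_group m\<^esub>"
  proof
    show "braid_class m (rev (map (apsnd Not) u)) \<in> carrier (braid_group m)"
      using inv by (simp add: carrier)
    show "braid_class m (rev (map (apsnd Not) u)) \<otimes>\<^bsub>braid_group m\<^esub> x = \<one>\<^bsub>braid_group m\<^esub>"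
      unfolding u(2) one braid_group_mult_class[OF inv u(1)]
      using braid_class_eq_iff[OF app[OF inv u(1)]] braid_word_inverse[OF u(1)] by simp
  qed
  fix y assume "y \<in> carrier (braid_group m)"
  then obtain v where v: "v \<in> braid_words m" "y = braid_class m v" by (auto simp: carrier)
  show "x \<otimes>\<^bsub>braid_group m\<^esub> y \<in> carrier (braid_group m)"
    using u v app by (simp add: carrier braid_group_mult_class)
  fix z assume "z \<in> carrier (braid_group m)"
  then obtain w where w: "w \<in> braid_words m" "z = braid_class m w" by (auto simp: carrier)
  show "x \<otimes>\<^bsub>braid_group m\<^esub> y \<otimes>\<^bsub>braid_group m\<^esub> z = x \<otimes>\<^bsub>braid_group m\<^esub> (y \<otimes>\<^bsub>braid_group m\<^esub> z)"
    using u v w app by (simp add: braid_group_mult_class)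
qed

section \<open>Mikado braids\<close>

definition reduced_diagram :: "braid \<Rightarrow> braid_word \<Rightarrow> bool" where
  "reduced_diagram \<beta> D \<longleftrightarrow> D \<in> \<beta> \<and> (\<forall>D'\<in>\<beta>. length D \<le> length D')"

text \<open>The argument \<open>p\<close> is the current position of the strand, positions being \<open>1, \<dots>, m\<close> from left to
  right.  At a crossing \<open>(i, True)\<close> the strand coming from position \<open>i\<close> passes over the one coming
  from position \<open>i + 1\<close>; at a crossing \<open>(i, False)\<close> it passes under.\<close>

fun good_strand :: "nat \<Rightarrow> braid_word \<Rightarrow> bool" where
  "good_strand p [] \<longleftrightarrow> True"
| "good_strand p ((i, e) # D) \<longleftrightarrow>
    (p = i \<longrightarrow> e) \<and> (p = i + 1 \<longrightarrow> \<not> e) \<and> good_strand (transpose i (i + 1) p) D"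

text \<open>Deleting a strand deletes its crossings and shifts by one the positions to the right of it.\<close>

fun remove_strand :: "nat \<Rightarrow> braid_word \<Rightarrow> braid_word" where
  "remove_strand p [] = []"
| "remove_strand p ((i, e) # D) =
    (if p = i \<or> p = i + 1 then remove_strand (transpose i (i + 1) p) D
     else (if p < i then i - 1 else i, e) # remove_strand p D)"

text \<open>The clause for \<open>0\<close> strands only makes the function total.\<close>

fun mikado :: "nat \<Rightarrow> braid \<Rightarrow> bool" where
  "mikado 0 \<beta> \<longleftrightarrow> \<beta> = \<one>\<^bsub>braid_group 0\<^esub>"
| "mikado (Suc 0) \<beta> \<longleftrightarrow> \<beta> = \<one>\<^bsub>braid_group 1\<^esub>"
| "mikado (Suc (Suc m)) \<beta> \<longleftrightarrow> \<beta> \<in> carrier (braid_group (Suc (Suc m))) \<and>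
    (\<forall>D. reduced_diagram \<beta> D \<longrightarrow>
       (\<exists>p\<in>{1..Suc (Suc m)}. good_strand p D) \<and>
       (\<forall>p\<in>{1..Suc (Suc m)}. good_strand p D \<longrightarrow>
          mikado (Suc m) (braid_class (Suc m) (remove_strand p D))))"

section \<open>Symmetric braids\<close>

definition braid_tau :: "nat \<Rightarrow> braid \<Rightarrow> braid" where
  "braid_tau n \<beta> = map (apfst (\<lambda>i. 2 * n - i)) ` \<beta>"

lemma braid_equiv_tau:
  assumes "braid_equiv (2 * n) u v"
  shows "braid_equiv (2 * n) (map (apfst (\<lambda>i. 2 * n - i)) u) (map (apfst (\<lambda>i. 2 * n - i)) v)"
  using assms
proof (induction rule: braid_equiv.induct)
  case (refl u)
  then show ?case by (intro braid_equiv.refl) (fastforce simp: braid_words_iff)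
next
  case (sym u v)
  from braid_equiv.sym[OF sym.IH] show ?case .
next
  case (trans u v w)
  from trans.IH show ?case by (rule braid_equiv.trans)
next
  case (cong u v a b)
  have "map (apfst (\<lambda>i. 2 * n - i)) w \<in> braid_words (2 * n)" if "w \<in> braid_words (2 * n)" for w
    using that by (fastforce simp: braid_words_iff)
  from braid_equiv.cong[OF cong.IH this[OF cong.hyps(2)] this[OF cong.hyps(3)]]
  show ?case by simp
next
  case (cancel i e)
  then have "braid_equiv (2 * n) [(2 * n - i, e), (2 * n - i, \<not> e)] []"
    by (intro braid_equiv.cancel) auto
  then show ?case by simp
next
  case (commute i j)
  then have "braid_equiv (2 * n) [(2 * n - j, True), (2 * n - i, True)]
      [(2 * n - i, True), (2 * n - j, True)]"
    by (intro braid_equiv.commute) auto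
  from braid_equiv.sym[OF this] show ?case by simp
next
  case (braid i)
  define k where "k = 2 * n - i - 1"
  have k: "2 * n - i = k + 1" "2 * n - (i + 1) = k" and "1 \<le> k" "k + 1 < 2 * n"
    using braid by (auto simp: k_def)
  then have "braid_equiv (2 * n) [(k, True), (k + 1, True), (k, True)]
      [(k + 1, True), (k, True), (k + 1, True)]"
    by (intro braid_equiv.braid)
  from braid_equiv.sym[OF this] show ?case by (simp only: list.map apfst_conv k)
qed

lemma braid_tau_class:
  assumes "u \<in> braid_words (2 * n)"
  shows "braid_tau n (braid_class (2 * n) u) =
    braid_class (2 * n) (map (apfst (\<lambda>i. 2 * n - i)) u)"
proof -
  define f where "f = map (apfst (\<lambda>i. 2 * n - i) :: nat \<times> bool \<Rightarrow> nat \<times> bool)"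
  have ff: "f (f w) = w" if "w \<in> braid_words (2 * n)" for w
    using that unfolding f_def by (induction w) (auto simp: braid_words_def)
  have *: "braid_equiv (2 * n) (f v) (f w)" if "braid_equiv (2 * n) v w" for v w
    using braid_equiv_tau[OF that] by (simp add: f_def)
  have "w \<in> f ` braid_class (2 * n) u" if "braid_equiv (2 * n) (f u) w" for w
  proof
    show "w = f (f w)" using ff braid_equiv_words(2)[OF that] by simp
    show "f w \<in> braid_class (2 * n) u"
      using *[OF that] ff[OF assms] by (simp add: braid_class_def)
  qed
  moreover have "f ` braid_class (2 * n) u \<subseteq> {w. braid_equiv (2 * n) (f u) w}"
    using * by (auto simp only: braid_class_def)
  ultimately have "f ` braid_class (2 * n) u = braid_class (2 * n) (f u)"
    unfolding braid_class_def[of _ "f u"] by blast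
  then show ?thesis unfolding braid_tau_def f_def .
qed

text \<open>The Artin--Tits group of type \<open>B\<^sub>n\<close>, realised as the fixed points of \<open>\<tau>\<close> in the braid group on
  \<open>2n\<close> strands.  The strands labelled \<open>-n, \<dots>, -1, 1, \<dots>, n\<close> are those starting at the positions
  \<open>1, \<dots>, 2n\<close>, in this order.\<close>

definition braids_B :: "nat \<Rightarrow> braid set" where
  "braids_B n = {\<beta> \<in> carrier (braid_group (2 * n)). braid_tau n \<beta> = \<beta>}"

text \<open>Removing pairs of symmetric strands ``starting from any diagram'' cannot be read literally for
  diagrams that are not reduced: on two strands, no strand is above the other one in the diagram
  \<open>s\<^sub>1s\<^sub>1s\<^sub>1\<^sup>-\<^sup>1s\<^sub>1\<^sup>-\<^sup>1\<close> of the trivial braid.  Mikado braids of type \<open>B\<^sub>n\<close> are therefore taken in the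
  equivalent form of the symmetric braids that are Mikado braids on \<open>2n\<close> strands.\<close>

definition mikado_B :: "nat \<Rightarrow> braid \<Rightarrow> bool" where
  "mikado_B n \<beta> \<longleftrightarrow> \<beta> \<in> braids_B n \<and> mikado (2 * n) \<beta>"

definition artin_gen_B :: "nat \<Rightarrow> nat \<Rightarrow> braid" where
  "artin_gen_B n i =
    (if i = 0 then artin_gen (2 * n) n
     else artin_gen (2 * n) i \<otimes>\<^bsub>braid_group (2 * n)\<^esub> artin_gen (2 * n) (2 * n - i))"

definition lift_word_B :: "nat \<Rightarrow> nat list \<Rightarrow> braid" where
  "lift_word_B n ts =
    foldr (\<otimes>\<^bsub>braid_group (2 * n)\<^esub>) (map (artin_gen_B n) ts) \<one>\<^bsub>braid_group (2 * n)\<^esub>"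

definition positive_braids_B :: "nat \<Rightarrow> braid set" where
  "positive_braids_B n = {lift_word_B n ts | ts. set ts \<subseteq> {..<n}}"

section \<open>The Coxeter group of type B and its positive lift\<close>

text \<open>The Coxeter group of type \<open>A\<close> with \<open>2n - 1\<close> generators is the symmetric group of \<open>{1..2n}\<close>, with
  \<open>s\<^sub>i\<close> the transposition of \<open>i\<close> and \<open>i + 1\<close>; its diagram automorphism is conjugation by the
  reversal \<open>k \<mapsto> 2n + 1 - k\<close>, so that a permutation is fixed iff it commutes with the reversal.\<close>

definition coxeter_B :: "nat \<Rightarrow> (nat \<Rightarrow> nat) set" where
  "coxeter_B n =
    {w. w permutes {1..2 * n} \<and> (\<forall>k\<in>{1..2 * n}. w (2 * n + 1 - k) = 2 * n + 1 - w k)}"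

definition coxeter_gen_B :: "nat \<Rightarrow> nat \<Rightarrow> nat \<Rightarrow> nat" where
  "coxeter_gen_B n i =
    (if i = 0 then transpose n (n + 1)
     else transpose i (i + 1) \<circ> transpose (2 * n - i) (2 * n - i + 1))"

definition expression_B :: "nat \<Rightarrow> nat list \<Rightarrow> (nat \<Rightarrow> nat) \<Rightarrow> bool" where
  "expression_B n ts w \<longleftrightarrow> set ts \<subseteq> {..<n} \<and> foldr (\<circ>) (map (coxeter_gen_B n) ts) id = w"

definition length_B :: "nat \<Rightarrow> (nat \<Rightarrow> nat) \<Rightarrow> nat" where
  "length_B n w = (LEAST k. \<exists>ts. expression_B n ts w \<and> length ts = k)"

definition reduced_expression_B :: "nat \<Rightarrow> nat list \<Rightarrow> (nat \<Rightarrow> nat) \<Rightarrow> bool" where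
  "reduced_expression_B n ts w \<longleftrightarrow> expression_B n ts w \<and> length ts = length_B n w"

definition positive_lift_B :: "nat \<Rightarrow> braid set" where
  "positive_lift_B n = {lift_word_B n ts | ts w. w \<in> coxeter_B n \<and> reduced_expression_B n ts w}"

definition longest_B :: "nat \<Rightarrow> nat \<Rightarrow> nat" where
  "longest_B n = (THE w. w \<in> coxeter_B n \<and> (\<forall>v\<in>coxeter_B n. length_B n v \<le> length_B n w))"

text \<open>By Matsumoto's theorem the lift does not depend on the reduced expression.\<close>

definition Delta_B :: "nat \<Rightarrow> braid" where
  "Delta_B n = (THE \<delta>. \<exists>ts. reduced_expression_B n ts (longest_B n) \<and> \<delta> = lift_word_B n ts)"

definition left_divides_B :: "nat \<Rightarrow> braid \<Rightarrow> braid \<Rightarrow> bool" where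
  "left_divides_B n u v \<longleftrightarrow> inv\<^bsub>braid_group (2 * n)\<^esub> u \<otimes>\<^bsub>braid_group (2 * n)\<^esub> v \<in> positive_braids_B n"

definition rational_permutation_braid_B :: "nat \<Rightarrow> braid \<Rightarrow> bool" where
  "rational_permutation_braid_B n \<beta> \<longleftrightarrow> \<beta> \<in> braids_B n \<and>
    left_divides_B n (inv\<^bsub>braid_group (2 * n)\<^esub> (Delta_B n)) \<beta> \<and> left_divides_B n \<beta> (Delta_B n)"

end

theory Submission
  imports Defs
begin

text \<open>Draw a braid with every strand at its own height.  If the heights \<open>a\<close> of the strands are given,
  the braid is determined by the permutation of the strands, since the top strand can be pulled out
  of any diagram; and the Mikado braids are exactly the braids that have such a layered diagram.
  Here it matters that a reduced diagram of a layered braid is itself layered: any two of its strands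
  cross at most once, and the sign of this crossing is their linking number.  A layered diagram with
  heights \<open>a\<close> and permutation \<open>w\<close> represents \<open>x\<^sup>-\<^sup>1y\<close> for the positive lifts \<open>x\<close> of \<open>a\<close> and \<open>y\<close> of
  \<open>a \<circ> w\<close>, and for a symmetric braid the heights can be chosen symmetric.

  If \<open>\<Delta>\<^sup>-\<^sup>1 \<preceq> \<beta> \<preceq> \<Delta>\<close>, then the positive braid \<open>\<Delta>\<beta>\<close> is a divisor of \<open>\<Delta>\<^sup>2\<close>, and Garside's greedy normal form
  shows that it is a product of two positive lifts of permutations, so that \<open>\<beta>\<close> is again a fraction
  \<open>x\<^sup>-\<^sup>1y\<close>, and is layered.\<close>

section \<open>Words and strands\<close>

text \<open>The bridge is an action: braid words act on infinite sequences of permutations, which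
  model normal forms, and equivalent words act equally up to powers of Delta. An inverse letter acts
  through s_i^-1 Delta^2, which is positive; the surplus powers of Delta are counted and compared
  afterwards. Thus an equation P Q = Delta^2 in the group bounds the number of nontrivial entries in
  the sequence of P.

  All of this takes place in the symmetric group on 2n letters. Type B enters only at the ends:
  reduced type B expressions are layered words, so the lifts of type B are the type A lifts of the
  symmetric permutations, and Delta is the same element. The fraction found for a rational
  permutation braid need not have symmetric terms; it only shows that the braid is layered, after
  which symmetric terms come from symmetric heights.\<close>

declare braid_equiv.trans [trans]

lemma braid_words_Nil [simp]: "[] \<in> braid_words m"
  by (simp add: braid_words_def)

lemma braid_words_Cons [simp]:
  "(i, e) # u \<in> braid_words m \<longleftrightarrow> 1 \<le> i \<and> i < m \<and> u \<in> braid_words m"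
  by (auto simp: braid_words_def)

lemma braid_words_append [simp]:
  "u @ v \<in> braid_words m \<longleftrightarrow> u \<in> braid_words m \<and> v \<in> braid_words m"
  by (simp add: braid_words_def)

abbreviation word_inverse :: "braid_word \<Rightarrow> braid_word" where
  "word_inverse u \<equiv> rev (map (apsnd Not) u)"

lemma word_inverse_words:
  assumes "u \<in> braid_words m"
  shows "word_inverse u \<in> braid_words m"
  using assms unfolding braid_words_iff by fastforce

lemma word_inverse_word_inverse: "word_inverse (word_inverse u) = u"
  by (induction u) (auto simp: rev_map)

lemma braid_word_inverse_right:
  assumes "u \<in> braid_words m"
  shows "braid_equiv m (u @ word_inverse u) []"
  using braid_word_inverse[OF word_inverse_words[OF assms]]
  by (simp add: word_inverse_word_inverse)

lemma braid_equiv_cancel_left: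
  assumes "braid_equiv m (w @ u) (w @ v)"
  shows "braid_equiv m u v"
proof -
  have W: "w \<in> braid_words m" "u \<in> braid_words m" "v \<in> braid_words m"
    using braid_equiv_words[OF assms] by simp_all
  have *: "braid_equiv m ((word_inverse w @ w) @ x) ([] @ x)" if "x \<in> braid_words m" for x
    by (rule braid_equiv_append[OF braid_word_inverse[OF W(1)] braid_equiv.refl[OF that]])
  have "braid_equiv m (word_inverse w @ w @ u) (word_inverse w @ w @ v)"
    by (rule braid_equiv_append[OF braid_equiv.refl[OF word_inverse_words[OF W(1)]] assms])
  from braid_equiv.trans[OF braid_equiv.sym[OF *[OF W(2), simplified]]
      braid_equiv.trans[OF this *[OF W(3), simplified]]]
  show ?thesis .
qed

lemma braid_equiv_swap_inverse:
  assumes "braid_equiv m (y @ x) (z @ y)"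
  shows "braid_equiv m (y @ word_inverse x) (word_inverse z @ y)"
proof -
  have W: "x \<in> braid_words m" "y \<in> braid_words m" "z \<in> braid_words m"
    "word_inverse x \<in> braid_words m" "word_inverse z \<in> braid_words m"
    using braid_equiv_words[OF assms] by (simp_all add: word_inverse_words)
  have "braid_equiv m (z @ y @ word_inverse x) (y @ x @ word_inverse x)"
    using braid_equiv_append[OF braid_equiv.sym[OF assms] braid_equiv.refl[OF W(4)]] by simp
  also have "braid_equiv m \<dots> y"
    using braid_equiv_append[OF braid_equiv.refl[OF W(2)] braid_word_inverse_right[OF W(1)]]
    by simp
  also have "braid_equiv m \<dots> (z @ word_inverse z @ y)"
    using braid_equiv.sym[OF braid_equiv_append[OF braid_word_inverse_right[OF W(3)]
      braid_equiv.refl[OF W(2)]]] by simp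
  finally show ?thesis by (rule braid_equiv_cancel_left)
qed

fun word_pos :: "braid_word \<Rightarrow> nat \<Rightarrow> nat" where
  "word_pos [] p = p"
| "word_pos ((i, e) # D) p = word_pos D (transpose i (i + 1) p)"

text \<open>Following strands downwards, as \<open>word_pos\<close> does, reverses the order of
  composition. Asking instead which strand ends at a given position makes concatenation of words
  into composition in the same order.\<close>

fun word_perm :: "braid_word \<Rightarrow> nat \<Rightarrow> nat" where
  "word_perm [] = id"
| "word_perm ((i, e) # D) = transpose i (i + 1) \<circ> word_perm D"

lemma word_pos_append: "word_pos (u @ v) p = word_pos v (word_pos u p)"
  by (induction u p rule: word_pos.induct) simp_all

lemma word_perm_append: "word_perm (u @ v) = word_perm u \<circ> word_perm v"
  by (induction u rule: word_perm.induct) (simp_all add: comp_assoc)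

lemma word_perm_word_pos [simp]: "word_perm D (word_pos D p) = p"
  by (induction D p rule: word_pos.induct) simp_all

lemma word_pos_word_perm [simp]: "word_pos D (word_perm D p) = p"
  by (induction D arbitrary: p rule: word_perm.induct) simp_all

lemma word_pos_eq_iff: "word_pos D = word_pos E \<longleftrightarrow> word_perm D = word_perm E"
proof
  assume "word_pos D = word_pos E"
  then show "word_perm D = word_perm E"
    by (metis ext word_perm_word_pos word_pos_word_perm)
next
  assume "word_perm D = word_perm E"
  then show "word_pos D = word_pos E"
    by (metis ext word_perm_word_pos word_pos_word_perm)
qed

lemma word_perm_permutes:
  assumes "D \<in> braid_words m"
  shows "word_perm D permutes {1..m}"
  using assms
proof (induction D rule: word_perm.induct)
  case 1
  show ?case unfolding word_perm.simps by (rule permutes_id)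
next
  case (2 i e D)
  then show ?case unfolding word_perm.simps
    by (intro permutes_compose permutes_swap_id) auto
qed

lemma word_pos_in:
  assumes "D \<in> braid_words m" "p \<in> {1..m}"
  shows "word_pos D p \<in> {1..m}"
  by (metis assms permutes_in_image word_perm_permutes word_perm_word_pos)

lemma braid_equiv_word_pos:
  assumes "braid_equiv m u v"
  shows "word_pos u = word_pos v"
  using assms
proof (induction rule: braid_equiv.induct)
  case (cong u v a b)
  then show ?case by (simp add: fun_eq_iff word_pos_append)
next
  case (commute i j)
  then show ?case by (auto simp: fun_eq_iff transpose_def)
next
  case (braid i)
  then show ?case by (auto simp: fun_eq_iff transpose_def)
qed (auto simp: fun_eq_iff)

lemma braid_equiv_word_perm:
  assumes "braid_equiv m u v"
  shows "word_perm u = word_perm v"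
  using braid_equiv_word_pos[OF assms] by (simp add: word_pos_eq_iff)

section \<open>Pulling a good strand to the left\<close>

abbreviation shift_word :: "braid_word \<Rightarrow> braid_word" where
  "shift_word \<equiv> map (apfst Suc)"

lemma braid_equiv_shift:
  assumes "braid_equiv m u v"
  shows "braid_equiv (Suc m) (shift_word u) (shift_word v)"
  using assms
proof (induction rule: braid_equiv.induct)
  case (refl u)
  then show ?case by (intro braid_equiv.refl) (fastforce simp: braid_words_iff)
next
  case (sym u v)
  from braid_equiv.sym[OF sym.IH] show ?case .
next
  case (trans u v w)
  from trans.IH show ?case by (rule braid_equiv.trans)
next
  case (cong u v a b)
  have "shift_word w \<in> braid_words (Suc m)" if "w \<in> braid_words m" for w
    using that by (fastforce simp: braid_words_iff)
  from braid_equiv.cong[OF cong.IH this[OF cong.hyps(2)] this[OF cong.hyps(3)]]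
  show ?case by simp
next
  case (cancel i e)
  then show ?case using braid_equiv.cancel[of "Suc i" "Suc m" e] by simp
next
  case (commute i j)
  then show ?case using braid_equiv.commute[of "Suc i" "Suc j" "Suc m"] by simp
next
  case (braid i)
  then show ?case using braid_equiv.braid[of "Suc i" "Suc m"] by simp
qed

text \<open>Moves the strand at position \<open>1\<close> over the others to position \<open>p\<close>.\<close>

definition slide :: "nat \<Rightarrow> braid_word" where
  "slide p = map (\<lambda>j. (j, True)) [1..<p]"

lemma slide_Suc: "1 \<le> p \<Longrightarrow> slide (Suc p) = slide p @ [(p, True)]"
  by (simp add: slide_def)

lemma slide_words: "p \<le> m \<Longrightarrow> slide p \<in> braid_words m"
  by (auto simp: slide_def braid_words_iff)

lemma braid_equiv_commute:
  assumes "1 \<le> i" "i < m" "1 \<le> j" "j < m" "i + 1 < j \<or> j + 1 < i"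
  shows "braid_equiv m [(i, True), (j, True)] [(j, True), (i, True)]"
  using assms by (auto intro: braid_equiv.commute braid_equiv.sym[OF braid_equiv.commute])

lemma slide_commute:
  assumes "p \<le> j" "1 \<le> p" "j + 1 < m"
  shows "braid_equiv m (slide p @ [(j + 1, True)]) ((j + 1, True) # slide p)"
  using assms(2,1)
proof (induction p rule: dec_induct)
  case base
  then show ?case using assms by (simp add: slide_def braid_equiv.refl)
next
  case (step p)
  have W: "slide p \<in> braid_words m"
    using step assms by (intro slide_words) simp
  have "braid_equiv m (slide p @ [(p, True), (j + 1, True)]) (slide p @ [(j + 1, True), (p, True)])"
    using step assms by (intro braid_equiv_append braid_equiv.refl W braid_equiv_commute) auto
  moreover have "braid_equiv m ((slide p @ [(j + 1, True)]) @ [(p, True)])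
      (((j + 1, True) # slide p) @ [(p, True)])"
    using step assms by (intro braid_equiv_append braid_equiv.refl) auto
  ultimately show ?case
    using step(1) by (simp add: slide_Suc) (rule braid_equiv.trans)
qed

text \<open>The crossing lies under the sliding strand. One braid move, at the two letters where the
  slide passes it, pulls the strand through, and all other letters commute. The index grows by one
  because the strand is now still to the left of the crossing when it happens.\<close>

lemma slide_conj:
  assumes "1 \<le> i" "i + 1 < p" "p \<le> m"
  shows "braid_equiv m (slide p @ [(i, True)]) ((i + 1, True) # slide p)"
proof -
  have "i + 2 \<le> p" using assms by simp
  then show ?thesis using \<open>p \<le> m\<close>
  proof (induction p rule: dec_induct)
    case base
    have W: "slide i \<in> braid_words m"
      using base by (intro slide_words) simp
    have e: "slide (i + 2) = slide i @ [(i, True), (i + 1, True)]"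
      using assms(1) slide_Suc[of "i + 1"] by (simp add: slide_Suc)
    have "braid_equiv m (slide i @ [(i, True), (i + 1, True), (i, True)])
        (slide i @ [(i + 1, True), (i, True), (i + 1, True)])"
      using base assms by (intro braid_equiv_append braid_equiv.refl W braid_equiv.braid) auto
    moreover have "braid_equiv m ((slide i @ [(i + 1, True)]) @ [(i, True), (i + 1, True)])
        (((i + 1, True) # slide i) @ [(i, True), (i + 1, True)])"
      using base assms by (intro braid_equiv_append braid_equiv.refl slide_commute) auto
    ultimately show ?case unfolding e by simp (rule braid_equiv.trans)
  next
    case (step p)
    have W: "slide p \<in> braid_words m"
      using step by (intro slide_words) simp
    have "braid_equiv m (slide p @ [(p, True), (i, True)]) (slide p @ [(i, True), (p, True)])"
      using step assms by (intro braid_equiv_append braid_equiv.refl W braid_equiv_commute) auto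
    moreover have "braid_equiv m ((slide p @ [(i, True)]) @ [(p, True)])
        (((i + 1, True) # slide p) @ [(p, True)])"
      using step assms by (intro braid_equiv_append braid_equiv.refl step.IH) auto
    ultimately show ?case
      using step(1) by (simp add: slide_Suc) (rule braid_equiv.trans)
  qed
qed

lemma slide_letter:
  assumes "braid_equiv m (slide p @ [(i, True)]) ((j, True) # slide p)"
  shows "braid_equiv m (slide p @ [(i, e)]) ((j, e) # slide p)"
  using assms braid_equiv_swap_inverse[of m "slide p" "[(i, True)]" "[(j, True)]"]
  by (cases e) simp_all

lemma remove_strand_words:
  assumes "D \<in> braid_words (Suc m)" "p \<in> {1..Suc m}"
  shows "remove_strand p D \<in> braid_words m"
  using assms
proof (induction p D rule: remove_strand.induct)
  case (2 p i e D)
  then show ?case by (auto simp: transpose_def)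
qed simp

text \<open>A strand that slides over the others to \<open>p\<close> and then follows the good
  strand lies above everything. It can be kept at position 1 until the other strands have finished
  crossing. A crossing of \<open>D\<close> with the good strand just lengthens or shortens the slide
  by one letter.\<close>

lemma good_strand_slide:
  assumes "D \<in> braid_words (Suc m)" "p \<in> {1..Suc m}" "good_strand p D"
  shows "braid_equiv (Suc m) (slide p @ D)
    (shift_word (remove_strand p D) @ slide (word_pos D p))"
  using assms
proof (induction p D rule: remove_strand.induct)
  case (1 p)
  then show ?case by (simp add: braid_equiv.refl slide_words)
next
  case (2 p i e D)
  have i: "1 \<le> i" "i \<le> m" and D: "D \<in> braid_words (Suc m)"
    using "2.prems"(1) by simp_all
  have R: "braid_equiv (Suc m) D D"
    by (rule braid_equiv.refl[OF D])
  consider (left) "p = i" | (right) "p = i + 1" | (before) "p < i" | (after) "p > i + 1" by linarith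
  then show ?case
  proof cases
    case left
    have "e" using left "2.prems"(3) by simp
    have IH: "braid_equiv (Suc m) (slide (i + 1) @ D)
        (shift_word (remove_strand (i + 1) D) @ slide (word_pos D (i + 1)))"
    proof -
      have q: "transpose i (i + 1) p = i + 1" using left by simp
      have "good_strand (i + 1) D" using "2.prems"(3) left by simp
      then show ?thesis using "2.IH"(1)[unfolded q, OF _ D] left i by simp
    qed
    have e1: "slide p @ (i, e) # D = slide (i + 1) @ D"
      using left i \<open>e\<close> by (simp add: slide_Suc)
    have e2: "remove_strand p ((i, e) # D) = remove_strand (i + 1) D"
      "word_pos ((i, e) # D) p = word_pos D (i + 1)"
      by (simp_all add: left)
    show ?thesis unfolding e1 e2 by (rule IH)
  next
    case right
    have "\<not> e" using right "2.prems"(3) by simp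
    have IH: "braid_equiv (Suc m) (slide i @ D)
        (shift_word (remove_strand i D) @ slide (word_pos D i))"
    proof -
      have q: "transpose i (i + 1) p = i" using right by simp
      have "good_strand i D" using "2.prems"(3) right by simp
      then show ?thesis using "2.IH"(1)[unfolded q, OF _ D] right i by simp
    qed
    have "braid_equiv (Suc m) (slide i @ [(i, True), (i, \<not> True)] @ D) (slide i @ [] @ D)"
      using i by (intro braid_equiv.cong braid_equiv.cancel slide_words D) auto
    moreover have "slide p @ (i, e) # D = slide i @ [(i, True), (i, \<not> True)] @ D"
      using right i \<open>\<not> e\<close> by (simp add: slide_Suc)
    ultimately have "braid_equiv (Suc m) (slide p @ (i, e) # D) (slide i @ D)"
      by simp
    also note IH
    finally show ?thesis using right by simp
  next
    case before
    have IH: "braid_equiv (Suc m) (slide p @ D)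
        (shift_word (remove_strand p D) @ slide (word_pos D p))"
    proof -
      have q: "transpose i (i + 1) p = p" using before by simp
      have "good_strand p D" using "2.prems"(3) unfolding good_strand.simps q by blast
      then show ?thesis using "2.IH"(2)[OF _ D "2.prems"(2)] before by simp
    qed
    have "braid_equiv (Suc m) (slide p @ [(i, True)]) ((i, True) # slide p)"
      using slide_commute[of p "i - 1" "Suc m"] before i "2.prems"(2) by simp
    then have "braid_equiv (Suc m) ((slide p @ [(i, e)]) @ D) (((i, e) # slide p) @ D)"
      by (rule braid_equiv_append[OF slide_letter R])
    then have "braid_equiv (Suc m) (slide p @ (i, e) # D) ([(i, e)] @ slide p @ D)"
      by simp
    also have "braid_equiv (Suc m) ([(i, e)] @ slide p @ D)
        ([(i, e)] @ shift_word (remove_strand p D) @ slide (word_pos D p))"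
      using i by (intro braid_equiv_append[OF _ IH] braid_equiv.refl) simp
    finally show ?thesis using before by simp
  next
    case after
    have IH: "braid_equiv (Suc m) (slide p @ D)
        (shift_word (remove_strand p D) @ slide (word_pos D p))"
    proof -
      have q: "transpose i (i + 1) p = p" using after by simp
      have "good_strand p D" using "2.prems"(3) unfolding good_strand.simps q by blast
      then show ?thesis using "2.IH"(2)[OF _ D "2.prems"(2)] after by simp
    qed
    have "braid_equiv (Suc m) (slide p @ [(i, True)]) ((i + 1, True) # slide p)"
      using slide_conj[of i p "Suc m"] after i "2.prems"(2) by simp
    then have "braid_equiv (Suc m) ((slide p @ [(i, e)]) @ D) (((i + 1, e) # slide p) @ D)"
      by (rule braid_equiv_append[OF slide_letter R])
    then have "braid_equiv (Suc m) (slide p @ (i, e) # D) ([(i + 1, e)] @ slide p @ D)"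
      by simp
    also have "braid_equiv (Suc m) ([(i + 1, e)] @ slide p @ D)
        ([(i + 1, e)] @ shift_word (remove_strand p D) @ slide (word_pos D p))"
      using i after "2.prems"(2) by (intro braid_equiv_append[OF _ IH] braid_equiv.refl) simp
    finally show ?thesis using after by simp
  qed
qed

section \<open>Layered diagrams\<close>

text \<open>The strand at position \<open>p\<close> has height \<open>a p\<close>, and a strand of smaller height passes over a strand
  of greater height.\<close>

fun layered :: "(nat \<Rightarrow> 'a::linorder) \<Rightarrow> braid_word \<Rightarrow> bool" where
  "layered a [] \<longleftrightarrow> True"
| "layered a ((i, e) # D) \<longleftrightarrow> (e \<longleftrightarrow> a i < a (i + 1)) \<and> layered (a \<circ> transpose i (i + 1)) D"

fun layer :: "(nat \<Rightarrow> 'a::linorder) \<Rightarrow> braid_word \<Rightarrow> braid_word" where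
  "layer a [] = []"
| "layer a ((i, e) # D) = (i, a i < a (i + 1)) # layer (a \<circ> transpose i (i + 1)) D"

text \<open>Translates positions in the diagram without the strand at \<open>p\<close> back to
  positions in the full diagram.\<close>

definition skip :: "nat \<Rightarrow> nat \<Rightarrow> nat" where
  "skip p k = (if k < p then k else Suc k)"

lemma inj_skip: "inj (skip p)"
  by (auto simp: skip_def inj_def split: if_splits)

lemma layered_append:
  "layered a (u @ v) \<longleftrightarrow> layered a u \<and> layered (a \<circ> word_perm u) v"
  by (induction a u rule: layered.induct) (simp_all add: comp_def)

lemma layered_layer [simp]: "layered a (layer a D)"
  by (induction a D rule: layer.induct) (simp_all add: comp_def)

lemma map_fst_layer [simp]: "map fst (layer a D) = map fst D"
  by (induction a D rule: layer.induct) (simp_all add: comp_def)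

lemma length_layer [simp]: "length (layer a D) = length D"
  by (induction a D rule: layer.induct) (simp_all add: comp_def)

lemma word_perm_layer [simp]: "word_perm (layer a D) = word_perm D"
  by (induction a D rule: layer.induct) (simp_all add: comp_def)

lemma layer_words [simp]: "layer a D \<in> braid_words m \<longleftrightarrow> D \<in> braid_words m"
  by (induction a D rule: layer.induct) (simp_all add: comp_def)

lemma skip_remove_strand:
  "skip (word_pos D p) (word_pos (remove_strand p D) k) = word_pos D (skip p k)"
proof (induction p D arbitrary: k rule: remove_strand.induct)
  case (2 p i e D)
  show ?case
  proof (cases "p = i \<or> p = i + 1")
    case True
    then have "transpose i (i + 1) (skip p k) = skip (transpose i (i + 1) p) k"
      by (auto simp: skip_def transpose_def)
    with True 2(1) show ?thesis by simp
  next
    case False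
    define j where "j = (if p < i then i - 1 else i)"
    have "transpose i (i + 1) (skip p k) = skip p (transpose j (j + 1) k)"
      using False by (auto simp: j_def skip_def transpose_def)
    with False 2(2) show ?thesis by (simp flip: j_def)
  qed
qed (simp add: skip_def)

text \<open>Any strand may go, not only the top one: the recursion of \<open>mikado\<close> has to
  succeed for every good strand.\<close>

lemma layered_remove_strand:
  assumes "layered a D"
  shows "layered (a \<circ> skip p) (remove_strand p D)"
  using assms
proof (induction p D arbitrary: a rule: remove_strand.induct)
  case (2 p i e D)
  show ?case
  proof (cases "p = i \<or> p = i + 1")
    case True
    then have "transpose i (i + 1) (skip (transpose i (i + 1) p) k) = skip p k" for k
      by (auto simp: skip_def transpose_def)
    with True 2(1)[of "a \<circ> transpose i (i + 1)"] 2(3) show ?thesis by (simp add: comp_def)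
  next
    case False
    define j where "j = (if p < i then i - 1 else i)"
    have "transpose i (i + 1) (skip p k) = skip p (transpose j (j + 1) k)"
      and "skip p j = i" "skip p (j + 1) = i + 1" for k
      using False by (auto simp: j_def skip_def transpose_def)
    with False 2(2)[of "a \<circ> transpose i (i + 1)"] 2(3) show ?thesis
      by (simp add: comp_def flip: j_def)
  qed
qed simp

lemma layered_good_strand:
  assumes "layered a D" "D \<in> braid_words m" "\<And>q. q \<in> {1..m} \<Longrightarrow> q \<noteq> p \<Longrightarrow> a p < a q"
  shows "good_strand p D"
  using assms
proof (induction p D arbitrary: a rule: good_strand.induct)
  case (2 p i e D)
  have i: "i \<in> {1..m}" "i + 1 \<in> {1..m}" using 2 by auto
  have "good_strand (transpose i (i + 1) p) D"
  proof (rule "2.IH")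
    fix q assume "q \<in> {1..m}" "q \<noteq> transpose i (i + 1) p"
    then show "(a \<circ> transpose i (i + 1)) (transpose i (i + 1) p) < (a \<circ> transpose i (i + 1)) q"
      using "2.prems"(3)[of "transpose i (i + 1) q"] i by (auto simp: transpose_def)
  next
    show "layered (a \<circ> transpose i (i + 1)) D" "D \<in> braid_words m"
      using "2.prems" unfolding layered.simps by simp_all
  qed
  moreover have "p = i \<longrightarrow> e" "p = i + 1 \<longrightarrow> \<not> e"
    using "2.prems"(1,3) i by (auto dest: less_imp_not_less)
  ultimately show ?case by simp
qed simp

lemma ex_top_strand:
  fixes a :: "nat \<Rightarrow> 'a::linorder"
  assumes "inj_on a {1..Suc m}"
  obtains p where "p \<in> {1..Suc m}" "\<And>q. q \<in> {1..Suc m} \<Longrightarrow> q \<noteq> p \<Longrightarrow> a p < a q"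
proof -
  have "Min (a ` {1..Suc m}) \<in> a ` {1..Suc m}" by (rule Min_in) auto
  then obtain p where p: "Min (a ` {1..Suc m}) = a p" "p \<in> {1..Suc m}"
    by (rule imageE)
  have "a p < a q" if "q \<in> {1..Suc m}" "q \<noteq> p" for q
  proof -
    have "a p \<le> a q" using that by (simp flip: p(1))
    moreover have "a p \<noteq> a q" using inj_onD[OF assms _ p(2) that(1)] that(2) by auto
    ultimately show ?thesis by simp
  qed
  with p(2) that show thesis by blast
qed

lemma inj_on_skip:
  assumes "inj_on a {1..Suc m}" "p \<in> {1..Suc m}"
  shows "inj_on (a \<circ> skip p) {1..m}"
  by (rule comp_inj_on[OF inj_on_subset[OF inj_skip] inj_on_subset[OF assms(1)]])
    (use assms(2) in \<open>auto simp: skip_def\<close>)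

text \<open>Induction on the number of strands, by pulling the top strand out of both diagrams.\<close>

theorem layered_unique:
  fixes a :: "nat \<Rightarrow> 'a::linorder"
  assumes "inj_on a {1..m}" "D \<in> braid_words m" "E \<in> braid_words m"
    "layered a D" "layered a E" "word_perm D = word_perm E"
  shows "braid_equiv m D E"
  using assms
proof (induction m arbitrary: a D E)
  case 0
  then have "D = []" "E = []" by (auto simp: braid_words_def)
  then show ?case by (simp add: braid_equiv.refl)
next
  case (Suc m)
  obtain p where p: "p \<in> {1..Suc m}" "\<And>q. q \<in> {1..Suc m} \<Longrightarrow> q \<noteq> p \<Longrightarrow> a p < a q"
    using ex_top_strand[OF Suc.prems(1)] by blast
  have pos: "word_pos D = word_pos E"
    using Suc.prems(6) by (simp add: word_pos_eq_iff)
  have "word_pos (remove_strand p D) k = word_pos (remove_strand p E) k" for k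
    using skip_remove_strand[of D p k] skip_remove_strand[of E p k] injD[OF inj_skip]
    unfolding pos by metis
  then have perm: "word_perm (remove_strand p D) = word_perm (remove_strand p E)"
    unfolding word_pos_eq_iff[symmetric] by (rule ext)
  have "braid_equiv m (remove_strand p D) (remove_strand p E)"
    using Suc.prems p(1)
    by (intro Suc.IH[OF inj_on_skip[OF Suc.prems(1) p(1)]] remove_strand_words
        layered_remove_strand perm)
  then have "braid_equiv (Suc m) (shift_word (remove_strand p D) @ slide (word_pos D p))
      (shift_word (remove_strand p E) @ slide (word_pos E p))"
    unfolding pos using word_pos_in[OF Suc.prems(3) p(1)]
    by (intro braid_equiv_append braid_equiv_shift braid_equiv.refl slide_words) auto
  moreover have "good_strand p D" "good_strand p E"
    using layered_good_strand[OF Suc.prems(4,2)] layered_good_strand[OF Suc.prems(5,3)] p(2)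
    by auto
  ultimately have "braid_equiv (Suc m) (slide p @ D) (slide p @ E)"
    using good_strand_slide Suc.prems(2,3) p(1) by (meson braid_equiv.sym braid_equiv.trans)
  then show ?case by (rule braid_equiv_cancel_left)
qed

section \<open>Inversions\<close>

definition inv_set :: "nat \<Rightarrow> (nat \<Rightarrow> 'a::linorder) \<Rightarrow> (nat \<times> nat) set" where
  "inv_set m f = {(p, q). 1 \<le> p \<and> p < q \<and> q \<le> m \<and> f q < f p}"

lemma finite_inv_set [simp]: "finite (inv_set m f)"
  by (rule finite_subset[of _ "{..m} \<times> {..m}"]) (auto simp: inv_set_def)

lemma inv_set_id [simp]: "inv_set m id = {}"
  by (auto simp: inv_set_def)

lemma transpose_less:
  assumes "p < q" "(p, q) \<noteq> (i, Suc i)"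
  shows "transpose i (Suc i) p < transpose i (Suc i) q"
  using assms by (auto simp: transpose_def)

text \<open>The transposition permutes the pairs of positions and keeps the order of each pair
  except \<open>(i, i + 1)\<close>, which becomes the only additional inversion.\<close>

lemma card_inv_set_up:
  assumes "1 \<le> i" "i < m" "f i < f (i + 1)"
  shows "card (inv_set m (f \<circ> transpose i (i + 1))) = Suc (card (inv_set m f))"
proof -
  let ?t = "transpose i (Suc i)"
  have t: "?t p \<in> {1..m} \<longleftrightarrow> p \<in> {1..m}" for p
    using assms(1,2) by (auto simp: transpose_def)
  have new: "(i, Suc i) \<notin> map_prod ?t ?t ` inv_set m f"
  proof
    assume "(i, Suc i) \<in> map_prod ?t ?t ` inv_set m f"
    then obtain p q where pq: "(p, q) \<in> inv_set m f" "?t p = i" "?t q = Suc i" by auto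
    then have "p = Suc i" "q = i" by (auto simp: transpose_def split: if_splits)
    with pq(1) show False by (simp add: inv_set_def)
  qed
  have "inv_set m (f \<circ> ?t) = insert (i, Suc i) (map_prod ?t ?t ` inv_set m f)"
  proof (intro equalityI subsetI)
    fix z assume "z \<in> inv_set m (f \<circ> ?t)"
    then obtain p q where z: "z = (p, q)" "1 \<le> p" "p < q" "q \<le> m" "f (?t q) < f (?t p)"
      by (auto simp: inv_set_def)
    show "z \<in> insert (i, Suc i) (map_prod ?t ?t ` inv_set m f)"
    proof (cases "z = (i, Suc i)")
      case False
      with z have "?t p < ?t q" by (intro transpose_less) auto
      with z t[of p] t[of q] have "(?t p, ?t q) \<in> inv_set m f" by (auto simp: inv_set_def)
      then have "map_prod ?t ?t (?t p, ?t q) \<in> map_prod ?t ?t ` inv_set m f" by (rule imageI)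
      with z(1) show ?thesis by simp
    qed simp
  next
    fix z assume z: "z \<in> insert (i, Suc i) (map_prod ?t ?t ` inv_set m f)"
    show "z \<in> inv_set m (f \<circ> ?t)"
    proof (cases "z = (i, Suc i)")
      case True
      with assms show ?thesis by (simp add: inv_set_def)
    next
      case False
      with z obtain p q where pq: "(p, q) \<in> inv_set m f" "z = (?t p, ?t q)" by auto
      have "(p, q) \<noteq> (i, Suc i)" using pq(1) assms(3) by (auto simp: inv_set_def)
      then have "?t p < ?t q" using pq(1) by (intro transpose_less) (auto simp: inv_set_def)
      with pq t[of p] t[of q] show ?thesis by (auto simp: inv_set_def)
    qed
  qed
  moreover have "inj_on (map_prod ?t ?t) (inv_set m f)"
    by (auto intro!: inj_onI dest: injD[OF inj_transpose])
  ultimately show ?thesis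
    using new by (simp add: card_image)
qed

lemma card_inv_set_down:
  assumes "1 \<le> i" "i < m" "f (i + 1) < f i"
  shows "card (inv_set m f) = Suc (card (inv_set m (f \<circ> transpose i (i + 1))))"
proof -
  have "(f \<circ> transpose i (i + 1)) \<circ> transpose i (i + 1) = f"
    by (simp add: comp_assoc)
  with card_inv_set_up[of i m "f \<circ> transpose i (i + 1)"] assms show ?thesis by simp
qed

lemma permutes_eqI_ascending:
  fixes m :: nat
  assumes "x permutes {1..m}" "\<And>i. 1 \<le> i \<Longrightarrow> i < m \<Longrightarrow> x i < x (i + 1)"
  shows "x = id"
proof
  have ge: "k \<le> x k" if "1 \<le> k" "k \<le> m" for k
    using that
  proof (induction k rule: dec_induct)
    case base
    then show ?case using permutes_in_image[OF assms(1), of 1] by simp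
  next
    case (step k)
    then show ?case using assms(2)[of k] by simp
  qed
  have le: "x k \<le> k" if "k \<le> m" "1 \<le> k" for k
    using that
  proof (induction k rule: inc_induct)
    case base
    then show ?case using permutes_in_image[OF assms(1), of m] by simp
  next
    case (step k)
    then show ?case using assms(2)[of k] by simp
  qed
  show "x k = id k" for k
    using ge[of k] le[of k] permutes_not_in[OF assms(1), of k] by fastforce
qed

lemma permutes_inj_on: "x permutes S \<Longrightarrow> inj_on x T"
  by (meson inj_on_subset permutes_inj subset_UNIV)

lemma permutes_ex_descent:
  fixes m :: nat
  assumes "x permutes {1..m}" "x \<noteq> id"
  obtains i where "1 \<le> i" "i < m" "x (i + 1) < x i"
proof -
  have "x i \<noteq> x (i + 1)" for i
    using injD[OF permutes_inj[OF assms(1)], of i "i + 1"] by auto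
  then show thesis
    using permutes_eqI_ascending[OF assms(1)] assms(2) that by (metis linorder_neqE_nat)
qed

section \<open>Positive lifts of permutations\<close>

definition positive :: "braid_word \<Rightarrow> braid_word" where
  "positive D = map (apsnd (\<lambda>_. True)) D"

lemma positive_simps [simp]:
  "positive [] = []" "positive ((i, e) # D) = (i, True) # positive D"
  "positive (D @ E) = positive D @ positive E" "length (positive D) = length D"
  by (simp_all add: positive_def)

lemma word_perm_positive [simp]: "word_perm (positive D) = word_perm D"
  by (induction D rule: word_perm.induct) simp_all

lemma positive_words [simp]: "positive D \<in> braid_words m \<longleftrightarrow> D \<in> braid_words m"
  by (induction D) auto

text \<open>\<open>adds a x\<close> expresses that no pair inverted by \<open>x\<close> is put back in order by \<open>a\<close>; for permutations
  this means that the lengths of \<open>a\<close> and \<open>x\<close> add up in \<open>a \<circ> x\<close>.\<close>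

definition adds :: "nat \<Rightarrow> (nat \<Rightarrow> 'a::linorder) \<Rightarrow> (nat \<Rightarrow> nat) \<Rightarrow> bool" where
  "adds m a x \<longleftrightarrow> inv_set m x \<subseteq> inv_set m (a \<circ> x)"

lemma adds_id [simp]: "adds m id x"
  by (simp add: adds_def)

text \<open>The word is built from the right, one descent of \<open>x\<close> at a time.
  \<open>adds m a x\<close> says that of two strands that cross, the left one has the smaller
  height, so every letter has to be positive. A single word serves all such heights;
  \<open>perm_word_comp\<close> uses it with heights other than \<open>id\<close>.\<close>

lemma ex_permutation_word:
  assumes "x permutes {1..m}"
  shows "\<exists>X \<in> braid_words m. positive X = X \<and> word_perm X = x \<and> length X = card (inv_set m x) \<and>
    (\<forall>a :: nat \<Rightarrow> nat. adds m a x \<longrightarrow> layered a X)"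
  using assms
proof (induction "card (inv_set m x)" arbitrary: x rule: less_induct)
  case less
  show ?case
  proof (cases "x = id")
    case True
    then have "inv_set m x = {}" by (simp only: inv_set_id)
    with True show ?thesis by (intro bexI[of _ "[]"]) auto
  next
    case False
    then obtain i where i: "1 \<le> i" "i < m" "x (i + 1) < x i"
      using permutes_ex_descent[OF less.prems] by blast
    let ?t = "transpose i (i + 1)"
    have x: "x = (x \<circ> ?t) \<circ> ?t" by (simp add: comp_assoc)
    have card: "card (inv_set m x) = Suc (card (inv_set m (x \<circ> ?t)))"
      by (rule card_inv_set_down[OF i])
    have "x \<circ> ?t permutes {1..m}"
      using i by (intro permutes_compose[OF permutes_swap_id less.prems]) auto
    with less.hyps card obtain X where X: "X \<in> braid_words m" "positive X = X"
      "word_perm X = x \<circ> ?t" "length X = card (inv_set m (x \<circ> ?t))"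
      "\<And>a :: nat \<Rightarrow> nat. adds m a (x \<circ> ?t) \<Longrightarrow> layered a X"
      by fastforce
    have "layered a (X @ [(i, True)])" if a: "adds m a x" for a :: "nat \<Rightarrow> nat"
    proof -
      have a: "a (x q) < a (x p)" if "1 \<le> p" "p < q" "q \<le> m" "x q < x p" for p q
        using a that unfolding adds_def inv_set_def by auto
      have "adds m a (x \<circ> ?t)"
        unfolding adds_def
      proof (clarsimp simp: inv_set_def)
        fix p q assume pq: "Suc 0 \<le> p" "p < q" "q \<le> m"
          "x (transpose i (Suc i) q) < x (transpose i (Suc i) p)"
        have "(p, q) \<noteq> (i, Suc i)" using pq(4) i(3) by auto
        then have "?t p < ?t q" using pq(2) transpose_less by simp
        moreover have "1 \<le> ?t p" "?t q \<le> m"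
          using pq i by (auto simp: transpose_def)
        ultimately show "a (x (transpose i (Suc i) q)) < a (x (transpose i (Suc i) p))"
          using a[of "?t p" "?t q"] pq(4) by simp
      qed
      then show ?thesis
        using X(5) a[of i "i + 1"] i by (simp add: layered_append X(3))
    qed
    moreover have "word_perm (X @ [(i, True)]) = x"
      using x by (simp add: word_perm_append X(3))
    ultimately show ?thesis
      using X i card by (intro bexI[of _ "X @ [(i, True)]"]) auto
  qed
qed

text \<open>The choice is immaterial: by \<open>perm_word_eq\<close> every word layered by
  \<open>id\<close> with permutation \<open>x\<close> represents the same braid, the positive lift
  of \<open>x\<close>.\<close>

definition perm_word :: "nat \<Rightarrow> (nat \<Rightarrow> nat) \<Rightarrow> braid_word" where
  "perm_word m x = (SOME X. X \<in> braid_words m \<and> positive X = X \<and> word_perm X = x \<and>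
    length X = card (inv_set m x) \<and> (\<forall>a :: nat \<Rightarrow> nat. adds m a x \<longrightarrow> layered a X))"

lemma perm_word:
  assumes "x permutes {1..m}"
  shows "perm_word m x \<in> braid_words m" "positive (perm_word m x) = perm_word m x"
    "word_perm (perm_word m x) = x" "length (perm_word m x) = card (inv_set m x)"
    "\<And>a :: nat \<Rightarrow> nat. adds m a x \<Longrightarrow> layered a (perm_word m x)"
  using someI_ex[of "\<lambda>X. X \<in> braid_words m \<and> positive X = X \<and> word_perm X = x \<and>
      length X = card (inv_set m x) \<and> (\<forall>a :: nat \<Rightarrow> nat. adds m a x \<longrightarrow> layered a X)"]
    ex_permutation_word[OF assms]
  unfolding perm_word_def[symmetric] by blast+

lemma perm_word_eq:
  assumes "D \<in> braid_words m" "layered id D"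
  shows "braid_equiv m D (perm_word m (word_perm D))"
proof -
  note P = perm_word[OF word_perm_permutes[OF assms(1)]]
  show ?thesis
    by (rule layered_unique[OF _ assms(1) P(1) assms(2) P(5)]) (simp_all add: P(3))
qed

lemma perm_word_comp:
  assumes "y permutes {1..m}" "x permutes {1..m}" "adds m y x"
  shows "braid_equiv m (perm_word m y @ perm_word m x) (perm_word m (y \<circ> x))"
  using perm_word_eq[of "perm_word m y @ perm_word m x" m] perm_word[OF assms(1)]
    perm_word[OF assms(2)] assms(3)
  by (simp add: word_perm_append layered_append)

lemma inj_on_comp_transpose:
  fixes m :: nat
  assumes "inj_on a {1..m}" "1 \<le> i" "i < m"
  shows "inj_on (a \<circ> transpose i (i + 1)) {1..m}"
proof -
  have t: "transpose i (i + 1) permutes {1..m}" using assms(2,3) by (intro permutes_swap_id) auto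
  show ?thesis
    using assms(1) permutes_image[OF t] by (intro comp_inj_on permutes_inj_on[OF t]) simp
qed

text \<open>Each letter changes the number of inversions of the heights by exactly one. The bound is
  attained only if every letter meets an ascent, which is what a layered word with positive letters
  does.\<close>

lemma card_inv_set_word:
  fixes a :: "nat \<Rightarrow> 'a::linorder"
  assumes "inj_on a {1..m}" "D \<in> braid_words m"
  shows "card (inv_set m (a \<circ> word_perm D)) \<le> card (inv_set m a) + length D"
    "card (inv_set m (a \<circ> word_perm D)) = card (inv_set m a) + length D \<Longrightarrow>
      layered a (positive D)"
proof -
  have "card (inv_set m (a \<circ> word_perm D)) \<le> card (inv_set m a) + length D \<and>
    (card (inv_set m (a \<circ> word_perm D)) = card (inv_set m a) + length D \<longrightarrow>
      layered a (positive D))"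
    using assms
  proof (induction D arbitrary: a rule: word_perm.induct)
    case (2 i e D)
    let ?t = "transpose i (i + 1)"
    have i: "1 \<le> i" "i < m" "D \<in> braid_words m" using 2 by auto
    note IH = "2.IH"[OF inj_on_comp_transpose[OF 2(2) i(1,2)] i(3)]
    have e: "a \<circ> word_perm ((i, e) # D) = (a \<circ> ?t) \<circ> word_perm D"
      by (simp add: comp_assoc)
    have "a i \<noteq> a (i + 1)" using inj_onD[OF 2(2), of i "i + 1"] i by auto
    then consider "a i < a (i + 1)" | "a (i + 1) < a i" by (meson linorder_neqE)
    then show ?case
    proof cases
      case 1
      then show ?thesis using IH card_inv_set_up[OF i(1,2) 1] unfolding e by (simp add: comp_def)
    next
      case 2
      then show ?thesis using IH card_inv_set_down[OF i(1,2) 2] unfolding e by (simp add: comp_def)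
    qed
  qed simp
  then show "card (inv_set m (a \<circ> word_perm D)) \<le> card (inv_set m a) + length D"
    "card (inv_set m (a \<circ> word_perm D)) = card (inv_set m a) + length D \<Longrightarrow>
      layered a (positive D)" by blast+
qed

section \<open>Linking numbers\<close>

fun linking :: "nat \<Rightarrow> nat \<Rightarrow> braid_word \<Rightarrow> int" where
  "linking p q [] = 0"
| "linking p q ((i, e) # D) =
    (if {p, q} = {i, i + 1} then (if e then 1 else - 1) else 0) +
    linking (transpose i (i + 1) p) (transpose i (i + 1) q) D"

lemma linking_append:
  "linking p q (u @ v) = linking p q u + linking (word_pos u p) (word_pos u q) v"
  by (induction p q u rule: linking.induct) simp_all

lemma braid_equiv_linking:
  assumes "braid_equiv m u v"
  shows "linking p q u = linking p q v"
  using assms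
proof (induction arbitrary: p q rule: braid_equiv.induct)
  case (cong u v a b)
  then show ?case by (simp add: linking_append braid_equiv_word_pos[OF cong.hyps(1)])
next
  case (cancel i e)
  have "{transpose i (i + 1) p, transpose i (i + 1) q} = {i, i + 1} \<longleftrightarrow> {p, q} = {i, i + 1}"
    by (auto simp: transpose_def doubleton_eq_iff)
  then show ?case by simp
next
  case (commute i j)
  consider "p = i" | "p = i + 1" | "p = j" | "p = j + 1" | "p \<notin> {i, i + 1, j, j + 1}" by auto
  moreover consider "q = i" | "q = i + 1" | "q = j" | "q = j + 1" | "q \<notin> {i, i + 1, j, j + 1}"
    by auto
  ultimately show ?case using commute by cases (auto simp: transpose_def doubleton_eq_iff)
next
  case (braid i)
  consider "p = i" | "p = i + 1" | "p = i + 2" | "p < i \<or> i + 2 < p" by linarith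
  moreover consider "q = i" | "q = i + 1" | "q = i + 2" | "q < i \<or> i + 2 < q" by linarith
  ultimately show ?case by cases (auto simp: transpose_def doubleton_eq_iff)
qed simp_all

text \<open>In a positive layered word two strands cross only while the left one has the smaller
  height. Once their heights are inverted they never meet again.\<close>

lemma linking_inverted:
  assumes "layered a (positive D)" "p < q" "a q < a p"
  shows "linking p q D = 0"
  using assms
proof (induction p q D arbitrary: a rule: linking.induct)
  case (2 p q i e D)
  have "(p, q) \<noteq> (i, Suc i)" using "2.prems" by auto
  moreover from this have "{p, q} \<noteq> {i, i + 1}" using "2.prems"(2) by (auto simp: doubleton_eq_iff)
  moreover have "linking (transpose i (i + 1) p) (transpose i (i + 1) q) D = 0"
    using "2.prems" transpose_less[OF "2.prems"(2) calculation(1)]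
    by (intro "2.IH"[of "a \<circ> transpose i (i + 1)"]) (simp_all add: comp_def)
  ultimately show ?case by simp
qed simp

text \<open>In a diagram in which any two strands cross at most once, the linking number of two crossing
  strands is the sign of their crossing.\<close>

lemma linking_eqD:
  assumes "layered a (positive D)" "map fst D = map fst E" "\<And>p q. linking p q D = linking p q E"
  shows "D = E"
  using assms
proof (induction D arbitrary: a E rule: word_perm.induct)
  case 1
  then show ?case by simp
next
  case (2 i e D)
  then obtain f F where E: "E = (i, f) # F" "map fst D = map fst F" by auto
  let ?t = "transpose i (i + 1)"
  have a: "a i < a (i + 1)" "layered (a \<circ> ?t) (positive D)" using "2.prems"(1) by simp_all
  have "positive D = positive F"
    using E(2) by (induction D F rule: list_induct2') (auto simp: positive_def)
  then have "layered (a \<circ> ?t) (positive F)" using a(2) by simp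
  then have "linking i (i + 1) D = 0" "linking i (i + 1) F = 0"
    using a by (auto intro!: linking_inverted[of "a \<circ> ?t"])
  then have e: "e = f"
    using "2.prems"(3)[of "i + 1" i]
    by (auto simp: E(1) insert_commute split: if_splits)
  have "linking p q D = linking p q F" for p q
    using "2.prems"(3)[of "?t p" "?t q"] by (simp add: E(1) e)
  then have "D = F" by (rule "2.IH"[OF a(2) E(2)])
  with E(1) e show ?case by simp
qed

text \<open>Replace the signs of \<open>D\<close> by those that \<open>a\<close> dictates. By
  \<open>layered_unique\<close> the braid stays the same, so the linking numbers do too, and these
  determine the signs: nothing has been replaced.\<close>

lemma layered_linking:
  assumes "inj_on a {1..m}" "D \<in> braid_words m" "E \<in> braid_words m" "layered a E"
    "layered id (positive D)" "braid_equiv m D E"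
  shows "layered a D"
proof -
  have "braid_equiv m (layer a D) E"
    using assms by (intro layered_unique[OF assms(1)]) (simp_all add: braid_equiv_word_perm)
  then have "braid_equiv m D (layer a D)"
    using assms(6) by (meson braid_equiv.sym braid_equiv.trans)
  then have "D = layer a D"
    using braid_equiv_linking by (intro linking_eqD[OF assms(5)]) auto
  then show ?thesis by (metis layered_layer)
qed

text \<open>A permutation word with the signs that \<open>a\<close> dictates is a diagram of the
  same braid with one crossing per inversion. A reduced diagram is no longer than this, hence any
  two of its strands cross at most once and the linking numbers apply.\<close>

lemma reduced_diagram_layered:
  assumes "inj_on a {1..m}" "E \<in> braid_words m" "layered a E"
    "reduced_diagram (braid_class m E) D"
  shows "D \<in> braid_words m" "layered a D" "braid_equiv m E D"
proof -
  note P = perm_word[OF word_perm_permutes[OF assms(2)]]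
  let ?F = "layer a (perm_word m (word_perm E))"
  show ED: "braid_equiv m E D"
    using assms(4) by (simp add: reduced_diagram_def braid_class_def)
  then show D: "D \<in> braid_words m" by (rule braid_equiv_words)
  have "braid_equiv m E ?F"
    by (rule layered_unique[OF assms(1,2) _ assms(3)]) (simp_all add: P)
  then have "length D \<le> length ?F"
    using assms(4) unfolding reduced_diagram_def braid_class_def by blast
  then have "length D \<le> card (inv_set m (word_perm D))"
    using braid_equiv_word_perm[OF ED] P(4) by simp
  then have "layered id (positive D)"
    using card_inv_set_word[of id m D] D by simp
  then show "layered a D"
    by (rule layered_linking[OF assms(1) D assms(2,3) _ braid_equiv.sym[OF ED]])
qed

section \<open>Mikado braids are layered\<close>

definition layerable :: "nat \<Rightarrow> braid \<Rightarrow> bool" where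
  "layerable m \<beta> \<longleftrightarrow> (\<exists>(a :: nat \<Rightarrow> nat) D. inj_on a {1..m} \<and> D \<in> braid_words m \<and> layered a D \<and>
     \<beta> = braid_class m D)"

lemma ex_reduced_diagram:
  assumes "\<beta> \<in> carrier (braid_group m)"
  obtains D where "reduced_diagram \<beta> D" "D \<in> braid_words m" "\<beta> = braid_class m D"
proof -
  obtain u where u: "u \<in> braid_words m" "\<beta> = braid_class m u"
    using assms by (auto simp: braid_group_def)
  then have "u \<in> \<beta>" by (simp add: braid_class_def braid_equiv.refl)
  then obtain D where D: "D \<in> \<beta>" "\<And>E. E \<in> \<beta> \<Longrightarrow> length D \<le> length E"
    using ex_has_least_nat[of "\<lambda>D. D \<in> \<beta>" u length] by blast
  then have "braid_equiv m u D" using u(2) by (simp add: braid_class_def)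
  with D u that[of D] show thesis
    using braid_equiv_words(2) braid_class_eq_iff by (auto simp: reduced_diagram_def)
qed

text \<open>At every crossing the sign tells how \<open>a\<close> and \<open>b\<close> order the two
  strands, so the two functions agree there. They will be the heights of a symmetric braid and the
  mirror image of these heights.\<close>

lemma layered_mono2:
  assumes "inj_on a {1..m}" "D \<in> braid_words m" "layered a D" "inj_on b {1..m}" "layered b D"
    "\<And>p q. p \<in> {1..m} \<Longrightarrow> q \<in> {1..m} \<Longrightarrow> a p < a q \<Longrightarrow> b p < b q \<Longrightarrow> c p < c q"
  shows "layered c D"
  using assms
proof (induction D arbitrary: a b c rule: word_perm.induct)
  case (2 i e D)
  let ?t = "transpose i (i + 1)"
  have i: "1 \<le> i" "i < m" "D \<in> braid_words m" using "2.prems"(2) by auto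
  have t: "?t permutes {1..m}" using i by (intro permutes_swap_id) auto
  have "layered (c \<circ> ?t) D"
  proof (rule "2.IH"[OF inj_on_comp_transpose[OF "2.prems"(1) i(1,2)] i(3) _
        inj_on_comp_transpose[OF "2.prems"(4) i(1,2)]])
    show "layered (a \<circ> ?t) D" "layered (b \<circ> ?t) D"
      using "2.prems"(3,5) unfolding layered.simps by simp_all
    show "(c \<circ> ?t) p < (c \<circ> ?t) q" if "p \<in> {1..m}" "q \<in> {1..m}"
      "(a \<circ> ?t) p < (a \<circ> ?t) q" "(b \<circ> ?t) p < (b \<circ> ?t) q" for p q
    proof -
      have "?t p \<in> {1..m}" "?t q \<in> {1..m}" using that(1,2) permutes_in_image[OF t] by blast+
      then show ?thesis using "2.prems"(6) that(3,4) by simp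
    qed
  qed
  moreover have "e \<longleftrightarrow> c i < c (i + 1)"
  proof (cases e)
    case True
    then show ?thesis using "2.prems"(3,5,6) i unfolding layered.simps by simp
  next
    case False
    have "a i \<noteq> a (i + 1)" "b i \<noteq> b (i + 1)"
      using inj_onD[OF "2.prems"(1), of i "i + 1"] inj_onD[OF "2.prems"(4), of i "i + 1"] i by auto
    then have "a (i + 1) < a i" "b (i + 1) < b i"
      using "2.prems"(3,5) False unfolding layered.simps by (meson linorder_neqE)+
    then have "c (i + 1) < c i" using "2.prems"(6)[of "i + 1" i] i by simp
    with False show ?thesis by auto
  qed
  ultimately show ?case by simp
qed simp

lemma layered_mono:
  assumes "inj_on a {1..m}" "D \<in> braid_words m" "layered a D"
    "\<And>p q. p \<in> {1..m} \<Longrightarrow> q \<in> {1..m} \<Longrightarrow> a p < a q \<Longrightarrow> b p < b q"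
  shows "layered b D"
  using layered_mono2[OF assms(1-3) assms(1,3)] assms(4) by blast

lemma word_perm_word_inverse: "word_perm (word_inverse u) = word_pos u"
proof (induction u rule: word_perm.induct)
  case (2 i e D)
  then show ?case by (auto simp: word_perm_append fun_eq_iff)
qed auto

lemma layered_word_inverse:
  assumes "inj_on a {1..m}" "u \<in> braid_words m" "layered a u"
  shows "layered (a \<circ> word_perm u) (word_inverse u)"
  using assms
proof (induction u arbitrary: a rule: word_perm.induct)
  case (2 i e D)
  let ?t = "transpose i (i + 1)"
  have i: "1 \<le> i" "i < m" "D \<in> braid_words m" using "2.prems"(2) by auto
  note inj = inj_on_comp_transpose[OF "2.prems"(1) i(1,2)]
  have IH: "layered (a \<circ> ?t \<circ> word_perm D) (word_inverse D)"
    using "2.IH"[OF inj i(3)] "2.prems"(3) unfolding layered.simps by blast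
  have "a i \<noteq> a (i + 1)"
    using inj_onD[OF "2.prems"(1), of i "i + 1"] i by auto
  then have "\<not> e \<longleftrightarrow> a (i + 1) < a i"
    using "2.prems"(3) unfolding layered.simps by (metis less_asym linorder_neqE)
  with IH show ?case
    by (simp add: layered_append word_perm_word_inverse comp_def)
qed simp

lemma layered_shift: "layered a (shift_word D) \<longleftrightarrow> layered (a \<circ> Suc) D"
proof (induction D arbitrary: a rule: word_perm.induct)
  case (2 i e D)
  have "transpose (Suc i) (Suc (Suc i)) (Suc k) = Suc (transpose i (Suc i) k)" for k
    by (auto simp: transpose_def)
  with 2[of "a \<circ> transpose (Suc i) (Suc i + 1)"] show ?case by (simp add: comp_def)
qed simp

lemma word_perm_shift_1: "D \<in> braid_words m \<Longrightarrow> word_perm (shift_word D) 1 = 1"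
  by (induction D rule: word_perm.induct) (auto simp: transpose_def)

lemma layered_slide:
  assumes "1 \<le> p" "\<And>k. 1 < k \<Longrightarrow> k \<le> p \<Longrightarrow> a 1 < a k"
  shows "layered a (slide p) \<and> (a \<circ> word_perm (slide p)) p = a 1"
  using assms
proof (induction p rule: dec_induct)
  case base
  then show ?case by (simp add: slide_def)
next
  case (step p)
  have *: "word_perm (slide p) (Suc p) = Suc p"
    using word_perm_permutes[OF slide_words[of p p]] by (simp add: permutes_not_in)
  with step show ?case
    by (auto simp: slide_Suc layered_append word_perm_append)
qed

lemma layerable_insert:
  assumes "D \<in> braid_words (Suc m)" "p \<in> {1..Suc m}" "good_strand p D"
    "layerable m (braid_class m (remove_strand p D))"
  shows "layerable (Suc m) (braid_class (Suc m) D)"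
proof -
  obtain a :: "nat \<Rightarrow> nat" and E where a: "inj_on a {1..m}" and E: "E \<in> braid_words m" "layered a E"
    "braid_equiv m (remove_strand p D) E"
    using assms(4) braid_class_eq_iff[OF remove_strand_words[OF assms(1,2)]]
    by (auto simp: layerable_def)
  let ?q = "word_pos D p"
  have q: "?q \<in> {1..Suc m}" by (rule word_pos_in[OF assms(1,2)])
  \<comment> \<open>The heights once the good strand has been brought to position 1: it lies on top,
    at height 0, and the others keep their order. Position 0 carries no strand.\<close>
  define b where "b k = (if k \<le> 1 then 0 else Suc (a (k - 1)))" for k
  \<comment> \<open>\<open>good_strand_slide\<close> solved for \<open>D\<close>. The heights at its
    beginning are \<open>b\<close> transported back along the slide.\<close>
  let ?F = "word_inverse (slide p) @ shift_word E @ slide ?q"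
  have W: "slide p \<in> braid_words (Suc m)" "slide ?q \<in> braid_words (Suc m)"
    "shift_word E \<in> braid_words (Suc m)"
    using assms(2) q slide_words
      braid_equiv_words(1)[OF braid_equiv_shift[OF braid_equiv.refl[OF E(1)]]]
    by auto
  have "braid_equiv (Suc m) (slide p @ D) (shift_word (remove_strand p D) @ slide ?q)"
    by (rule good_strand_slide[OF assms(1-3)])
  also have "braid_equiv (Suc m) \<dots> (shift_word E @ slide ?q)"
    by (rule braid_equiv_append[OF braid_equiv_shift[OF E(3)] braid_equiv.refl[OF W(2)]])
  also have "braid_equiv (Suc m) \<dots> (slide p @ ?F)"
    using braid_equiv_append[OF braid_equiv.sym[OF braid_word_inverse_right[OF W(1)]]
        braid_equiv.refl[of "shift_word E @ slide ?q"]] W by simp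
  finally have DF: "braid_equiv (Suc m) D ?F" by (rule braid_equiv_cancel_left)
  have b: "inj_on b {1..Suc m}"
  proof (rule inj_onI)
    fix k l assume kl: "k \<in> {1..Suc m}" "l \<in> {1..Suc m}" "b k = b l"
    show "k = l"
    proof (cases "k = 1 \<or> l = 1")
      case True
      with kl show ?thesis unfolding b_def by (auto split: if_splits)
    next
      case False
      then have "a (k - 1) = a (l - 1)" using kl by (auto simp: b_def)
      then have "k - 1 = l - 1" by (rule inj_onD[OF a]) (use kl False in auto)
      with False kl(1,2) show ?thesis unfolding atLeastAtMost_iff by linarith
    qed
  qed
  have slide_layered: "layered c (slide r)" if "c 1 = 0" "\<And>k. k > 1 \<Longrightarrow> c k > 0" "r \<ge> 1"
    for c :: "nat \<Rightarrow> nat" and r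
    using layered_slide[of r c] that by simp
  have "layered (b \<circ> word_perm (slide p)) (word_inverse (slide p))"
    using assms(2)
    by (intro layered_word_inverse[OF b W(1)] slide_layered) (simp_all add: b_def)
  moreover have "b \<circ> word_perm (slide p) \<circ> word_perm (word_inverse (slide p)) = b"
    by (simp add: word_perm_word_inverse fun_eq_iff)
  moreover have "layered b (shift_word E)"
    unfolding layered_shift by (rule layered_mono[OF a E(1,2)]) (simp add: b_def)
  moreover have "layered (b \<circ> word_perm (shift_word E)) (slide ?q)"
  proof (rule slide_layered)
    show "(b \<circ> word_perm (shift_word E)) 1 = 0"
      using word_perm_shift_1[OF E(1)] by (simp add: b_def)
    fix k :: nat assume "k > 1"
    note inj = inj_eq[OF permutes_inj[OF word_perm_permutes[OF W(3)]]]
    have "word_perm (shift_word E) k \<noteq> 1"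
      using inj[of k 1] \<open>k > 1\<close> unfolding word_perm_shift_1[OF E(1)] by simp
    moreover have "word_perm (shift_word E) 0 = 0"
      by (rule permutes_not_in[OF word_perm_permutes[OF W(3)]]) simp
    then have "word_perm (shift_word E) k \<noteq> 0"
      using inj[of k 0] \<open>k > 1\<close> by simp
    ultimately show "(b \<circ> word_perm (shift_word E)) k > 0" by (simp add: b_def)
  qed (use q in simp)
  ultimately have L: "layered (b \<circ> word_perm (slide p)) ?F"
    by (simp only: layered_append)
  have "inj_on (b \<circ> word_perm (slide p)) {1..Suc m}"
    using permutes_image[OF word_perm_permutes[OF W(1)]] b
    by (intro comp_inj_on permutes_inj_on[OF word_perm_permutes[OF W(1)]]) simp
  moreover have "?F \<in> braid_words (Suc m)" by (rule braid_equiv_words(2)[OF DF])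
  moreover have "braid_class (Suc m) D = braid_class (Suc m) ?F"
    using braid_class_eq_iff[OF assms(1)] DF by blast
  ultimately show ?thesis using L unfolding layerable_def by blast
qed

lemma mikado_imp_layerable: "mikado (Suc m) \<beta> \<Longrightarrow> layerable (Suc m) \<beta>"
proof (induction m arbitrary: \<beta>)
  case 0
  then show ?case
    by (auto simp: layerable_def braid_group_def intro!: exI[of _ id] exI[of _ "[]"])
next
  case (Suc m)
  then have "\<beta> \<in> carrier (braid_group (Suc (Suc m)))" by simp
  then obtain D where D: "reduced_diagram \<beta> D" "D \<in> braid_words (Suc (Suc m))"
    "\<beta> = braid_class (Suc (Suc m)) D"
    by (rule ex_reduced_diagram)
  with Suc.prems obtain p where p: "p \<in> {1..Suc (Suc m)}" "good_strand p D"
    "mikado (Suc m) (braid_class (Suc m) (remove_strand p D))"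
    unfolding mikado.simps by blast
  show ?case
    unfolding D(3) by (rule layerable_insert[OF D(2) p(1,2) Suc.IH[OF p(3)]])
qed

lemma layerable_imp_mikado: "layerable (Suc m) \<beta> \<Longrightarrow> mikado (Suc m) \<beta>"
proof (induction m arbitrary: \<beta>)
  case 0
  then obtain D where "D \<in> braid_words 1" "\<beta> = braid_class 1 D"
    by (auto simp: layerable_def)
  moreover from this have "D = []" by (cases D) auto
  ultimately show ?case by (simp add: braid_group_def)
next
  case (Suc m)
  let ?m = "Suc (Suc m)"
  obtain a :: "nat \<Rightarrow> nat" and E where a: "inj_on a {1..?m}" and E: "E \<in> braid_words ?m"
    "layered a E" "\<beta> = braid_class ?m E"
    using Suc.prems by (auto simp: layerable_def)
  have "(\<exists>p\<in>{1..?m}. good_strand p D) \<and> (\<forall>p\<in>{1..?m}. good_strand p D \<longrightarrow>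
      mikado (Suc m) (braid_class (Suc m) (remove_strand p D)))" if "reduced_diagram \<beta> D" for D
  proof -
    have D: "D \<in> braid_words ?m" "layered a D"
      using reduced_diagram_layered[OF a E(1,2)] that E(3) by blast+
    obtain p where "p \<in> {1..?m}" "\<And>q. q \<in> {1..?m} \<Longrightarrow> q \<noteq> p \<Longrightarrow> a p < a q"
      using ex_top_strand[OF a] by blast
    then have "\<exists>p\<in>{1..?m}. good_strand p D" using layered_good_strand[OF D(2,1)] by blast
    moreover have "layerable (Suc m) (braid_class (Suc m) (remove_strand p D))"
      if "p \<in> {1..?m}" for p
      unfolding layerable_def
      using inj_on_skip[OF a that] remove_strand_words[OF D(1) that] layered_remove_strand[OF D(2)]
      by blast
    ultimately show ?thesis using Suc.IH by blast
  qed
  moreover have "\<beta> \<in> carrier (braid_group ?m)" using E by (simp add: braid_group_def)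
  ultimately show ?case unfolding mikado.simps by blast
qed

section \<open>The weak order is a lattice\<close>

abbreviation pinv :: "(nat \<Rightarrow> nat) \<Rightarrow> nat \<Rightarrow> nat" where
  "pinv \<equiv> inv_into UNIV"

lemma permutes_comp: "y permutes S \<Longrightarrow> x permutes S \<Longrightarrow> y \<circ> x permutes S"
  by (rule permutes_compose)

text \<open>Both the meet in the weak order and the symmetric heights are obtained first as strict
  total orders on the positions and are then turned into permutations by ranking.\<close>

lemma permutes_rank:
  fixes R :: "nat \<Rightarrow> nat \<Rightarrow> bool"
  assumes irrefl: "\<And>i. i \<in> {1..m} \<Longrightarrow> \<not> R i i"
    and trans: "\<And>i j k. i \<in> {1..m} \<Longrightarrow> j \<in> {1..m} \<Longrightarrow> k \<in> {1..m} \<Longrightarrow> R i j \<Longrightarrow> R j k \<Longrightarrow> R i k"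
    and total: "\<And>i j. i \<in> {1..m} \<Longrightarrow> j \<in> {1..m} \<Longrightarrow> i \<noteq> j \<Longrightarrow> R i j \<or> R j i"
  defines "c \<equiv> \<lambda>k. if k \<in> {1..m} then Suc (card {j \<in> {1..m}. R j k}) else k"
  shows "c permutes {1..m}" "\<And>i j. i \<in> {1..m} \<Longrightarrow> j \<in> {1..m} \<Longrightarrow> c i < c j \<longleftrightarrow> R i j"
proof -
  have less: "c i < c j" if "i \<in> {1..m}" "j \<in> {1..m}" "R i j" for i j
  proof -
    have "{l \<in> {1..m}. R l i} \<subset> {l \<in> {1..m}. R l j}"
      using that irrefl trans by blast
    then have "card {l \<in> {1..m}. R l i} < card {l \<in> {1..m}. R l j}"
      by (intro psubset_card_mono) auto
    with that show ?thesis by (simp add: c_def)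
  qed
  show iff: "c i < c j \<longleftrightarrow> R i j" if "i \<in> {1..m}" "j \<in> {1..m}" for i j
    using less that total by (metis less_asym less_irrefl)
  have "inj_on c {1..m}"
    using iff total by (intro inj_onI) (metis less_irrefl)
  moreover have "c ` {1..m} \<subseteq> {1..m}"
  proof clarify
    fix k assume k: "k \<in> {1..m}"
    have "{l \<in> {1..m}. R l k} \<subset> {1..m}" using k irrefl by blast
    then have "card {l \<in> {1..m}. R l k} < card {1..m}" by (intro psubset_card_mono) auto
    with k show "c k \<in> {1..m}" by (simp add: c_def)
  qed
  ultimately have "bij_betw c {1..m} {1..m}"
    by (simp add: bij_betw_def endo_inj_surj)
  then show "c permutes {1..m}"
    by (rule bij_imp_permutes) (simp add: c_def del: atLeastAtMost_iff)
qed

context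
  fixes m :: nat
begin

abbreviation "perm \<equiv> \<lambda>x. x permutes {1..m}"

text \<open>The weak order by right factors: since inversions are pairs of arguments,
  \<open>c\<close> lies below \<open>w\<close> iff \<open>w = r \<circ> c\<close> with lengths
  adding up.\<close>

abbreviation inv_le :: "(nat \<Rightarrow> nat) \<Rightarrow> (nat \<Rightarrow> nat) \<Rightarrow> bool" (infix "\<sqsubseteq>" 50) where
  "c \<sqsubseteq> w \<equiv> inv_set m c \<subseteq> inv_set m w"

lemma inv_leI:
  "(\<And>p q. 1 \<le> p \<Longrightarrow> p < q \<Longrightarrow> q \<le> m \<Longrightarrow> c q < c p \<Longrightarrow> w q < w p) \<Longrightarrow> c \<sqsubseteq> w"
  by (auto simp: inv_set_def)

lemma inv_leD:
  "c \<sqsubseteq> w \<Longrightarrow> 1 \<le> p \<Longrightarrow> p < q \<Longrightarrow> q \<le> m \<Longrightarrow> c q < c p \<Longrightarrow> w q < w p"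
  by (auto simp: inv_set_def)

lemma addsI:
  fixes c :: "nat \<Rightarrow> nat"
  shows "(\<And>p q. 1 \<le> p \<Longrightarrow> p < q \<Longrightarrow> q \<le> m \<Longrightarrow> x q < x p \<Longrightarrow> c (x q) < c (x p)) \<Longrightarrow> adds m c x"
  by (auto simp: inv_set_def adds_def)

lemma addsD:
  fixes c :: "nat \<Rightarrow> nat"
  shows "adds m c x \<Longrightarrow> 1 \<le> p \<Longrightarrow> p < q \<Longrightarrow> q \<le> m \<Longrightarrow> x q < x p \<Longrightarrow> c (x q) < c (x p)"
  by (auto simp: inv_set_def adds_def)

lemma perm_less_or:
  assumes "perm x" "p \<noteq> q"
  shows "x p < x q \<or> x q < x p"
  using injD[OF permutes_inj[OF assms(1)], of p q] assms(2) by linarith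

lemma perm_range:
  assumes "perm x" "1 \<le> p" "p \<le> m"
  shows "1 \<le> x p" "x p \<le> m"
  using permutes_in_image[OF assms(1), of p] assms(2,3) by auto

lemma inv_set_eqD:
  assumes "perm c" "perm d" "inv_set m c = inv_set m d"
  shows "c = d"
proof -
  have "c \<circ> pinv d = id"
  proof (rule permutes_eqI_ascending)
    show "perm (c \<circ> pinv d)"
      by (rule permutes_comp[OF assms(1) permutes_inv[OF assms(2)]])
    fix i assume i: "1 \<le> i" "i < m"
    define p q where "p = pinv d i" "q = pinv d (i + 1)"
    then have d: "d p = i" "d q = i + 1"
      using permutes_inverses(1)[OF assms(2)] by auto
    have r: "1 \<le> p" "p \<le> m" "1 \<le> q" "q \<le> m"
      using perm_range[OF permutes_inv[OF assms(2)]] i unfolding p_q_def by auto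
    have "p \<noteq> q" using d by auto
    then consider "p < q" | "q < p" by linarith
    then have "c p < c q"
    proof cases
      case 1
      then have "(p, q) \<notin> inv_set m c" using d r assms(3) by (auto simp: inv_set_def)
      with 1 r perm_less_or[OF assms(1) \<open>p \<noteq> q\<close>] show ?thesis by (auto simp: inv_set_def)
    next
      case 2
      then have "(q, p) \<in> inv_set m c" using d r assms(3) by (auto simp: inv_set_def)
      then show ?thesis by (simp add: inv_set_def)
    qed
    then show "(c \<circ> pinv d) i < (c \<circ> pinv d) (i + 1)" by (simp add: p_q_def)
  qed
  then have "c \<circ> pinv d \<circ> d = d" by simp
  then show ?thesis
    using permutes_inv_o(2)[OF assms(2)] by (simp add: comp_assoc)
qed

text \<open>The non-inversions of the meet are the transitive closure of the union of the
  non-inversions.\<close>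

lemma ex_meet:
  assumes u: "perm u" and v: "perm v"
  shows "\<exists>c. perm c \<and> c \<sqsubseteq> u \<and> c \<sqsubseteq> v \<and> (\<forall>d. perm d \<longrightarrow> d \<sqsubseteq> u \<longrightarrow> d \<sqsubseteq> v \<longrightarrow> d \<sqsubseteq> c)"
proof -
  define N where "N f = {(p, q). 1 \<le> p \<and> p < q \<and> q \<le> m \<and> f p < f q}" for f :: "nat \<Rightarrow> nat"
  define T where "T = (N u \<union> N v)\<^sup>+"
  have T_sub: "1 \<le> p \<and> p < q \<and> q \<le> m" if "(p, q) \<in> T" for p q
    using that unfolding T_def by (induction rule: trancl_induct) (auto simp: N_def)
  have T_trans: "(p, r) \<in> T" if "(p, q) \<in> T" "(q, r) \<in> T" for p q r
    using that unfolding T_def by (rule trancl_trans)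
  \<comment> \<open>A set of pairs is the inversion set of a permutation iff it and its complement
    are transitive. \<open>T\<close> is transitive by construction; this is the transitivity of its
    complement. It holds for \<open>N u\<close> and \<open>N v\<close> and is carried along
    chains.\<close>
  have T_split: "(i, j) \<in> T \<or> (j, k) \<in> T" if "(i, k) \<in> T" "i < j" "j < k" for i j k
    using that(1,3) unfolding T_def
  proof (induction rule: trancl_induct)
    case (base k)
    have "(i, j) \<in> N u \<union> N v \<or> (j, k) \<in> N u \<union> N v"
      using base that(2) by (auto simp: N_def)
    then show ?case by auto
  next
    case (step l k)
    consider "j < l" | "j = l" | "l < j" by linarith
    then show ?case
    proof cases
      case 1
      with step show ?thesis by (meson trancl.trancl_into_trancl)
    next
      case 2
      with step(1) show ?thesis by simp
    next
      case 3
      have "(l, j) \<in> N u \<union> N v \<or> (j, k) \<in> N u \<union> N v"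
        using step(2,4) 3 by (auto simp: N_def)
      with step(1) show ?thesis by (meson r_into_trancl trancl.trancl_into_trancl)
    qed
  qed
  \<comment> \<open>\<open>R j k\<close> demands a smaller value at \<open>j\<close> than at
    \<open>k\<close>, where \<open>T\<close> lists the pairs that stay in order.\<close>
  define R where "R j k \<longleftrightarrow> j < k \<and> (j, k) \<in> T \<or> k < j \<and> (k, j) \<notin> T" for j k
  have irrefl: "\<not> R i i" for i by (simp add: R_def)
  have total: "R i j \<or> R j i" if "i \<noteq> j" for i j
    using that by (auto simp: R_def)
  have trans: "R i k" if ij: "R i j" and jk: "R j k" for i j k
  proof -
    have "i \<noteq> j" "j \<noteq> k" "i \<noteq> k" using ij jk by (auto simp: R_def)
    then consider "i < j" "j < k" | "i < k" "k < j" | "j < i" "i < k" | "j < k" "k < i"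
      | "k < i" "i < j" | "k < j" "j < i" by linarith
    then show ?thesis
    proof cases
      case 1
      with ij jk show ?thesis by (auto simp: R_def intro: T_trans)
    next
      case 2
      with ij jk show ?thesis using T_split[of i j k] by (auto simp: R_def)
    next
      case 3
      with ij jk show ?thesis using T_split[of j k i] by (auto simp: R_def)
    next
      case 4
      with ij jk show ?thesis using T_trans[of j k i] by (auto simp: R_def)
    next
      case 5
      with ij jk show ?thesis using T_trans[of k i j] by (auto simp: R_def)
    next
      case 6
      with ij jk show ?thesis using T_split[of k i j] by (auto simp: R_def)
    qed
  qed
  define c where "c k = (if k \<in> {1..m} then Suc (card {j \<in> {1..m}. R j k}) else k)" for k
  have c: "perm c" and R: "\<And>i j. i \<in> {1..m} \<Longrightarrow> j \<in> {1..m} \<Longrightarrow> c i < c j \<longleftrightarrow> R i j"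
    using permutes_rank[of m R] irrefl trans total unfolding c_def by blast+
  have inv_c: "(p, q) \<in> inv_set m c \<longleftrightarrow> 1 \<le> p \<and> p < q \<and> q \<le> m \<and> (p, q) \<notin> T" for p q
    using R[of q p] by (auto simp: inv_set_def R_def)
  have "c \<sqsubseteq> f" if "f = u \<or> f = v" for f
  proof clarify
    fix p q assume pq: "(p, q) \<in> inv_set m c"
    then have "(p, q) \<notin> N f" using that inv_c by (auto simp: T_def)
    moreover have "f p < f q \<or> f q < f p"
    proof (rule perm_less_or[of f p q])
      show "perm f" using that u v by blast
      show "p \<noteq> q" using pq by (simp add: inv_set_def)
    qed
    ultimately show "(p, q) \<in> inv_set m f" using pq by (auto simp: N_def inv_set_def)
  qed
  moreover have "d \<sqsubseteq> c" if d: "perm d" "d \<sqsubseteq> u" "d \<sqsubseteq> v" for d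
  proof clarify
    fix p q assume pq: "(p, q) \<in> inv_set m d"
    \<comment> \<open>Maximality of the meet: \<open>d\<close> increases along each link of a chain,
      because its inversions are inversions of both \<open>u\<close> and \<open>v\<close>.\<close>
    have dT: "d p < d q" if "(p, q) \<in> T" for p q
      using that unfolding T_def
    proof (induction rule: trancl_induct)
      have *: "d p < d q" if "(p, q) \<in> N u \<union> N v" for p q
      proof -
        have r: "1 \<le> p" "p < q" "q \<le> m" using that by (auto simp: N_def)
        have "(p, q) \<notin> inv_set m u \<or> (p, q) \<notin> inv_set m v"
          using that by (auto simp: N_def inv_set_def)
        then have "(p, q) \<notin> inv_set m d" using d(2,3) by blast
        then have "\<not> d q < d p" "p \<noteq> q" using r by (simp_all add: inv_set_def)
        with perm_less_or[OF d(1) \<open>p \<noteq> q\<close>] show ?thesis by blast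
      qed
      {
        case (base q)
        then show ?case by (rule *)
      next
        case (step q r)
        with *[OF step(2)] show ?case by simp
      }
    qed
    show "(p, q) \<in> inv_set m c"
    proof -
      have 1: "1 \<le> p" "p < q" "q \<le> m" "d q < d p" using pq by (simp_all add: inv_set_def)
      then have "(p, q) \<notin> T" using dT[of p q] by (meson less_asym)
      with 1 show ?thesis using inv_c by blast
    qed
  qed
  ultimately show ?thesis using c by blast
qed

section \<open>Greedy factorization of a product of two permutations\<close>

definition rev_perm :: "nat \<Rightarrow> nat" where
  "rev_perm k = (if k \<in> {1..m} then m + 1 - k else k)"

lemma rev_perm_rev_perm [simp]: "rev_perm (rev_perm k) = k"
  by (auto simp: rev_perm_def)

lemma perm_rev: "perm rev_perm"
  by (rule bij_imp_permutes[OF bij_betwI[where g = rev_perm]]) (auto simp: rev_perm_def)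

lemma inv_rev_perm [simp]: "pinv rev_perm = rev_perm"
  by (rule inv_equality) simp_all

lemma rev_perm_less:
  assumes "p \<in> {1..m}" "q \<in> {1..m}"
  shows "rev_perm p < rev_perm q \<longleftrightarrow> q < p"
  using assms by (auto simp: rev_perm_def)

text \<open>\<open>rev_perm \<circ> pinv x\<close> is the complement of \<open>x\<close> to the
  longest element. Additivity forbids \<open>c\<close> to invert those pairs of values that
  \<open>x\<close> already has in the wrong order, and the remaining pairs are exactly the
  inversions of the complement.\<close>

lemma adds_iff:
  assumes c: "perm c" and x: "perm x"
  shows "adds m c x \<longleftrightarrow> c \<sqsubseteq> rev_perm \<circ> pinv x"
proof
  assume add: "adds m c x"
  show "c \<sqsubseteq> rev_perm \<circ> pinv x"
  proof (rule inv_leI)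
    fix a b assume ab: "1 \<le> a" "a < b" "b \<le> m" "c b < c a"
    have r: "pinv x a \<in> {1..m}" "pinv x b \<in> {1..m}"
      using perm_range[OF permutes_inv[OF x]] ab by auto
    have "pinv x a < pinv x b"
    proof (rule ccontr)
      assume "\<not> ?thesis"
      then have "pinv x b < pinv x a"
        using perm_less_or[OF permutes_inv[OF x], of a b] ab by auto
      then have "c a < c b"
        using addsD[OF add, of "pinv x b" "pinv x a"] ab r permutes_inverses(1)[OF x] by simp
      with ab show False by simp
    qed
    then show "(rev_perm \<circ> pinv x) b < (rev_perm \<circ> pinv x) a"
      using rev_perm_less[OF r(2,1)] by simp
  qed
next
  assume le: "c \<sqsubseteq> rev_perm \<circ> pinv x"
  show "adds m c x"
  proof (rule addsI)
    fix p q assume pq: "1 \<le> p" "p < q" "q \<le> m" "x q < x p"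
    have r: "1 \<le> x q" "x p \<le> m" using perm_range[OF x] pq by auto
    have "\<not> c (x p) < c (x q)"
    proof
      assume "c (x p) < c (x q)"
      from inv_leD[OF le r(1) pq(4) r(2) this]
      have "rev_perm p < rev_perm q" by (simp add: permutes_inverses(2)[OF x])
      with pq show False using rev_perm_less[of p q] by auto
    qed
    with perm_less_or[OF c, of "x p" "x q"] pq(4) show "c (x q) < c (x p)" by auto
  qed
qed

text \<open>The greatest right factor of \<open>w\<close> that \<open>x\<close> can absorb with
  lengths adding up, so that the product is again the lift of a permutation. It exists as the meet
  of \<open>w\<close> and the complement of \<open>x\<close>.\<close>

definition is_cut :: "(nat \<Rightarrow> nat) \<Rightarrow> (nat \<Rightarrow> nat) \<Rightarrow> (nat \<Rightarrow> nat) \<Rightarrow> bool" where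
  "is_cut w x c \<longleftrightarrow> perm c \<and> c \<sqsubseteq> w \<and> adds m c x \<and>
    (\<forall>d. perm d \<longrightarrow> d \<sqsubseteq> w \<longrightarrow> adds m d x \<longrightarrow> d \<sqsubseteq> c)"

definition cut :: "(nat \<Rightarrow> nat) \<Rightarrow> (nat \<Rightarrow> nat) \<Rightarrow> nat \<Rightarrow> nat" where
  "cut w x = (THE c. is_cut w x c)"

lemma is_cut_unique:
  assumes "is_cut w x c" "is_cut w x d"
  shows "c = d"
proof (rule inv_set_eqD)
  show "perm c" "perm d" using assms unfolding is_cut_def by simp_all
  have "c \<sqsubseteq> d" "d \<sqsubseteq> c" using assms unfolding is_cut_def by simp_all
  then show "inv_set m c = inv_set m d" by (rule subset_antisym)
qed

lemma cut_eqI: "is_cut w x c \<Longrightarrow> cut w x = c"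
  unfolding cut_def by (blast intro: is_cut_unique)

lemma is_cut_cut:
  assumes "perm w" "perm x"
  shows "is_cut w x (cut w x)"
proof -
  have "perm (rev_perm \<circ> pinv x)"
    by (rule permutes_comp[OF perm_rev permutes_inv[OF assms(2)]])
  from ex_meet[OF assms(1) this] obtain c where c: "perm c" "c \<sqsubseteq> w" "c \<sqsubseteq> rev_perm \<circ> pinv x"
    "\<And>d. perm d \<Longrightarrow> d \<sqsubseteq> w \<Longrightarrow> d \<sqsubseteq> rev_perm \<circ> pinv x \<Longrightarrow> d \<sqsubseteq> c" by metis
  have "is_cut w x c"
    unfolding is_cut_def
  proof (intro conjI allI impI)
    show "adds m c x" using adds_iff[OF c(1) assms(2)] c(3) by simp
    show "d \<sqsubseteq> c" if "perm d" "d \<sqsubseteq> w" "adds m d x" for d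
      using c(4)[OF that(1,2)] adds_iff[OF that(1) assms(2)] that(3) by simp
  qed (rule c)+
  then show ?thesis using cut_eqI by metis
qed

lemma cut:
  assumes "perm w" "perm x"
  shows "perm (cut w x)" "cut w x \<sqsubseteq> w" "adds m (cut w x) x"
    "\<And>d. perm d \<Longrightarrow> d \<sqsubseteq> w \<Longrightarrow> adds m d x \<Longrightarrow> d \<sqsubseteq> cut w x"
  using is_cut_cut[OF assms] unfolding is_cut_def by blast+

text \<open>For \<open>c = cut w x\<close> the product \<open>w \<circ> x = (w \<circ> pinv c) \<circ> (c \<circ> x)\<close> is factored such that the second
  factor \<open>head w x\<close> is as long as possible.\<close>

definition head :: "(nat \<Rightarrow> nat) \<Rightarrow> (nat \<Rightarrow> nat) \<Rightarrow> nat \<Rightarrow> nat" where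
  "head w x = cut w x \<circ> x"

definition rest :: "(nat \<Rightarrow> nat) \<Rightarrow> (nat \<Rightarrow> nat) \<Rightarrow> nat \<Rightarrow> nat" where
  "rest w x = w \<circ> pinv (cut w x)"

lemma perm_head: "perm w \<Longrightarrow> perm x \<Longrightarrow> perm (head w x)"
  unfolding head_def by (intro permutes_comp cut)

lemma perm_rest: "perm w \<Longrightarrow> perm x \<Longrightarrow> perm (rest w x)"
  unfolding rest_def by (intro permutes_comp permutes_inv cut)

lemma rest_cut: "perm w \<Longrightarrow> perm x \<Longrightarrow> rest w x \<circ> cut w x = w"
  by (simp add: rest_def comp_assoc permutes_inv_o(2)[OF cut(1)])

lemma adds_rest_cut: "perm w \<Longrightarrow> perm x \<Longrightarrow> adds m (rest w x) (cut w x)"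
  by (simp add: adds_def rest_cut cut(2))

text \<open>Both sides express that the lengths of the three factors add up in
  \<open>z \<circ> y \<circ> x\<close>.\<close>

lemma adds_assoc:
  fixes z :: "nat \<Rightarrow> nat"
  assumes x: "perm x" and y: "perm y" and z: "perm z"
  shows "adds m z (y \<circ> x) \<and> adds m y x \<longleftrightarrow> adds m (z \<circ> y) x \<and> adds m z y"
proof (intro iffI conjI)
  assume A: "adds m z (y \<circ> x) \<and> adds m y x"
  show "adds m (z \<circ> y) x"
    using A by (auto simp: adds_def comp_assoc)
  show "adds m z y"
  proof (rule addsI)
    fix a b assume ab: "1 \<le> a" "a < b" "b \<le> m" "y b < y a"
    define p q where "p = pinv x a" "q = pinv x b"
    have xp: "x p = a" "x q = b" using permutes_inverses(1)[OF x] by (auto simp: p_q_def)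
    have r: "1 \<le> p" "p \<le> m" "1 \<le> q" "q \<le> m"
      using perm_range[OF permutes_inv[OF x]] ab unfolding p_q_def by auto
    have "p < q"
    proof (rule ccontr)
      assume "\<not> p < q"
      then have "q < p" using xp ab(2) by (metis less_irrefl linorder_neqE_nat)
      then have "y a < y b" using addsD[of y x q p] A xp r ab(2) by simp
      with ab(4) show False by simp
    qed
    then show "z (y b) < z (y a)"
      using addsD[of z "y \<circ> x" p q] A xp r ab by simp
  qed
next
  assume A: "adds m (z \<circ> y) x \<and> adds m z y"
  show add: "adds m y x"
  proof (rule addsI)
    fix p q assume pq: "1 \<le> p" "p < q" "q \<le> m" "x q < x p"
    have r: "1 \<le> x q" "x p \<le> m" using perm_range[OF x] pq by auto
    have "z (y (x q)) < z (y (x p))" using addsD[of "z \<circ> y" x p q] A pq by simp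
    moreover have "z (y (x p)) < z (y (x q))" if "y (x p) < y (x q)"
      using addsD[of z y "x q" "x p"] A pq(4) r that by simp
    ultimately show "y (x q) < y (x p)"
      using perm_less_or[OF y, of "x p" "x q"] pq(4) by fastforce
  qed
  show "adds m z (y \<circ> x)"
  proof (rule addsI)
    fix p q assume pq: "1 \<le> p" "p < q" "q \<le> m" "(y \<circ> x) q < (y \<circ> x) p"
    have r: "1 \<le> x p" "x p \<le> m" "1 \<le> x q" "x q \<le> m" using perm_range[OF x] pq by auto
    consider "x p < x q" | "x q < x p" using perm_less_or[OF x, of p q] pq(2) by auto
    then show "z ((y \<circ> x) q) < z ((y \<circ> x) p)"
    proof cases
      case 1
      then show ?thesis using addsD[of z y "x p" "x q"] A pq(4) r by simp
    next
      case 2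
      then show ?thesis using addsD[of "z \<circ> y" x p q] A pq by simp
    qed
  qed
qed

lemma comp_inv_le_iff:
  assumes y: "perm y" and c: "perm c" and d: "perm d" and "adds m c y" "adds m d y"
  shows "c \<circ> y \<sqsubseteq> d \<circ> y \<longleftrightarrow> c \<sqsubseteq> d"
proof
  assume le: "c \<circ> y \<sqsubseteq> d \<circ> y"
  show "c \<sqsubseteq> d"
  proof (rule inv_leI)
    fix a b assume ab: "1 \<le> a" "a < b" "b \<le> m" "c b < c a"
    define p q where "p = pinv y a" "q = pinv y b"
    have yp: "y p = a" "y q = b" using permutes_inverses(1)[OF y] by (auto simp: p_q_def)
    have r: "1 \<le> p" "p \<le> m" "1 \<le> q" "q \<le> m"
      using perm_range[OF permutes_inv[OF y]] ab unfolding p_q_def by auto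
    have "p < q"
      using addsD[OF assms(4), of q p] yp r ab by (metis less_asym linorder_neqE_nat)
    then show "d b < d a" using inv_leD[OF le, of p q] yp r ab by simp
  qed
next
  assume le: "c \<sqsubseteq> d"
  show "c \<circ> y \<sqsubseteq> d \<circ> y"
  proof (rule inv_leI)
    fix p q assume pq: "1 \<le> p" "p < q" "q \<le> m" "(c \<circ> y) q < (c \<circ> y) p"
    have r: "1 \<le> y p" "y p \<le> m" "1 \<le> y q" "y q \<le> m" using perm_range[OF y] pq by auto
    consider "y p < y q" | "y q < y p" using perm_less_or[OF y, of p q] pq(2) by auto
    then show "(d \<circ> y) q < (d \<circ> y) p"
    proof cases
      case 1
      then show ?thesis using inv_leD[OF le, of "y p" "y q"] pq(4) r by simp
    next
      case 2
      then show ?thesis using addsD[OF assms(5), of p q] pq by simp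
    qed
  qed
qed

text \<open>Maximality is used in both directions. \<open>cut w (y \<circ> x) \<circ> y\<close> is a
  candidate for the cut of \<open>head w y\<close>. Conversely, that cut lies above this candidate
  and so has \<open>y\<close> as a right factor; stripping \<open>y\<close> off leaves a candidate
  for \<open>cut w (y \<circ> x)\<close>. This is what makes permutations act compatibly with their
  length-additive products.\<close>

lemma cut_comp:
  assumes w: "perm w" and y: "perm y" and x: "perm x" and add: "adds m y x"
  shows "cut (head w y) x = cut w (y \<circ> x) \<circ> y" "cut w (y \<circ> x) \<sqsubseteq> cut w y"
proof -
  let ?d = "cut w y" and ?e = "cut (head w y) x" and ?c = "cut w (y \<circ> x)"
  note yx = permutes_comp[OF y x]
  note d = cut[OF w y] and c = cut[OF w yx] and e = cut[OF perm_head[OF w y] x]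
  have cy: "adds m (?c \<circ> y) x" "adds m ?c y"
    using adds_assoc[OF x y c(1)] c(3) add by auto
  show cd: "?c \<sqsubseteq> ?d" by (rule d(4)[OF c(1,2) cy(2)])
  then have "?c \<circ> y \<sqsubseteq> head w y"
    unfolding head_def using comp_inv_le_iff[OF y c(1) d(1) cy(2) d(3)] by simp
  then have ce: "?c \<circ> y \<sqsubseteq> ?e" by (rule e(4)[OF permutes_comp[OF c(1) y] _ cy(1)])
  let ?f = "?e \<circ> pinv y"
  have f: "perm ?f" by (rule permutes_comp[OF e(1) permutes_inv[OF y]])
  have fy: "?f \<circ> y = ?e" by (simp add: comp_assoc permutes_inv_o(2)[OF y])
  have "inv_set m y \<subseteq> inv_set m (?c \<circ> y)" using cy(2) by (simp add: adds_def)
  then have fadd: "adds m ?f y" using ce by (simp add: adds_def fy)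
  have "?f \<sqsubseteq> ?d"
    using comp_inv_le_iff[OF y f d(1) fadd d(3)] e(2) unfolding fy unfolding head_def by blast
  then have "?f \<sqsubseteq> w" using d(2) by blast
  moreover have "adds m ?f (y \<circ> x)"
    using adds_assoc[OF x y f] e(3) fadd by (simp add: fy)
  ultimately have "?f \<sqsubseteq> ?c" by (rule c(4)[OF f])
  then have "?e \<sqsubseteq> ?c \<circ> y"
    using comp_inv_le_iff[OF y f c(1) fadd cy(2)] by (simp add: fy)
  with ce show "?e = ?c \<circ> y"
    by (intro inv_set_eqD[OF e(1) permutes_comp[OF c(1) y]]) auto
qed

lemma head_comp:
  assumes "perm w" "perm y" "perm x" "adds m y x"
  shows "head (head w y) x = head w (y \<circ> x)"
  using cut_comp(1)[OF assms] by (simp add: head_def[of "head w y"] head_def[of w "y \<circ> x"] comp_assoc)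

lemma rest_comp:
  assumes w: "perm w" and y: "perm y" and x: "perm x" and add: "adds m y x"
  shows "rest w (y \<circ> x) = rest w y \<circ> rest (head w y) x" "adds m (rest w y) (rest (head w y) x)"
proof -
  let ?d = "cut w y" and ?c = "cut w (y \<circ> x)"
  note yx = permutes_comp[OF y x]
  note d = cut[OF w y] and c = cut[OF w yx]
  have "rest (head w y) x = (?d \<circ> y) \<circ> pinv (?c \<circ> y)"
    unfolding rest_def cut_comp(1)[OF assms] unfolding head_def ..
  also have "pinv (?c \<circ> y) = pinv y \<circ> pinv ?c"
    by (rule o_inv_distrib[OF permutes_bij[OF c(1)] permutes_bij[OF y]])
  also have "?d \<circ> y \<circ> (pinv y \<circ> pinv ?c) = ?d \<circ> (y \<circ> pinv y) \<circ> pinv ?c"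
    by (simp only: comp_assoc)
  finally have 1: "rest (head w y) x = ?d \<circ> pinv ?c"
    by (simp add: permutes_inv_o(1)[OF y])
  show 2: "rest w (y \<circ> x) = rest w y \<circ> rest (head w y) x"
    unfolding 1 unfolding rest_def
    by (simp add: comp_assoc permutes_inv_o(2)[OF d(1)] flip: comp_assoc[of "pinv ?d" ?d])
  show "adds m (rest w y) (rest (head w y) x)"
    unfolding adds_def 2[symmetric] unfolding 1 unfolding rest_def
  proof (rule inv_leI)
    fix a b assume ab: "1 \<le> a" "a < b" "b \<le> m" "(?d \<circ> pinv ?c) b < (?d \<circ> pinv ?c) a"
    define p q where "p = pinv ?c a" "q = pinv ?c b"
    have cp: "?c p = a" "?c q = b" using permutes_inverses(1)[OF c(1)] by (auto simp: p_q_def)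
    have r: "1 \<le> p" "p \<le> m" "1 \<le> q" "q \<le> m"
      using perm_range[OF permutes_inv[OF c(1)]] ab unfolding p_q_def by auto
    have dpq: "?d q < ?d p" using ab(4) by (simp add: p_q_def)
    have "p < q"
      using inv_leD[OF cut_comp(2)[OF assms], of q p] cp r ab(2) dpq
      by (metis less_asym linorder_neqE_nat)
    from inv_leD[OF d(2) r(1) this r(4) dpq]
    show "(w \<circ> pinv ?c) b < (w \<circ> pinv ?c) a" by (simp add: p_q_def)
  qed
qed

lemma cut_id: "perm w \<Longrightarrow> cut w id = w"
  by (rule cut_eqI) (auto simp: is_cut_def adds_def inv_set_def)

lemma rest_id: "perm w \<Longrightarrow> rest w id = id"
  by (simp add: rest_def cut_id permutes_inv_o(1))

lemma cut_rev: "perm w \<Longrightarrow> cut w rev_perm = id"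
proof (rule cut_eqI, unfold is_cut_def, intro conjI allI impI)
  show "d \<sqsubseteq> id" if "perm d" "adds m d rev_perm" for d
    using that adds_iff[OF that(1) perm_rev] by (auto simp: comp_def inv_set_def)
qed (auto simp: permutes_id inv_set_id)

lemma inv_le_rev:
  assumes "perm d"
  shows "d \<sqsubseteq> rev_perm"
  using rev_perm_less by (intro inv_leI) auto

lemma cut_of_rev:
  assumes "perm x"
  shows "cut rev_perm x = rev_perm \<circ> pinv x"
proof (rule cut_eqI, unfold is_cut_def, intro conjI allI impI)
  have p: "perm (rev_perm \<circ> pinv x)"
    by (rule permutes_comp[OF perm_rev permutes_inv[OF assms]])
  show "perm (rev_perm \<circ> pinv x)" "rev_perm \<circ> pinv x \<sqsubseteq> rev_perm"
    using p inv_le_rev by auto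
  show "adds m (rev_perm \<circ> pinv x) x"
    using adds_iff[OF p assms] by simp
  show "d \<sqsubseteq> rev_perm \<circ> pinv x" if "perm d" "adds m d x" for d
    using that adds_iff[OF that(1) assms] by simp
qed

text \<open>A head retains all inversions of \<open>x\<close>. This is why positive letters can
  never make a nontrivial entry of a sequence trivial.\<close>

lemma head_eq_id:
  assumes "perm w" "perm x" "head w x = id"
  shows "w = id" "x = id"
proof -
  have "inv_set m x \<subseteq> inv_set m (head w x)"
    using cut(3)[OF assms(1,2)] by (simp add: adds_def head_def)
  then show x: "x = id"
    using inv_set_eqD[OF assms(2) permutes_id] assms(3) inv_set_id by auto
  show "w = id" using assms(1,3) by (simp add: x head_def cut_id)
qed

section \<open>The action of braid words on sequences of permutations\<close>

text \<open>A sequence \<open>ws\<close> stands for the product \<open>\<dots> ws 2 \<circ> ws 1 \<circ> ws 0\<close> of positive lifts, which is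
  multiplied by \<open>x\<close> from the right.\<close>

fun carry :: "(nat \<Rightarrow> nat) \<Rightarrow> (nat \<Rightarrow> nat \<Rightarrow> nat) \<Rightarrow> nat \<Rightarrow> nat \<Rightarrow> nat" where
  "carry x ws 0 = x"
| "carry x ws (Suc k) = rest (ws k) (carry x ws k)"

text \<open>Each entry is multiplied by the factor carried over from its right neighbour, keeps as
  long a right factor of the product as possible, and hands the rest on to the left.\<close>

definition act :: "(nat \<Rightarrow> nat) \<Rightarrow> (nat \<Rightarrow> nat \<Rightarrow> nat) \<Rightarrow> nat \<Rightarrow> nat \<Rightarrow> nat" where
  "act x ws k = head (ws k) (carry x ws k)"

abbreviation perms :: "(nat \<Rightarrow> nat \<Rightarrow> nat) \<Rightarrow> bool" where
  "perms ws \<equiv> \<forall>k. perm (ws k)"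

text \<open>The right greedy normal form: no part of an entry can be moved into its right
  neighbour.\<close>

definition greedy :: "(nat \<Rightarrow> nat \<Rightarrow> nat) \<Rightarrow> bool" where
  "greedy ws \<longleftrightarrow> perms ws \<and> (\<forall>k. head (ws (Suc k)) (ws k) = ws k)"

text \<open>Right multiplication by Delta on greedy sequences, as \<open>act_rev\<close>
  shows.\<close>

definition shift :: "(nat \<Rightarrow> nat \<Rightarrow> nat) \<Rightarrow> nat \<Rightarrow> nat \<Rightarrow> nat" where
  "shift ws k = (case k of 0 \<Rightarrow> rev_perm | Suc j \<Rightarrow> ws j)"

lemma perm_carry: "perm x \<Longrightarrow> perms ws \<Longrightarrow> perm (carry x ws k)"
proof (induction k)
  case (Suc k)
  then show ?case unfolding carry.simps by (blast intro: perm_rest)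
qed simp

lemma perms_act: "perm x \<Longrightarrow> perms ws \<Longrightarrow> perms (act x ws)"
  unfolding act_def by (blast intro: perm_head perm_carry)

lemma shift_simps [simp]: "shift ws 0 = rev_perm" "shift ws (Suc k) = ws k"
  by (simp_all add: shift_def)

lemma act_comp:
  assumes "perm y" "perm x" "perms ws" "adds m y x"
  shows "act x (act y ws) = act (y \<circ> x) ws"
proof -
  \<comment> \<open>What is carried for \<open>y\<close> and afterwards for \<open>x\<close>
    multiplies, with lengths adding up, to what is carried for the product.\<close>
  have *: "carry (y \<circ> x) ws k = carry y ws k \<circ> carry x (act y ws) k \<and>
    adds m (carry y ws k) (carry x (act y ws) k)" for k
  proof (induction k)
    case (Suc k)
    have p: "perm (ws k)" "perm (carry y ws k)" "perm (carry x (act y ws) k)"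
      using assms perm_carry perms_act by auto
    have e: "act y ws k = head (ws k) (carry y ws k)" by (simp add: act_def)
    have c: "carry (y \<circ> x) ws k = carry y ws k \<circ> carry x (act y ws) k"
      using Suc by (rule conjunct1)
    have "adds m (carry y ws k) (carry x (act y ws) k)" using Suc by (rule conjunct2)
    from rest_comp[OF p this] show ?case
      unfolding carry.simps e c by blast
  qed (use assms in simp)
  show ?thesis
  proof
    fix k
    have p: "perm (ws k)" "perm (carry y ws k)" "perm (carry x (act y ws) k)"
      using assms perm_carry perms_act by auto
    show "act x (act y ws) k = act (y \<circ> x) ws k"
      using head_comp[OF p] *[of k] unfolding act_def[of y] act_def[of x] act_def[of "y \<circ> x"]
      by simp
  qed
qed

lemma greedy_act:
  assumes x: "perm x" and "greedy ws"
  shows "greedy (act x ws)"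
proof -
  have ws: "perms ws" using assms by (simp add: greedy_def)
  have "head (act x ws (Suc k)) (act x ws k) = act x ws k" for k
  proof -
    define y where "y = carry x ws k"
    let ?c = "cut (ws k) y" and ?r = "rest (ws k) y"
    have y: "perm y" using perm_carry[OF x ws] by (simp add: y_def)
    have p: "perm (ws k)" "perm (ws (Suc k))" using ws by auto
    note c = cut[OF p(1) y] and r = perm_rest[OF p(1) y]
    \<comment> \<open>The new entry \<open>k\<close> is \<open>?c \<circ> y\<close>, while
      \<open>?r\<close> has moved on to the left. Regrouping brings
      \<open>?r \<circ> ?c = ws k\<close> together again, where greediness of \<open>ws\<close>
      applies.\<close>
    have "head (act x ws (Suc k)) (act x ws k) = head (head (ws (Suc k)) ?r) (?c \<circ> y)"
      by (simp add: act_def head_def[of "ws k"] flip: y_def)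
    also have "\<dots> = head (head (head (ws (Suc k)) ?r) ?c) y"
      by (rule head_comp[symmetric, OF perm_head[OF p(2) r] c(1) y c(3)])
    also have "head (head (ws (Suc k)) ?r) ?c = head (ws (Suc k)) (?r \<circ> ?c)"
      by (rule head_comp[OF p(2) r c(1) adds_rest_cut[OF p(1) y]])
    also have "\<dots> = ws k"
      using assms(2) by (simp add: rest_cut[OF p(1) y] greedy_def)
    finally show ?thesis by (simp add: act_def y_def)
  qed
  then show ?thesis using perms_act[OF x ws] by (simp add: greedy_def)
qed

text \<open>Delta absorbs nothing, so \<open>ws 0\<close> is carried on as a whole. By greediness it
  takes nothing from \<open>ws 1\<close> and displaces it as a whole, and so on along the
  sequence.\<close>

lemma act_rev:
  assumes "greedy ws"
  shows "act rev_perm ws = shift ws"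
proof -
  have ws: "perms ws" using assms by (simp add: greedy_def)
  have carry: "carry rev_perm ws (Suc k) = ws k" for k
  proof (induction k)
    case 0
    then show ?case using ws by (simp add: rest_def cut_rev)
  next
    case (Suc k)
    have "cut (ws (Suc k)) (ws k) \<circ> ws k = ws k"
      using assms by (simp add: greedy_def head_def)
    then have "cut (ws (Suc k)) (ws k) \<circ> ws k \<circ> pinv (ws k) = ws k \<circ> pinv (ws k)" by simp
    then have "cut (ws (Suc k)) (ws k) = id"
      using ws by (simp add: comp_assoc permutes_inv_o(1)[of "ws k" "{1..m}"])
    then show ?case
      unfolding carry.simps(2)[of rev_perm ws "Suc k"] Suc by (simp add: rest_def)
  qed
  show ?thesis
  proof
    fix k
    show "act rev_perm ws k = shift ws k"
    proof (cases k)
      case 0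
      then show ?thesis using ws by (simp add: act_def head_def cut_rev)
    next
      case (Suc j)
      then show ?thesis using carry[of j] assms by (simp add: act_def greedy_def)
    qed
  qed
qed

text \<open>The relation Delta x = (Delta x Delta^-1) Delta: the leading Delta stays in place and
  passes the conjugate of \<open>x\<close> on.\<close>

lemma act_shift:
  assumes "perm x"
  shows "act x (shift ws) = shift (act (rev_perm \<circ> x \<circ> rev_perm) ws)"
proof -
  have x: "cut rev_perm x = rev_perm \<circ> pinv x" by (rule cut_of_rev[OF assms])
  have "pinv (rev_perm \<circ> pinv x) = x \<circ> rev_perm"
    using o_inv_distrib[OF permutes_bij[OF perm_rev] permutes_bij[OF permutes_inv[OF assms]]]
    by (simp add: permutes_inv_inv[OF assms])
  then have "rest rev_perm x = rev_perm \<circ> x \<circ> rev_perm"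
    by (simp add: rest_def x comp_assoc)
  then have carry: "carry x (shift ws) (Suc k) = carry (rev_perm \<circ> x \<circ> rev_perm) ws k" for k
    by (induction k) (simp_all add: shift_def)
  show ?thesis
  proof
    fix k
    show "act x (shift ws) k = shift (act (rev_perm \<circ> x \<circ> rev_perm) ws) k"
    proof (cases k)
      case 0
      then show ?thesis
        by (simp add: act_def head_def x comp_assoc permutes_inv_o(2)[OF assms])
    next
      case (Suc j)
      then show ?thesis using carry[of j] by (simp add: act_def)
    qed
  qed
qed

lemma inj_shift:
  assumes "shift v = shift w"
  shows "v = w"
proof
  show "v k = w k" for k using fun_cong[OF assms, of "Suc k"] by simp
qed

lemma inj_shift_pow: "(shift ^^ j) v = (shift ^^ j) w \<Longrightarrow> v = w"
  by (induction j) (auto dest: inj_shift)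

section \<open>Extending the action to braid words\<close>

text \<open>The inverse of \<open>s\<^sub>i\<close> acts as \<open>s\<^sub>i\<^sup>-\<^sup>1\<Delta>\<^sup>2\<close>; the exponent of \<open>\<Delta>\<close> is recorded by \<open>deltas\<close>.\<close>

fun word_act :: "braid_word \<Rightarrow> (nat \<Rightarrow> nat \<Rightarrow> nat) \<Rightarrow> nat \<Rightarrow> nat \<Rightarrow> nat" where
  "word_act [] ws = ws"
| "word_act ((i, e) # D) ws = word_act D
    (if e then act (transpose i (i + 1)) ws
     else act rev_perm (act (transpose i (i + 1) \<circ> rev_perm) ws))"

fun deltas :: "braid_word \<Rightarrow> nat" where
  "deltas [] = 0"
| "deltas ((i, e) # D) = (if e then 0 else 2) + deltas D"

lemma word_act_append: "word_act (u @ v) ws = word_act v (word_act u ws)"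
  by (induction u ws rule: word_act.induct) simp_all

lemma deltas_append: "deltas (u @ v) = deltas u + deltas v"
  by (induction u rule: deltas.induct) simp_all

lemma even_deltas: "even (deltas u)"
  by (induction u rule: deltas.induct) simp_all

lemma perm_transpose: "1 \<le> i \<Longrightarrow> i < m \<Longrightarrow> perm (transpose i (i + 1))"
  by (rule permutes_swap_id) auto

lemma greedy_word_act:
  assumes "u \<in> braid_words m" "greedy ws"
  shows "greedy (word_act u ws)"
  using assms
proof (induction u ws rule: word_act.induct)
  case (2 i e D ws)
  then have t: "perm (transpose i (i + 1))" using perm_transpose by simp
  have "greedy (act (transpose i (i + 1)) ws)"
    "greedy (act rev_perm (act (transpose i (i + 1) \<circ> rev_perm) ws))"
    using greedy_act t permutes_comp[OF t perm_rev] perm_rev "2.prems"(2) by blast+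
  then have "greedy (if e then act (transpose i (i + 1)) ws
     else act rev_perm (act (transpose i (i + 1) \<circ> rev_perm) ws))" by presburger
  then show ?case unfolding word_act.simps using "2.IH" "2.prems"(1) by auto
qed simp

text \<open>Delta^2 is central, because conjugating twice by the reversal does nothing. This is why
  an inverse letter is compensated by Delta^2, although one Delta would make it positive.\<close>

lemma act_shift2:
  assumes "perm x"
  shows "act x (shift (shift ws)) = shift (shift (act x ws))"
proof -
  have "perm (rev_perm \<circ> x \<circ> rev_perm)"
    by (intro permutes_comp perm_rev assms)
  moreover have "rev_perm \<circ> (rev_perm \<circ> x \<circ> rev_perm) \<circ> rev_perm = x"
    by (simp add: fun_eq_iff)
  ultimately show ?thesis unfolding act_shift[OF assms] using act_shift by metis
qed

lemma word_act_shift2: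
  assumes "u \<in> braid_words m"
  shows "word_act u (shift (shift ws)) = shift (shift (word_act u ws))"
  using assms
proof (induction u ws rule: word_act.induct)
  case (2 i e D ws)
  then have t: "perm (transpose i (i + 1))" using perm_transpose by simp
  have "perm (transpose i (i + 1) \<circ> rev_perm)" by (rule permutes_comp[OF t perm_rev])
  from act_shift2[OF t] act_shift2[OF this] act_shift2[OF perm_rev]
  have "(if e then act (transpose i (i + 1)) (shift (shift ws))
      else act rev_perm (act (transpose i (i + 1) \<circ> rev_perm) (shift (shift ws)))) =
    shift (shift (if e then act (transpose i (i + 1)) ws
      else act rev_perm (act (transpose i (i + 1) \<circ> rev_perm) ws)))"
    by presburger
  moreover have "D \<in> braid_words m" using "2.prems" by simp
  ultimately show ?case using "2.IH" unfolding word_act.simps by presburger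
qed simp

lemma word_act_shift_pow:
  assumes "u \<in> braid_words m" "even j"
  shows "word_act u ((shift ^^ j) ws) = (shift ^^ j) (word_act u ws)"
proof -
  obtain k where "j = 2 * k" using assms(2) by (rule evenE)
  moreover have "word_act u ((shift ^^ (2 * k)) ws) = (shift ^^ (2 * k)) (word_act u ws)"
    by (induction k) (simp_all add: word_act_shift2[OF assms(1)])
  ultimately show ?thesis by simp
qed

lemma shift_pow_commute: "(shift ^^ a) ((shift ^^ b) v) = (shift ^^ b) ((shift ^^ a) v)"
  by (metis add.commute comp_apply funpow_add)

lemma adds_transpose:
  fixes y :: "nat \<Rightarrow> nat"
  assumes "y i < y (Suc i)"
  shows "adds m y (transpose i (Suc i))"
proof (rule addsI)
  fix p q assume "p < q" "transpose i (Suc i) q < transpose i (Suc i) p"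
  then have "(p, q) = (i, Suc i)" using transpose_less[of p q i] by (meson less_asym)
  then show "y (transpose i (Suc i) q) < y (transpose i (Suc i) p)" using assms by simp
qed

lemma adds_rev:
  assumes "y \<circ> x = rev_perm" "perm x"
  shows "adds m y x"
  using inv_le_rev[OF assms(2)] by (simp add: adds_def assms(1))

text \<open>The powers of Delta are multiplied across the equation, since \<open>shift\<close> is
  injective but has no inverse. Greediness is what turns the action of \<open>rev_perm\<close> into
  \<open>shift\<close>.\<close>

lemma word_act_equiv:
  assumes "braid_equiv m u v" "greedy ws"
  shows "(shift ^^ deltas v) (word_act u ws) = (shift ^^ deltas u) (word_act v ws)"
  using assms
proof (induction arbitrary: ws rule: braid_equiv.induct)
  case (refl u)
  then show ?case by simp
next
  case (sym u v)
  then show ?case by simp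
next
  case (trans u v w)
  have "(shift ^^ deltas v) ((shift ^^ deltas w) (word_act u ws))
      = (shift ^^ deltas w) ((shift ^^ deltas u) (word_act v ws))"
    using trans.IH(1)[OF trans.prems] shift_pow_commute by metis
  also have "\<dots> = (shift ^^ deltas v) ((shift ^^ deltas u) (word_act w ws))"
    using trans.IH(2)[OF trans.prems] shift_pow_commute by metis
  finally show ?case by (rule inj_shift_pow)
next
  case (cong u v a b)
  note W = braid_equiv_words[OF cong.hyps(1)]
  let ?w = "word_act a ws"
  have g: "greedy ?w" by (rule greedy_word_act[OF cong.hyps(2) cong.prems])
  have "(shift ^^ deltas v) (word_act b (word_act u ?w)) = (shift ^^ deltas u) (word_act b (word_act v ?w))"
    using cong.IH[OF g] word_act_shift_pow[OF cong.hyps(3) even_deltas] by metis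
  then show ?case
    unfolding word_act_append deltas_append funpow_add comp_apply by (metis shift_pow_commute)
next
  case (cancel i e)
  let ?t = "transpose i (i + 1)"
  have t: "perm ?t" using cancel perm_transpose by simp
  have tr: "perm (?t \<circ> rev_perm)" by (rule permutes_comp[OF t perm_rev])
  have ws: "perms ws" using cancel by (simp add: greedy_def)
  show ?case
  proof (cases e)
    case True
    \<comment> \<open>The lift of \<open>?t \<circ> rev_perm\<close> is s_i^-1 Delta, so together
      with s_i it gives Delta.\<close>
    have "act (?t \<circ> rev_perm) (act ?t ws) = act rev_perm ws"
      using act_comp[OF t tr ws adds_rev[OF _ tr]] by (simp flip: comp_assoc)
    then have "act rev_perm (act (?t \<circ> rev_perm) (act ?t ws)) = shift (shift ws)"
      using act_rev[OF cancel.prems] act_rev[OF greedy_act[OF perm_rev cancel.prems]] by simp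
    with True show ?thesis by (simp add: numeral_2_eq_2)
  next
    case False
    let ?v = "act (?t \<circ> rev_perm) ws" and ?s = "rev_perm \<circ> ?t \<circ> rev_perm"
    have s: "perm ?s" by (rule permutes_comp[OF permutes_comp[OF perm_rev t] perm_rev])
    have e: "?t \<circ> rev_perm \<circ> ?s = rev_perm" by (simp add: fun_eq_iff)
    \<comment> \<open>Here Delta precedes s_i. Moving Delta to the end turns \<open>?t\<close> into
      its conjugate \<open>?s\<close>, which completes \<open>?t \<circ> rev_perm\<close> to the
      reversal.\<close>
    have "act ?t (act rev_perm ?v) = act ?t (shift ?v)"
      using act_rev[OF greedy_act[OF tr cancel.prems]] by simp
    also have "\<dots> = shift (act ?s ?v)" by (rule act_shift[OF t])
    also have "act ?s ?v = act rev_perm ws"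
      using act_comp[OF tr s ws adds_rev[OF e s]] by (simp only: e)
    also have "act rev_perm ws = shift ws" by (rule act_rev[OF cancel.prems])
    finally have *: "act ?t (act rev_perm ?v) = shift (shift ws)" .
    have "(shift ^^ 2) ws = shift (shift ws)" by (simp add: numeral_2_eq_2)
    with False * show ?thesis
      by (simp only: word_act.simps deltas.simps if_True if_False not_False_eq_True add_0
          add_0_right funpow_0)
  qed
next
  case (commute i j)
  let ?s = "transpose i (Suc i)" and ?t = "transpose j (Suc j)"
  have p: "perm ?s" "perm ?t" using commute perm_transpose[of i] perm_transpose[of j] by simp_all
  have ws: "perms ws" using commute by (simp add: greedy_def)
  have "adds m ?s ?t" "adds m ?t ?s"
    using commute by (auto intro!: adds_transpose)
  moreover have "?s \<circ> ?t = ?t \<circ> ?s"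
    using commute by (auto simp: fun_eq_iff transpose_def)
  ultimately show ?case
    using act_comp[OF p ws] act_comp[OF p(2,1) ws] by simp
next
  case (braid i)
  let ?s = "transpose i (Suc i)" and ?t = "transpose (Suc i) (Suc (Suc i))"
  have p: "perm ?s" "perm ?t" using braid perm_transpose[of i] perm_transpose[of "Suc i"] by simp_all
  have ws: "perms ws" using braid by (simp add: greedy_def)
  have "adds m ?s ?t" "adds m ?t ?s"
    by (auto intro!: adds_transpose simp: transpose_def)
  moreover have "adds m (?s \<circ> ?t) ?s" "adds m (?t \<circ> ?s) ?t"
    by (auto intro!: adds_transpose simp: transpose_def)
  moreover have "?s \<circ> ?t \<circ> ?s = ?t \<circ> ?s \<circ> ?t"
    by (auto simp: fun_eq_iff transpose_def)
  ultimately show ?case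
    using act_comp[OF p ws] act_comp[OF p(2,1) ws] act_comp[OF permutes_comp[OF p] p(1) ws]
      act_comp[OF permutes_comp[OF p(2,1)] p(2) ws] by simp
qed

lemma act_perm_word:
  assumes "D \<in> braid_words m" "positive D = D" "layered id D" "perms ws"
  shows "word_act D ws = act (word_perm D) ws"
  using assms(1-3)
proof (induction D rule: rev_induct)
  case Nil
  have carry: "carry id ws k = id" for k
    using assms(4) by (induction k) (simp_all add: rest_id)
  have "act id ws k = ws k" for k
    unfolding act_def carry head_def using assms(4) cut_id by simp
  then show ?case unfolding word_act.simps word_perm.simps by presburger
next
  case (snoc z D)
  obtain i where z: "z = (i, True)" "positive D = D" using snoc.prems(2) by (cases z) simp
  have "layered id D" "layered (id \<circ> word_perm D) [(i, True)]"
    using snoc.prems(3) unfolding z(1) layered_append by blast+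
  then have D: "D \<in> braid_words m" "1 \<le> i" "i < m" "layered id D"
    "word_perm D i < word_perm D (Suc i)"
    using snoc.prems(1) by (simp_all add: z(1))
  have "act (transpose i (i + 1)) (act (word_perm D) ws) = act (word_perm D \<circ> transpose i (i + 1)) ws"
    using act_comp[OF word_perm_permutes[OF D(1)] perm_transpose[OF D(2,3)] assms(4)]
      adds_transpose[of "word_perm D" i] D(5) by simp
  then show ?case
    by (simp only: z(1) word_act_append word_perm_append word_act.simps word_perm.simps if_True
        comp_id snoc.IH[OF D(1) z(2) D(4)])
qed

lemma greedy_id: "greedy (\<lambda>_. id)"
  unfolding greedy_def head_def using cut_id[OF permutes_id] permutes_id by auto

text \<open>The sequence always multiplies to the braid that produced it. With entries w1, w0 and a
  new letter t, write w0 = x c, where c is the part that t absorbs; then w1 w0 t = (w1 x)(c t) are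
  the new entries.\<close>

lemma word_act_short:
  assumes "P \<in> braid_words m" "positive P = P" "\<And>k. k \<ge> 2 \<Longrightarrow> word_act P (\<lambda>_. id) k = id"
  shows "\<exists>w v. perm w \<and> perm v \<and> braid_equiv m P (perm_word m w @ perm_word m v)"
proof -
  let ?o = "\<lambda>_ :: nat. id :: nat \<Rightarrow> nat"
  have perms: "perms (word_act u ?o)" if "u \<in> braid_words m" for u
    using greedy_word_act[OF that greedy_id] by (simp add: greedy_def)
  have "braid_equiv m P (perm_word m (word_act P ?o (Suc 0)) @ perm_word m (word_act P ?o 0))"
    using assms
  proof (induction P rule: rev_induct)
    case Nil
    have e: "perm_word m id = []"
      using perm_word(4)[OF permutes_id, of m] by (simp add: inv_set_id)
    show ?case unfolding word_act.simps e by (simp add: braid_equiv.refl)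
  next
    case (snoc z P)
    obtain i where z: "z = (i, True)" "positive P = P" using snoc.prems(2) by (cases z) simp
    let ?t = "transpose i (i + 1)"
    have P: "P \<in> braid_words m" "1 \<le> i" "i < m"
      using snoc.prems(1) by (simp_all add: z(1))
    have t: "perm ?t" by (rule perm_transpose[OF P(2,3)])
    define ws where "ws = word_act P ?o"
    have ws: "perms ws" using perms[OF P(1)] by (simp add: ws_def)
    have w: "perm (ws k)" for k using ws by blast
    have out: "word_act (P @ [z]) ?o = act ?t ws"
      by (simp add: word_act_append z(1) ws_def)
    \<comment> \<open>A trivial head leaves no room for a nontrivial factor: these entries were
      trivial before the last letter as well, and nothing was carried to them.\<close>
    have tail: "ws k = id" "carry ?t ws k = id" if "k \<ge> 2" for k
      using head_eq_id[OF w perm_carry[OF t ws], of k k] snoc.prems(3)[OF that]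
      unfolding out act_def by blast+
    let ?x = "rest (ws 0) ?t" and ?c = "cut (ws 0) ?t"
    have x: "perm ?x" by (rule perm_rest[OF w t])
    note c0 = cut[OF w[of 0] t] and c1 = cut[OF w[of "Suc 0"] x]
    have "rest (ws (Suc 0)) ?x = id"
      using tail(2)[of 2] by (simp add: numeral_2_eq_2)
    \<comment> \<open>Nothing is handed on from entry 1, so it merges completely with
      \<open>?x\<close>.\<close>
    then have c1_eq: "cut (ws (Suc 0)) ?x = ws (Suc 0)"
      using rest_cut[OF w[of "Suc 0"] x] by simp
    have o1: "act ?t ws (Suc 0) = ws (Suc 0) \<circ> ?x"
      unfolding act_def head_def carry.simps c1_eq ..
    have o0: "act ?t ws 0 = ?c \<circ> ?t"
      unfolding act_def head_def carry.simps ..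
    note equivs = braid_equiv.trans braid_equiv_append braid_equiv.refl
    have W: "perm_word m y \<in> braid_words m" if "perm y" for y
      by (rule perm_word(1)[OF that])
    have "braid_equiv m P (perm_word m (ws (Suc 0)) @ perm_word m (ws 0))"
      unfolding ws_def
    proof (rule snoc.IH[OF P(1) z(2)])
      show "word_act P ?o k = id" if "k \<ge> 2" for k using tail(1)[OF that] by (simp add: ws_def)
    qed
    moreover have "braid_equiv m [z] (perm_word m ?t)"
      using perm_word_eq[of "[z]" m] P by (simp add: z(1))
    ultimately have "braid_equiv m (P @ [z])
        ((perm_word m (ws (Suc 0)) @ perm_word m (ws 0)) @ perm_word m ?t)"
      by (rule braid_equiv_append)
    also have "braid_equiv m \<dots>
        ((perm_word m (ws (Suc 0)) @ (perm_word m ?x @ perm_word m ?c)) @ perm_word m ?t)"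
      using perm_word_comp[OF x c0(1) adds_rest_cut[OF w t]] unfolding rest_cut[OF w t]
      by (intro braid_equiv_append braid_equiv.refl W w t) (rule braid_equiv.sym)
    also have "\<dots> = (perm_word m (ws (Suc 0)) @ perm_word m ?x) @ (perm_word m ?c @ perm_word m ?t)"
      by simp
    also have "braid_equiv m \<dots>
        (perm_word m (ws (Suc 0) \<circ> ?x) @ perm_word m (?c \<circ> ?t))"
      using perm_word_comp[OF w x] c1(3) perm_word_comp[OF c0(1) t c0(3)] unfolding c1_eq
      by (intro braid_equiv_append)
    finally show ?case unfolding out o1 o0 .
  qed
  then show ?thesis using perms[OF assms(1)] by blast
qed

text \<open>Right multiplication by a positive braid does not shorten the sequence of \<open>P\<close>, and the sequence
  of \<open>\<Delta>\<^sup>2\<close> has length two.\<close>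

theorem positive_divisor_Delta_squared:
  assumes P: "P \<in> braid_words m" "positive P = P" and Q: "Q \<in> braid_words m" "positive Q = Q"
    and PQ: "braid_equiv m (P @ Q) (perm_word m rev_perm @ perm_word m rev_perm)"
  shows "\<exists>w v. perm w \<and> perm v \<and> braid_equiv m P (perm_word m w @ perm_word m v)"
proof (rule word_act_short[OF P])
  let ?o = "\<lambda>_ :: nat. id :: nat \<Rightarrow> nat"
  have deltas: "deltas D = 0" if "positive D = D" for D
    using that by (induction D rule: deltas.induct) auto
  note R = perm_word[OF perm_rev]
  have "greedy (shift ?o)"
    using greedy_act[OF perm_rev greedy_id] unfolding act_rev[OF greedy_id] .
  have o: "perms ?o" "perms (shift ?o)"
    using greedy_id \<open>greedy (shift ?o)\<close> unfolding greedy_def by blast+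
  have "word_act Q (word_act P ?o) = word_act (perm_word m rev_perm) (word_act (perm_word m rev_perm) ?o)"
    using word_act_equiv[OF PQ greedy_id] P(2) Q(2) R(2)
    by (simp add: deltas_append deltas word_act_append)
  also have "\<dots> = shift (shift ?o)"
    using act_perm_word[OF R(1,2) R(5)[OF adds_id]] o act_rev[OF greedy_id] act_rev[OF \<open>greedy (shift ?o)\<close>]
    unfolding R(3) by metis
  finally have end_eq: "word_act Q (word_act P ?o) = shift (shift ?o)" .
  have mono: "ws k = id" if "perms ws" "Q \<in> braid_words m" "positive Q = Q" "word_act Q ws k = id"
    for Q ws k
    using that
  proof (induction Q arbitrary: ws)
    case (Cons z Q)
    obtain i where z: "z = (i, True)" "positive Q = Q" using Cons.prems(3) by (cases z) simp
    have Q: "Q \<in> braid_words m" "1 \<le> i" "i < m" using Cons.prems(2) by (simp_all add: z(1))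
    note t = perm_transpose[OF Q(2,3)]
    have "act (transpose i (i + 1)) ws k = id"
    proof (rule Cons.IH[OF perms_act[OF t Cons.prems(1)] Q(1) z(2)])
      show "word_act Q (act (transpose i (i + 1)) ws) k = id"
        using Cons.prems(4) unfolding z(1) word_act.simps by (simp only: if_True)
    qed
    then show ?case
      unfolding act_def
      using head_eq_id(1)[OF _ perm_carry[OF t Cons.prems(1)]] Cons.prems(1) by blast
  qed simp
  show "word_act P ?o k = id" if k: "k \<ge> 2" for k
  proof (rule mono[OF _ Q])
    show "perms (word_act P ?o)"
      using greedy_word_act[OF P(1) greedy_id] by (simp add: greedy_def)
    obtain j where "k = Suc (Suc j)" using k by (metis add_2_eq_Suc le_Suc_ex)
    then show "word_act Q (word_act P ?o) k = id" by (simp only: end_eq shift_simps)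
  qed
qed

end

section \<open>Words in the braid group\<close>

lemma braid_group_inv_class:
  assumes "u \<in> braid_words m"
  shows "inv\<^bsub>braid_group m\<^esub> braid_class m u = braid_class m (word_inverse u)"
proof (rule group.inv_equality[OF group_braid_group])
  have W: "word_inverse u \<in> braid_words m" by (rule word_inverse_words[OF assms])
  show "braid_class m (word_inverse u) \<otimes>\<^bsub>braid_group m\<^esub> braid_class m u = \<one>\<^bsub>braid_group m\<^esub>"
    unfolding braid_group_mult_class[OF W assms]
    using braid_class_eq_iff[of "word_inverse u @ u" m "[]"] W assms braid_word_inverse[OF assms]
    by (simp add: braid_group_def)
  show "braid_class m u \<in> carrier (braid_group m)"
    "braid_class m (word_inverse u) \<in> carrier (braid_group m)"
    using W assms by (simp_all add: braid_group_def)
qed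

lemma braid_equiv_word_inverse_append:
  assumes "u \<in> braid_words m" "v \<in> braid_words m"
  shows "braid_equiv m (word_inverse u @ u @ v) v"
  using braid_equiv_append[OF braid_word_inverse[OF assms(1)] braid_equiv.refl[OF assms(2)]]
  by simp

text \<open>With heights \<open>x\<close> at the start, undoing \<open>x\<close> sorts the heights
  into \<open>id\<close>, and every permutation word is layered by \<open>id\<close>.\<close>

lemma fraction_layerable:
  assumes x: "x permutes {1..m}" and y: "y permutes {1..m}"
  shows "layerable m (braid_class m (word_inverse (perm_word m x) @ perm_word m y))"
proof -
  note X = perm_word[OF x] and Y = perm_word[OF y]
  have "layered (id \<circ> word_perm (perm_word m x)) (word_inverse (perm_word m x))"
    by (rule layered_word_inverse[OF _ X(1) X(5)[OF adds_id]]) simp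
  moreover have "x \<circ> word_perm (word_inverse (perm_word m x)) = id"
    unfolding word_perm_word_inverse
    using word_perm_word_pos[of "perm_word m x"] by (simp add: X(3) fun_eq_iff)
  moreover have "layered id (perm_word m y)" by (rule Y(5)[OF adds_id])
  ultimately have "layered x (word_inverse (perm_word m x) @ perm_word m y)"
    unfolding X(3) layered_append by (simp only: id_comp simp_thms)
  moreover have "word_inverse (perm_word m x) @ perm_word m y \<in> braid_words m"
    using word_inverse_words[OF X(1)] Y(1) by simp
  moreover have "inj_on x {1..m}" by (rule permutes_inj_on[OF x])
  ultimately show ?thesis unfolding layerable_def by blast
qed

section \<open>The Coxeter group of type B\<close>

lemma coxeter_B_iff:
  "w \<in> coxeter_B n \<longleftrightarrow> w permutes {1..2 * n} \<and> w \<circ> rev_perm (2 * n) = rev_perm (2 * n) \<circ> w"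
proof -
  have "(\<forall>k\<in>{1..2 * n}. w (2 * n + 1 - k) = 2 * n + 1 - w k) \<longleftrightarrow>
      w \<circ> rev_perm (2 * n) = rev_perm (2 * n) \<circ> w" if w: "w permutes {1..2 * n}"
  proof -
    have "w (rev_perm (2 * n) k) = rev_perm (2 * n) (w k)" if "k \<notin> {1..2 * n}" for k
      using that permutes_not_in[OF w that] by (simp add: rev_perm_def del: atLeastAtMost_iff)
    moreover have "w (rev_perm (2 * n) k) = rev_perm (2 * n) (w k) \<longleftrightarrow>
        w (2 * n + 1 - k) = 2 * n + 1 - w k" if "k \<in> {1..2 * n}" for k
      using that permutes_in_image[OF w, of k] by (simp add: rev_perm_def)
    ultimately show ?thesis unfolding fun_eq_iff comp_apply by blast
  qed
  then show ?thesis unfolding coxeter_B_def by blast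
qed

lemma coxeter_B_permutes: "w \<in> coxeter_B n \<Longrightarrow> w permutes {1..2 * n}"
  by (simp add: coxeter_B_def)

lemma coxeter_B_rev: "rev_perm (2 * n) \<in> coxeter_B n"
  using perm_rev by (simp add: coxeter_B_iff)

lemma coxeter_B_id: "id \<in> coxeter_B n"
  unfolding coxeter_B_iff using permutes_id by auto

lemma coxeter_B_comp:
  assumes "w \<in> coxeter_B n" "v \<in> coxeter_B n"
  shows "w \<circ> v \<in> coxeter_B n"
proof -
  have "w (rev_perm (2 * n) k) = rev_perm (2 * n) (w k)"
    "v (rev_perm (2 * n) k) = rev_perm (2 * n) (v k)" for k
    using assms by (simp_all add: coxeter_B_iff fun_eq_iff)
  moreover have "w \<circ> v permutes {1..2 * n}"
    by (intro permutes_comp coxeter_B_permutes assms)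
  ultimately show ?thesis by (simp add: coxeter_B_iff fun_eq_iff)
qed

lemma coxeter_B_inv:
  assumes "w \<in> coxeter_B n"
  shows "pinv w \<in> coxeter_B n"
proof -
  have w: "w permutes {1..2 * n}" by (rule coxeter_B_permutes[OF assms])
  have c: "w (rev_perm (2 * n) k) = rev_perm (2 * n) (w k)" for k
    using assms by (simp add: coxeter_B_iff fun_eq_iff)
  have "pinv w (rev_perm (2 * n) k) = rev_perm (2 * n) (pinv w k)" for k
    using c[of "pinv w k"] permutes_inverses[OF w] by metis
  with permutes_inv[OF w] show ?thesis by (simp add: coxeter_B_iff fun_eq_iff)
qed

lemma inj_transpose_apply:
  "inj f \<Longrightarrow> f (transpose a b k) = transpose (f a) (f b) (f k)"
  by (auto simp: transpose_def inj_eq)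

lemma transpose_commute_disjoint:
  assumes "c \<noteq> a" "c \<noteq> b" "d \<noteq> a" "d \<noteq> b"
  shows "transpose a b (transpose c d k) = transpose c d (transpose a b k)"
  using inj_transpose_apply[OF inj_transpose[of a b], of c d k] assms
  by simp

lemma coxeter_gen_B_commute:
  fixes n :: nat
  assumes "i < n"
  shows "transpose i (i + 1) (transpose (2 * n - i) (2 * n - i + 1) k) =
    transpose (2 * n - i) (2 * n - i + 1) (transpose i (i + 1) k)"
  using assms by (intro transpose_commute_disjoint) linarith+

lemma coxeter_gen_B:
  assumes "i < n"
  shows "coxeter_gen_B n i \<in> coxeter_B n"
proof -
  let ?r = "rev_perm (2 * n)"
  have r: "?r (transpose a b k) = transpose (?r a) (?r b) (?r k)" for a b k
    by (rule inj_transpose_apply[OF permutes_inj[OF perm_rev]])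
  show ?thesis
  proof (cases "i = 0")
    case True
    have "?r n = n + 1" "?r (n + 1) = n" using assms by (auto simp: rev_perm_def)
    then have "transpose n (n + 1) (?r k) = ?r (transpose n (n + 1) k)" for k
      unfolding r by (simp add: transpose_commute)
    moreover have "transpose n (n + 1) permutes {1..2 * n}"
      using assms by (intro permutes_swap_id) auto
    ultimately show ?thesis
      using True by (simp add: coxeter_B_iff coxeter_gen_B_def fun_eq_iff)
  next
    case False
    let ?s = "transpose i (i + 1)" and ?t = "transpose (2 * n - i) (2 * n - i + 1)"
    have "?r i = 2 * n - i + 1" "?r (i + 1) = 2 * n - i" "?r (2 * n - i) = i + 1"
      "?r (2 * n - i + 1) = i"
      using assms False by (auto simp: rev_perm_def)
    then have "?r (?s k) = ?t (?r k)" "?r (?t k) = ?s (?r k)" for k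
      unfolding r by (simp_all add: transpose_commute)
    then have "?s (?t (?r k)) = ?r (?s (?t k))" for k
      by (simp only: coxeter_gen_B_commute[OF assms])
    moreover have "?s permutes {1..2 * n}" "?t permutes {1..2 * n}"
      using assms False by (intro permutes_swap_id; simp)+
    then have "?s \<circ> ?t permutes {1..2 * n}" by (rule permutes_comp)
    ultimately show ?thesis
      using False unfolding coxeter_B_iff coxeter_gen_B_def fun_eq_iff comp_apply if_not_P[OF False]
      by blast
  qed
qed

lemma coxeter_gen_B_involution:
  assumes "i < n"
  shows "coxeter_gen_B n i (coxeter_gen_B n i k) = k"
proof (cases "i = 0")
  case False
  then show ?thesis
    unfolding coxeter_gen_B_def if_not_P[OF False] comp_apply coxeter_gen_B_commute[OF assms]
    by (simp only: transpose_involutory)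
qed (simp add: coxeter_gen_B_def)

text \<open>The left position of the crossing that decides whether the generator lengthens an
  element; for \<open>i > 0\<close> its mirror image behaves alike.\<close>

definition gen_pos :: "nat \<Rightarrow> nat \<Rightarrow> nat" where
  "gen_pos n i = (if i = 0 then n else i)"

text \<open>Twice the length: for \<open>i > 0\<close> the generator \<open>t\<^sub>i\<close> is a product of two simple transpositions, while \<open>t\<^sub>0\<close>
  is a single one but also moves a strand across the middle.\<close>

definition double_length :: "nat \<Rightarrow> (nat \<Rightarrow> nat) \<Rightarrow> nat" where
  "double_length n w = card (inv_set (2 * n) w) + card {k \<in> {1..n}. n < w k}"

lemma coxeter_B_mirror:
  assumes "w \<in> coxeter_B n" "1 \<le> k" "k \<le> 2 * n"
  shows "w (2 * n + 1 - k) = 2 * n + 1 - w k" "1 \<le> w k" "w k \<le> 2 * n"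
  using assms permutes_in_image[OF coxeter_B_permutes[OF assms(1)], of k]
  unfolding coxeter_B_def by auto

lemma coxeter_B_mirror_ascent:
  assumes "w \<in> coxeter_B n" "1 \<le> i" "i < 2 * n"
  shows "w (2 * n - i) < w (2 * n - i + 1) \<longleftrightarrow> w i < w (i + 1)"
proof -
  have "w (2 * n - i) = 2 * n + 1 - w (i + 1)"
    using coxeter_B_mirror(1)[OF assms(1), of "i + 1"] assms(2,3) by simp
  moreover have "w (2 * n - i + 1) = 2 * n + 1 - w i"
    using coxeter_B_mirror(1)[OF assms(1), of i] assms(2,3) by (simp add: Suc_diff_le)
  ultimately show ?thesis
    using coxeter_B_mirror(2,3)[OF assms(1), of i] coxeter_B_mirror(2,3)[OF assms(1), of "i + 1"]
      assms(2,3) by auto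
qed

lemma double_length_up:
  assumes w: "w \<in> coxeter_B n" and i: "i < n" and up: "w (gen_pos n i) < w (gen_pos n i + 1)"
  shows "double_length n (w \<circ> coxeter_gen_B n i) = double_length n w + 2"
proof (cases "i = 0")
  case True
  have up: "w n < w (n + 1)" using up True by (simp add: gen_pos_def)
  moreover have "w (n + 1) = 2 * n + 1 - w n"
    using coxeter_B_mirror(1)[OF w, of n] i by simp
  ultimately have n: "w n \<le> n" "n < w (n + 1)" by simp_all
  have "{k \<in> {1..n}. n < (w \<circ> transpose n (n + 1)) k} = insert n {k \<in> {1..n}. n < w k}"
    using n i by (auto simp: transpose_def)
  moreover have "card (inv_set (2 * n) (w \<circ> transpose n (n + 1))) = Suc (card (inv_set (2 * n) w))"
    using up i by (intro card_inv_set_up) auto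
  ultimately show ?thesis
    using n True by (simp add: double_length_def coxeter_gen_B_def)
next
  case False
  let ?s = "transpose i (i + 1)" and ?j = "2 * n - i"
  let ?t = "transpose ?j (?j + 1)"
  have up: "w i < w (i + 1)" using up False by (simp add: gen_pos_def)
  have j: "1 \<le> ?j" "?j < 2 * n" "i + 1 < ?j" "n < ?j" using i False by auto
  have "card (inv_set (2 * n) (w \<circ> ?s)) = Suc (card (inv_set (2 * n) w))"
    using up i False by (intro card_inv_set_up) auto
  moreover have "w ?j < w (?j + 1)"
    using coxeter_B_mirror_ascent[OF w, of i] up i False by simp
  then have "(w \<circ> ?s) ?j < (w \<circ> ?s) (?j + 1)" using j by (simp add: transpose_def)
  then have "card (inv_set (2 * n) (w \<circ> ?s \<circ> ?t)) = Suc (card (inv_set (2 * n) (w \<circ> ?s)))"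
    by (rule card_inv_set_up[OF j(1,2)])
  \<comment> \<open>For \<open>i > 0\<close> the generator preserves both halves of the positions,
    so the number of strands crossing the middle does not change.\<close>
  moreover have "{k \<in> {1..n}. n < (w \<circ> ?s \<circ> ?t) k} = ?s ` {k \<in> {1..n}. n < w k}"
  proof (intro equalityI subsetI)
    fix k assume k: "k \<in> {k \<in> {1..n}. n < (w \<circ> ?s \<circ> ?t) k}"
    then have "?t k = k" using j by (auto simp: transpose_def)
    with k have "n < w (?s k)" by simp
    moreover have "?s k \<in> {1..n}" using k i False by (auto simp: transpose_def)
    ultimately have "?s (?s k) \<in> ?s ` {k \<in> {1..n}. n < w k}" by (intro imageI) simp
    then show "k \<in> ?s ` {k \<in> {1..n}. n < w k}" by simp
  next
    fix k assume "k \<in> ?s ` {k \<in> {1..n}. n < w k}"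
    then obtain l where l: "l \<in> {1..n}" "n < w l" "k = ?s l" by blast
    then have k: "k \<in> {1..n}" "?s k = l" using i False by (auto simp: transpose_def)
    then have "?t k = k" using j by (auto simp: transpose_def)
    with l k show "k \<in> {k \<in> {1..n}. n < (w \<circ> ?s \<circ> ?t) k}" by simp
  qed
  then have "card {k \<in> {1..n}. n < (w \<circ> ?s \<circ> ?t) k} = card {k \<in> {1..n}. n < w k}"
    using card_image[OF inj_on_subset[OF inj_transpose subset_UNIV]] by metis
  ultimately show ?thesis
    using False by (simp add: double_length_def coxeter_gen_B_def comp_assoc)
qed

lemma coxeter_gen_B_pos:
  assumes "i < n"
  shows "coxeter_gen_B n i (gen_pos n i) = gen_pos n i + 1"
    "coxeter_gen_B n i (gen_pos n i + 1) = gen_pos n i"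
  using assms by (auto simp: coxeter_gen_B_def gen_pos_def transpose_def)

lemma double_length_down:
  assumes w: "w \<in> coxeter_B n" and i: "i < n" and down: "w (gen_pos n i + 1) < w (gen_pos n i)"
  shows "double_length n w = double_length n (w \<circ> coxeter_gen_B n i) + 2"
proof -
  have e: "w \<circ> coxeter_gen_B n i \<circ> coxeter_gen_B n i = w"
    using coxeter_gen_B_involution[OF i] by (simp add: fun_eq_iff)
  have "(w \<circ> coxeter_gen_B n i) (gen_pos n i) < (w \<circ> coxeter_gen_B n i) (gen_pos n i + 1)"
    unfolding comp_apply coxeter_gen_B_pos[OF i] by (rule down)
  from double_length_up[OF coxeter_B_comp[OF w coxeter_gen_B[OF i]] i this]
  show ?thesis unfolding e .
qed

text \<open>\<open>gen_pos\<close> sees only positions up to \<open>n\<close>; a descent to the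
  right of the middle is replaced by its mirror image.\<close>

lemma coxeter_B_ex_descent:
  assumes w: "w \<in> coxeter_B n" and "w \<noteq> id"
  obtains i where "i < n" "w (gen_pos n i + 1) < w (gen_pos n i)"
proof -
  obtain j where j: "1 \<le> j" "j < 2 * n" "w (j + 1) < w j"
    using permutes_ex_descent[OF coxeter_B_permutes[OF w] assms(2)] by blast
  consider "j < n" | "j = n" | "n < j" by linarith
  then show thesis
  proof cases
    case 1
    then show ?thesis using that[of j] j by (simp add: gen_pos_def)
  next
    case 2
    then show ?thesis using that[of 0] j by (simp add: gen_pos_def)
  next
    case 3
    have "w (2 * n - j) \<noteq> w (2 * n - j + 1)"
      using injD[OF permutes_inj[OF coxeter_B_permutes[OF w]], of "2 * n - j" "2 * n - j + 1"] by auto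
    then have "w (2 * n - j + 1) < w (2 * n - j)"
      using coxeter_B_mirror_ascent[OF w j(1,2)] j(3) by linarith
    then show ?thesis using that[of "2 * n - j"] 3 j by (simp add: gen_pos_def)
  qed
qed

lemma ascending_or_descending:
  assumes "w \<in> coxeter_B n"
  shows "w (gen_pos n i) < w (gen_pos n i + 1) \<or> w (gen_pos n i + 1) < w (gen_pos n i)"
  using injD[OF permutes_inj[OF coxeter_B_permutes[OF assms]], of "gen_pos n i" "gen_pos n i + 1"]
  by fastforce

section \<open>Braid words of type B expressions\<close>

definition gen_word :: "nat \<Rightarrow> nat \<Rightarrow> braid_word" where
  "gen_word n i = (if i = 0 then [(n, True)] else [(i, True), (2 * n - i, True)])"

definition symmetric_word :: "nat \<Rightarrow> nat list \<Rightarrow> braid_word" where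
  "symmetric_word n ts = concat (map (gen_word n) ts)"

lemma symmetric_word_simps [simp]:
  "symmetric_word n [] = []" "symmetric_word n (i # ts) = gen_word n i @ symmetric_word n ts"
  "symmetric_word n (ts @ us) = symmetric_word n ts @ symmetric_word n us"
  by (simp_all add: symmetric_word_def)

lemma gen_word:
  assumes "i < n"
  shows "gen_word n i \<in> braid_words (2 * n)" "positive (gen_word n i) = gen_word n i"
    "word_perm (gen_word n i) = coxeter_gen_B n i"
  using assms by (auto simp: gen_word_def coxeter_gen_B_def)

lemma symmetric_word_words:
  "set ts \<subseteq> {..<n} \<Longrightarrow> symmetric_word n ts \<in> braid_words (2 * n)"
  by (induction ts) (simp_all add: gen_word)

lemma positive_symmetric_word:
  "set ts \<subseteq> {..<n} \<Longrightarrow> positive (symmetric_word n ts) = symmetric_word n ts"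
  by (induction ts) (simp_all add: gen_word)

lemma lift_word_B_eq:
  assumes "set ts \<subseteq> {..<n}"
  shows "lift_word_B n ts = braid_class (2 * n) (symmetric_word n ts)"
  using assms
proof (induction ts)
  case Nil
  then show ?case by (simp add: lift_word_B_def braid_group_def)
next
  case (Cons i ts)
  then have i: "i < n" "set ts \<subseteq> {..<n}" by auto
  have "artin_gen_B n i = braid_class (2 * n) (gen_word n i)"
    using i(1) by (auto simp: artin_gen_B_def artin_gen_def gen_word_def braid_group_mult_class)
  moreover have "lift_word_B n (i # ts) = artin_gen_B n i \<otimes>\<^bsub>braid_group (2 * n)\<^esub> lift_word_B n ts"
    by (simp add: lift_word_B_def)
  ultimately show ?case
    using Cons.IH[OF i(2)] braid_group_mult_class[OF gen_word(1)[OF i(1)] symmetric_word_words[OF i(2)]]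
    by simp
qed

lemma expression_B_eq:
  "expression_B n ts w \<longleftrightarrow> set ts \<subseteq> {..<n} \<and> word_perm (symmetric_word n ts) = w"
proof -
  have "foldr (\<circ>) (map (coxeter_gen_B n) ts) id = word_perm (symmetric_word n ts)"
    if "set ts \<subseteq> {..<n}"
    using that by (induction ts) (simp_all add: word_perm_append gen_word)
  then show ?thesis unfolding expression_B_def by metis
qed

lemma layered_gen_word:
  assumes w: "w \<in> coxeter_B n" and i: "i < n" and up: "w (gen_pos n i) < w (gen_pos n i + 1)"
  shows "layered w (gen_word n i)"
proof (cases "i = 0")
  case True
  then show ?thesis using up by (simp add: gen_pos_def gen_word_def)
next
  case False
  have up: "w i < w (i + 1)" using up False by (simp add: gen_pos_def)
  then have "w (2 * n - i) < w (2 * n - i + 1)"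
    using coxeter_B_mirror_ascent[OF w, of i] i False by simp
  moreover have "transpose i (i + 1) (2 * n - i) = 2 * n - i"
    "transpose i (i + 1) (2 * n - i + 1) = 2 * n - i + 1"
    using i by (intro transpose_apply_other; linarith)+
  ultimately show ?thesis using up False by (simp add: gen_word_def)
qed

text \<open>Every generator changes \<open>double_length\<close> by exactly two, so equality means
  that each one is applied at an ascent, where its letters are layered.\<close>

lemma symmetric_word_length:
  assumes "set ts \<subseteq> {..<n}"
  shows "word_perm (symmetric_word n ts) \<in> coxeter_B n"
    "double_length n (word_perm (symmetric_word n ts)) \<le> 2 * length ts"
    "double_length n (word_perm (symmetric_word n ts)) = 2 * length ts \<Longrightarrow>
      layered id (symmetric_word n ts)"
proof -
  have "word_perm (symmetric_word n ts) \<in> coxeter_B n \<and>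
    double_length n (word_perm (symmetric_word n ts)) \<le> 2 * length ts \<and>
    (double_length n (word_perm (symmetric_word n ts)) = 2 * length ts \<longrightarrow>
      layered id (symmetric_word n ts))"
    using assms
  proof (induction ts rule: rev_induct)
    case Nil
    have "{k \<in> {1..n}. n < id k} = {}" by auto
    then have d: "double_length n id = 0" unfolding double_length_def by simp
    show ?case
      unfolding symmetric_word_simps word_perm.simps d by (intro conjI coxeter_B_id) simp_all
  next
    case (snoc i ts)
    then have i: "i < n" and ts: "set ts \<subseteq> {..<n}" by auto
    let ?v = "word_perm (symmetric_word n ts)"
    note IH = snoc.IH[OF ts]
    have v: "?v \<in> coxeter_B n" using IH by blast
    have e: "word_perm (symmetric_word n (ts @ [i])) = ?v \<circ> coxeter_gen_B n i"
      by (simp add: word_perm_append gen_word(3)[OF i])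
    consider "?v (gen_pos n i) < ?v (gen_pos n i + 1)" | "?v (gen_pos n i + 1) < ?v (gen_pos n i)"
      using ascending_or_descending[OF v] by blast
    then show ?case
    proof cases
      case 1
      show ?thesis
        unfolding e double_length_up[OF v i 1]
      proof (intro conjI impI coxeter_B_comp[OF v coxeter_gen_B[OF i]])
        show "double_length n ?v + 2 \<le> 2 * length (ts @ [i])" using IH by simp
        assume "double_length n ?v + 2 = 2 * length (ts @ [i])"
        then have "double_length n ?v = 2 * length ts" by simp
        then have "layered id (symmetric_word n ts)" using IH by blast
        then show "layered id (symmetric_word n (ts @ [i]))"
          using layered_gen_word[OF v i 1] by (simp add: layered_append)
      qed
    next
      case 2
      have "double_length n (?v \<circ> coxeter_gen_B n i) < 2 * length (ts @ [i])"
        using IH double_length_down[OF v i 2] by simp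
      then have "double_length n (?v \<circ> coxeter_gen_B n i) \<le> 2 * length (ts @ [i])"
        "double_length n (?v \<circ> coxeter_gen_B n i) \<noteq> 2 * length (ts @ [i])"
        by linarith+
      then show ?thesis
        unfolding e using coxeter_B_comp[OF v coxeter_gen_B[OF i]] by blast
    qed
  qed
  then show "word_perm (symmetric_word n ts) \<in> coxeter_B n"
    "double_length n (word_perm (symmetric_word n ts)) \<le> 2 * length ts"
    "double_length n (word_perm (symmetric_word n ts)) = 2 * length ts \<Longrightarrow>
      layered id (symmetric_word n ts)" by blast+
qed

lemma coxeter_B_ex_word:
  assumes "w \<in> coxeter_B n"
  shows "\<exists>ts. set ts \<subseteq> {..<n} \<and> word_perm (symmetric_word n ts) = w \<and> double_length n w = 2 * length ts"
  using assms
proof (induction "double_length n w" arbitrary: w rule: less_induct)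
  case less
  show ?case
  proof (cases "w = id")
    case True
    have "{k \<in> {1..n}. n < id k} = {}" by auto
    then have "double_length n id = 0" unfolding double_length_def by simp
    with True show ?thesis by (intro exI[of _ "[]"]) simp
  next
    case False
    then obtain i where i: "i < n" "w (gen_pos n i + 1) < w (gen_pos n i)"
      using coxeter_B_ex_descent[OF less.prems] by blast
    let ?v = "w \<circ> coxeter_gen_B n i"
    have d: "double_length n w = double_length n ?v + 2"
      by (rule double_length_down[OF less.prems i])
    then obtain ts where ts: "set ts \<subseteq> {..<n}" "word_perm (symmetric_word n ts) = ?v"
      "double_length n ?v = 2 * length ts"
      using less.hyps[OF _ coxeter_B_comp[OF less.prems coxeter_gen_B[OF i(1)]]] by auto
    have "?v \<circ> coxeter_gen_B n i = w"
      using coxeter_gen_B_involution[OF i(1)] by (simp add: fun_eq_iff)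
    with ts d i(1) show ?thesis
      by (intro exI[of _ "ts @ [i]"]) (simp add: word_perm_append gen_word(3))
  qed
qed

lemma length_B_eq:
  assumes "w \<in> coxeter_B n"
  shows "2 * length_B n w = double_length n w"
proof -
  obtain ts where ts: "set ts \<subseteq> {..<n}" "word_perm (symmetric_word n ts) = w"
    "double_length n w = 2 * length ts"
    using coxeter_B_ex_word[OF assms] by blast
  have "length_B n w = length ts"
    unfolding length_B_def
  proof (rule Least_equality)
    show "\<exists>us. expression_B n us w \<and> length us = length ts"
      using ts by (auto simp: expression_B_eq)
    fix k assume "\<exists>us. expression_B n us w \<and> length us = k"
    then obtain us where "set us \<subseteq> {..<n}" "word_perm (symmetric_word n us) = w" "length us = k"
      by (auto simp: expression_B_eq)
    with symmetric_word_length(2)[of us n] ts(3) show "length ts \<le> k" by simp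
  qed
  with ts(3) show ?thesis by simp
qed

text \<open>A reduced type B expression spells a word layered by \<open>id\<close>, which its
  permutation determines up to equivalence. This yields Matsumoto's theorem in type B and identifies
  the lift with the one of type A.\<close>

lemma reduced_expression_B_class:
  assumes "reduced_expression_B n ts w"
  shows "lift_word_B n ts = braid_class (2 * n) (perm_word (2 * n) w)"
proof -
  have ts: "set ts \<subseteq> {..<n}" "word_perm (symmetric_word n ts) = w" "length ts = length_B n w"
    using assms by (auto simp: reduced_expression_B_def expression_B_eq)
  have W: "symmetric_word n ts \<in> braid_words (2 * n)" by (rule symmetric_word_words[OF ts(1)])
  have "2 * length ts = double_length n w"
    using length_B_eq symmetric_word_length(1)[OF ts(1)] ts(2,3) by simp
  then have "layered id (symmetric_word n ts)"
    using symmetric_word_length(3)[OF ts(1)] ts(2) by simp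
  from perm_word_eq[OF W this] show ?thesis
    unfolding lift_word_B_eq[OF ts(1)] ts(2) using braid_class_eq_iff[OF W] by blast
qed

lemma coxeter_B_ex_reduced:
  assumes "w \<in> coxeter_B n"
  shows "\<exists>ts. reduced_expression_B n ts w"
  using coxeter_B_ex_word[OF assms] length_B_eq[OF assms]
  by (auto simp: reduced_expression_B_def expression_B_eq)

lemma positive_lift_B_eq:
  "positive_lift_B n = (\<lambda>w. braid_class (2 * n) (perm_word (2 * n) w)) ` coxeter_B n"
proof (intro equalityI subsetI)
  show "x \<in> (\<lambda>w. braid_class (2 * n) (perm_word (2 * n) w)) ` coxeter_B n"
    if "x \<in> positive_lift_B n" for x
    using that reduced_expression_B_class unfolding positive_lift_B_def by blast
  show "x \<in> positive_lift_B n"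
    if x: "x \<in> (\<lambda>w. braid_class (2 * n) (perm_word (2 * n) w)) ` coxeter_B n" for x
  proof -
    obtain w where w: "w \<in> coxeter_B n" "x = braid_class (2 * n) (perm_word (2 * n) w)"
      using x by blast
    obtain ts where "reduced_expression_B n ts w" using coxeter_B_ex_reduced[OF w(1)] by blast
    with w show ?thesis
      using reduced_expression_B_class unfolding positive_lift_B_def by blast
  qed
qed

lemma positive_lift_B_positive: "positive_lift_B n \<subseteq> positive_braids_B n"
  unfolding positive_lift_B_def positive_braids_B_def reduced_expression_B_def expression_B_def
  by blast

lemma positive_braids_B_words:
  assumes "x \<in> positive_braids_B n"
  obtains X where "X \<in> braid_words (2 * n)" "positive X = X" "x = braid_class (2 * n) X"
  using assms lift_word_B_eq symmetric_word_words positive_symmetric_word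
  unfolding positive_braids_B_def by blast

lemma positive_braids_B_mult:
  assumes "x \<in> positive_braids_B n" "y \<in> positive_braids_B n"
  shows "x \<otimes>\<^bsub>braid_group (2 * n)\<^esub> y \<in> positive_braids_B n"
proof -
  obtain ts us where ts: "set ts \<subseteq> {..<n}" "x = lift_word_B n ts"
    and us: "set us \<subseteq> {..<n}" "y = lift_word_B n us"
    using assms unfolding positive_braids_B_def by blast
  have tu: "set (ts @ us) \<subseteq> {..<n}" using ts us by simp
  have "x \<otimes>\<^bsub>braid_group (2 * n)\<^esub> y = lift_word_B n (ts @ us)"
    unfolding ts(2) us(2) lift_word_B_eq[OF ts(1)] lift_word_B_eq[OF us(1)] lift_word_B_eq[OF tu]
    using braid_group_mult_class symmetric_word_words ts(1) us(1) by simp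
  with tu show ?thesis unfolding positive_braids_B_def by blast
qed

text \<open>A descent of \<open>rev_perm (2 * n) \<circ> w\<close> is an ascent of \<open>w\<close>,
  where a generator would still lengthen \<open>w\<close>.\<close>

lemma longest_B_eq: "longest_B n = rev_perm (2 * n)"
proof -
  let ?r = "rev_perm (2 * n)"
  have max: "w = ?r" if w: "w \<in> coxeter_B n" "\<forall>v\<in>coxeter_B n. length_B n v \<le> length_B n w" for w
  proof -
    have "?r \<circ> w = id"
    proof (rule ccontr)
      assume "?r \<circ> w \<noteq> id"
      then obtain i where i: "i < n" "(?r \<circ> w) (gen_pos n i + 1) < (?r \<circ> w) (gen_pos n i)"
        using coxeter_B_ex_descent[OF coxeter_B_comp[OF coxeter_B_rev w(1)]] by blast
      have "gen_pos n i \<in> {1..2 * n}" "gen_pos n i + 1 \<in> {1..2 * n}"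
        using i(1) by (auto simp: gen_pos_def)
      then have "w (gen_pos n i) \<in> {1..2 * n}" "w (gen_pos n i + 1) \<in> {1..2 * n}"
        using permutes_in_image[OF coxeter_B_permutes[OF w(1)]] by blast+
      then have "w (gen_pos n i) < w (gen_pos n i + 1)"
        using i(2) rev_perm_less by simp
      from double_length_up[OF w(1) i(1) this]
      have "length_B n w < length_B n (w \<circ> coxeter_gen_B n i)"
        using length_B_eq[OF w(1)] length_B_eq[OF coxeter_B_comp[OF w(1) coxeter_gen_B[OF i(1)]]]
        by simp
      with w coxeter_B_comp[OF w(1) coxeter_gen_B[OF i(1)]] show False by (meson leD)
    qed
    then have "?r (?r (w k)) = ?r k" for k by (simp add: fun_eq_iff)
    then show ?thesis by (simp add: fun_eq_iff)
  qed
  have "finite (coxeter_B n)"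
    by (rule finite_subset[OF _ finite_permutations[of "{1..2 * n}"]]) (auto simp: coxeter_B_def)
  then have fin: "finite (length_B n ` coxeter_B n)" by (rule finite_imageI)
  have "Max (length_B n ` coxeter_B n) \<in> length_B n ` coxeter_B n"
    using coxeter_B_id[of n] by (intro Max_in[OF fin]) blast
  then obtain w where "w \<in> coxeter_B n" "length_B n w = Max (length_B n ` coxeter_B n)"
    by (metis imageE)
  then have w: "w \<in> coxeter_B n" "\<forall>v\<in>coxeter_B n. length_B n v \<le> length_B n w"
    using Max_ge[OF fin] by simp_all
  show ?thesis
    unfolding longest_B_def using w max by (intro the_equality) blast+
qed

lemma Delta_B_eq: "Delta_B n = braid_class (2 * n) (perm_word (2 * n) (rev_perm (2 * n)))"
  unfolding Delta_B_def longest_B_eq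
  using reduced_expression_B_class coxeter_B_ex_reduced[OF coxeter_B_rev] by (intro the_equality) metis+


section \<open>Symmetric heights of symmetric braids\<close>

abbreviation tau_word :: "nat \<Rightarrow> braid_word \<Rightarrow> braid_word" where
  "tau_word n \<equiv> map (apfst (\<lambda>i. 2 * n - i))"

text \<open>The symmetry exchanges left and right but keeps the signs of the letters, so it
  exchanges over and under. Hence the heights are mirrored and negated, with values in
  \<open>int\<close>.\<close>

lemma layered_tau:
  fixes a :: "nat \<Rightarrow> nat"
  assumes "D \<in> braid_words (2 * n)" "inj_on a {1..2 * n}" "layered a D"
  shows "layered (\<lambda>k. - int (a (rev_perm (2 * n) k))) (tau_word n D)"
  using assms
proof (induction D arbitrary: a rule: word_perm.induct)
  case (2 i e D)
  let ?r = "rev_perm (2 * n)" and ?t = "transpose i (i + 1)"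
  let ?u = "transpose (2 * n - i) (2 * n - i + 1)"
  have i: "1 \<le> i" "i < 2 * n" "D \<in> braid_words (2 * n)" using "2.prems"(1) by auto
  have r: "?r (2 * n - i) = i + 1" "?r (2 * n - i + 1) = i"
    using i by (auto simp: rev_perm_def)
  have ru: "?r (?u k) = ?t (?r k)" for k
    using inj_transpose_apply[OF permutes_inj[OF perm_rev], of "2 * n" "2 * n - i" "2 * n - i + 1" k]
    unfolding r by (simp only: transpose_commute)
  note inj = inj_on_comp_transpose[OF "2.prems"(2) i(1,2)]
  have "layered (\<lambda>k. - int ((a \<circ> ?t) (?r k))) (tau_word n D)"
    using "2.IH"[OF i(3) inj] "2.prems"(3) unfolding layered.simps by blast
  moreover have "(\<lambda>k. - int (a (?r k))) \<circ> ?u = (\<lambda>k. - int ((a \<circ> ?t) (?r k)))"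
    unfolding comp_def ru ..
  moreover have "e \<longleftrightarrow> - int (a (?r (2 * n - i))) < - int (a (?r (2 * n - i + 1)))"
    using "2.prems"(3) unfolding r layered.simps by simp
  ultimately show ?case
    unfolding list.map apfst_conv layered.simps by (simp only: simp_thms)
qed simp

lemma word_perm_tau:
  assumes "D \<in> braid_words (2 * n)"
  shows "word_perm (tau_word n D) (rev_perm (2 * n) k) = rev_perm (2 * n) (word_perm D k)"
  using assms
proof (induction D rule: word_perm.induct)
  case (2 i e D)
  let ?r = "rev_perm (2 * n)"
  have i: "1 \<le> i" "i < 2 * n" "D \<in> braid_words (2 * n)" using "2.prems" by auto
  have r: "?r i = 2 * n - i + 1" "?r (i + 1) = 2 * n - i"
    using i by (auto simp: rev_perm_def)
  have "?r (transpose i (i + 1) l) = transpose (2 * n - i) (2 * n - i + 1) (?r l)" for l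
    using inj_transpose_apply[OF permutes_inj[OF perm_rev], of "2 * n" i "i + 1" l]
    unfolding r by (simp only: transpose_commute)
  then show ?case
    using "2.IH"[OF i(3)] unfolding list.map apfst_conv word_perm.simps comp_apply by metis
qed simp

lemma positive_layer: "positive (layer a D) = positive D"
  by (induction a D rule: layer.induct) (simp_all add: comp_def)

text \<open>A reduced diagram \<open>D\<close> with heights \<open>a\<close> also has the heights obtained from \<open>a\<close> by the symmetry,
  hence every height function refining both, such as the one ordering the strands by
  \<open>a k - a (-k)\<close>, with ties resolved symmetrically.\<close>

lemma symmetric_layered:
  assumes "\<beta> \<in> braids_B n" "layerable (2 * n) \<beta>"
  shows "\<exists>s \<in> coxeter_B n. \<exists>D \<in> braid_words (2 * n). layered s D \<and> word_perm D \<in> coxeter_B n \<and>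
    \<beta> = braid_class (2 * n) D"
proof -
  let ?r = "rev_perm (2 * n)" and ?I = "{1..2 * n}"
  obtain a :: "nat \<Rightarrow> nat" and E where a: "inj_on a ?I" and E: "E \<in> braid_words (2 * n)"
    "layered a E" "\<beta> = braid_class (2 * n) E"
    using assms(2) unfolding layerable_def by blast
  note X = perm_word[OF word_perm_permutes[OF E(1)]]
  define D where "D = layer a (perm_word (2 * n) (word_perm E))"
  have D: "D \<in> braid_words (2 * n)" "layered a D" "word_perm D = word_perm E"
    by (simp_all add: D_def X)
  have red: "layered id (positive D)"
    unfolding D_def positive_layer X(2) by (rule X(5)[OF adds_id])
  have "braid_equiv (2 * n) D E"
    by (rule layered_unique[OF a D(1) E(1) D(2) E(2) D(3)])
  then have \<beta>: "\<beta> = braid_class (2 * n) D"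
    using braid_class_eq_iff[OF D(1)] E(3) by metis
  have "braid_class (2 * n) D = braid_class (2 * n) (tau_word n D)"
    using assms(1) braid_tau_class[OF D(1)] unfolding braids_B_def \<beta> by simp
  then have tau: "braid_equiv (2 * n) D (tau_word n D)"
    using braid_class_eq_iff[OF D(1)] by simp
  have "word_perm D (?r k) = ?r (word_perm D k)" for k
    using word_perm_tau[OF D(1), of k] braid_equiv_word_perm[OF tau] by simp
  then have perm_D: "word_perm D \<in> coxeter_B n"
    using word_perm_permutes[OF D(1)] by (simp add: coxeter_B_iff fun_eq_iff)
  define b where "b k = - int (a (?r k))" for k
  have r_in: "?r k \<in> ?I \<longleftrightarrow> k \<in> ?I" for k
    by (rule permutes_in_image[OF perm_rev])
  have "inj_on b ?I"
  proof (rule inj_onI)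
    fix k l assume kl: "k \<in> ?I" "l \<in> ?I" "b k = b l"
    then have "a (?r k) = a (?r l)" by (simp add: b_def)
    then have "?r k = ?r l" by (rule inj_onD[OF a]) (use kl r_in in blast)+
    then show "k = l" by (metis rev_perm_rev_perm)
  qed
  moreover have "layered b (tau_word n D)"
    unfolding b_def by (rule layered_tau[OF D(1) a D(2)])
  ultimately have b: "inj_on b ?I" "layered b D"
    using layered_linking[OF _ D(1) braid_equiv_words(2)[OF tau] _ red tau] by blast+
  \<comment> \<open>The sum of \<open>a\<close> and \<open>b\<close>, which increases whenever both
    do. Mirroring negates \<open>c\<close> and reverses the positions, so breaking ties by position
    respects the symmetry.\<close>
  define c where "c k = int (a k) - int (a (?r k))" for k
  define R where "R k l \<longleftrightarrow> c k < c l \<or> c k = c l \<and> k < l" for k l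
  define s where "s k = (if k \<in> ?I then Suc (card {j \<in> ?I. R j k}) else k)" for k
  have R: "\<not> R k k" "R j k \<Longrightarrow> R k l \<Longrightarrow> R j l" "k \<noteq> l \<Longrightarrow> R k l \<or> R l k" for j k l
    by (auto simp: R_def)
  have s: "s permutes ?I" and sR: "\<And>k l. k \<in> ?I \<Longrightarrow> l \<in> ?I \<Longrightarrow> s k < s l \<longleftrightarrow> R k l"
    using permutes_rank[of "2 * n" R] R unfolding s_def by blast+
  have Rr: "R (?r l) (?r k) \<longleftrightarrow> R k l" if "k \<in> ?I" "l \<in> ?I" for k l
    using rev_perm_less[OF that(2,1)] by (auto simp: R_def c_def)
  have p: "?r \<circ> s \<circ> ?r permutes ?I"
    by (intro permutes_comp perm_rev s)
  have "(?r \<circ> s \<circ> ?r) l < (?r \<circ> s \<circ> ?r) k \<longleftrightarrow> s l < s k" if kl: "k \<in> ?I" "l \<in> ?I" for k l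
  proof -
    have rk: "?r k \<in> ?I" "?r l \<in> ?I" using kl r_in by blast+
    then have "s (?r k) \<in> ?I" "s (?r l) \<in> ?I" using permutes_in_image[OF s] by blast+
    then have "(?r \<circ> s \<circ> ?r) l < (?r \<circ> s \<circ> ?r) k \<longleftrightarrow> R (?r k) (?r l)"
      using rev_perm_less sR[OF rk] by simp
    then show ?thesis using Rr[OF kl(2,1)] sR[OF kl(2,1)] by simp
  qed
  then have "inv_set (2 * n) (?r \<circ> s \<circ> ?r) = inv_set (2 * n) s"
    unfolding inv_set_def by auto
  then have rsr: "?r \<circ> s \<circ> ?r = s" by (rule inv_set_eqD[OF p s])
  then have "s \<circ> ?r = ?r \<circ> s \<circ> ?r \<circ> ?r" by simp
  also have "\<dots> = ?r \<circ> s" by (simp add: fun_eq_iff)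
  finally have "s \<in> coxeter_B n" using s by (simp only: coxeter_B_iff simp_thms)
  moreover have "layered s D"
  proof (rule layered_mono2[OF a D(1,2) b])
    fix k l assume "k \<in> ?I" "l \<in> ?I" "a k < a l" "b k < b l"
    then show "s k < s l" using sR by (simp add: R_def b_def c_def)
  qed
  ultimately show ?thesis using D(1) perm_D \<beta> by blast
qed

section \<open>Mikado braids and rational permutation braids\<close>

lemma mikado_B_fraction:
  assumes "n \<ge> 1" "mikado_B n \<beta>"
  shows "\<exists>x\<in>positive_lift_B n. \<exists>y\<in>positive_lift_B n.
    \<beta> = inv\<^bsub>braid_group (2 * n)\<^esub> x \<otimes>\<^bsub>braid_group (2 * n)\<^esub> y"
proof -
  let ?m = "2 * n"
  have "\<exists>m. ?m = Suc m" using assms(1) by (intro exI[of _ "2 * n - 1"]) simp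
  then have "layerable ?m \<beta>"
    using assms(2) mikado_imp_layerable unfolding mikado_B_def by metis
  then obtain s D where s: "s \<in> coxeter_B n" and D: "D \<in> braid_words ?m" "layered s D"
    "word_perm D \<in> coxeter_B n" "\<beta> = braid_class ?m D"
    using symmetric_layered assms(2) unfolding mikado_B_def by blast
  define X where "X = perm_word ?m s"
  define Y where "Y = perm_word ?m (s \<circ> word_perm D)"
  have sD: "s \<circ> word_perm D \<in> coxeter_B n" by (rule coxeter_B_comp[OF s D(3)])
  note PX = perm_word[OF coxeter_B_permutes[OF s], folded X_def]
  note PY = perm_word[OF coxeter_B_permutes[OF sD], folded Y_def]
  \<comment> \<open>The word \<open>X\<close> turns the heights \<open>id\<close> into
    \<open>s\<close>, with which \<open>D\<close> continues. Hence \<open>X @ D\<close> is a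
    positive lift.\<close>
  have "layered id (X @ D)"
    unfolding layered_append PX(3) using PX(5)[OF adds_id] D(2) by simp
  then have "braid_equiv ?m (X @ D) Y"
    using perm_word_eq[of "X @ D" ?m] PX(1) D(1) unfolding word_perm_append PX(3) Y_def by simp
  then have "braid_equiv ?m (word_inverse X @ X @ D) (word_inverse X @ Y)"
    by (intro braid_equiv_append braid_equiv.refl word_inverse_words PX(1))
  then have "braid_equiv ?m D (word_inverse X @ Y)"
    using braid_equiv_word_inverse_append[OF PX(1) D(1)] braid_equiv.sym braid_equiv.trans by blast
  then have "\<beta> = inv\<^bsub>braid_group ?m\<^esub> braid_class ?m X \<otimes>\<^bsub>braid_group ?m\<^esub> braid_class ?m Y"
    unfolding braid_group_inv_class[OF PX(1)]
      braid_group_mult_class[OF word_inverse_words[OF PX(1)] PY(1)] D(4)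
    using braid_class_eq_iff[OF D(1)] by blast
  moreover have "braid_class ?m X \<in> positive_lift_B n" "braid_class ?m Y \<in> positive_lift_B n"
    unfolding positive_lift_B_eq X_def Y_def using s sD by blast+
  ultimately show ?thesis by blast
qed

text \<open>With complements u', v' such that u' u and v v' both give Delta, the two quotients
  become u' v and v' u. The second needs Delta to be moved past u, which is possible because the
  longest element is central in type B.\<close>

lemma fraction_rational:
  assumes "\<beta> \<in> braids_B n" "x \<in> positive_lift_B n" "y \<in> positive_lift_B n"
    and \<beta>: "\<beta> = inv\<^bsub>braid_group (2 * n)\<^esub> x \<otimes>\<^bsub>braid_group (2 * n)\<^esub> y"
  shows "rational_permutation_braid_B n \<beta>"
proof -
  let ?m = "2 * n" and ?r = "rev_perm (2 * n)"
  let ?G = "braid_group ?m"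
  interpret G: group ?G by (rule group_braid_group)
  define C where "C w = braid_class ?m (perm_word ?m w)" for w
  have C: "C w \<in> carrier ?G" if "w \<in> coxeter_B n" for w
    using perm_word(1)[OF coxeter_B_permutes[OF that]] by (simp add: C_def braid_group_def)
  have pos: "C w \<in> positive_braids_B n" if "w \<in> coxeter_B n" for w
    using that positive_lift_B_positive unfolding positive_lift_B_eq C_def by blast
  have mult: "C w \<otimes>\<^bsub>?G\<^esub> C v = C ?r" if w: "w \<in> coxeter_B n" and v: "v \<in> coxeter_B n"
    and wv: "w \<circ> v = ?r" for w v
  proof -
    note w = coxeter_B_permutes[OF w] and v = coxeter_B_permutes[OF v]
    have "braid_equiv ?m (perm_word ?m w @ perm_word ?m v) (perm_word ?m ?r)"
      using perm_word_comp[OF w v adds_rev[OF wv v]] unfolding wv .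
    then show ?thesis
      unfolding C_def braid_group_mult_class[OF perm_word(1)[OF w] perm_word(1)[OF v]]
      using braid_class_eq_iff perm_word(1)[OF w] perm_word(1)[OF v] by simp
  qed
  obtain u where u: "u \<in> coxeter_B n" "x = C u"
    using assms(2) unfolding positive_lift_B_eq C_def by blast
  obtain v where v: "v \<in> coxeter_B n" "y = C v"
    using assms(3) unfolding positive_lift_B_eq C_def by blast
  have compl: "?r \<circ> pinv w \<in> coxeter_B n" "?r \<circ> pinv w \<circ> w = ?r" "w \<circ> (?r \<circ> pinv w) = ?r"
    if w: "w \<in> coxeter_B n" for w
  proof -
    note p = coxeter_B_permutes[OF w]
    show "?r \<circ> pinv w \<in> coxeter_B n" by (rule coxeter_B_comp[OF coxeter_B_rev coxeter_B_inv[OF w]])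
    show "?r \<circ> pinv w \<circ> w = ?r" by (simp add: comp_assoc permutes_inv_o(2)[OF p])
    have "w \<circ> (?r \<circ> pinv w) = ?r \<circ> (w \<circ> pinv w)"
      using w unfolding coxeter_B_iff by (metis comp_assoc)
    then show "w \<circ> (?r \<circ> pinv w) = ?r" by (simp add: permutes_inv_o(1)[OF p])
  qed
  note cu = compl[OF u(1)] and cv = compl[OF v(1)]
  have \<Delta>: "Delta_B n = C ?r" unfolding Delta_B_eq C_def ..
  have cancel: "a \<otimes>\<^bsub>?G\<^esub> (inv\<^bsub>?G\<^esub> a \<otimes>\<^bsub>?G\<^esub> b) = b" "inv\<^bsub>?G\<^esub> a \<otimes>\<^bsub>?G\<^esub> (a \<otimes>\<^bsub>?G\<^esub> b) = b"
    if "a \<in> carrier ?G" "b \<in> carrier ?G" for a b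
    using that by (simp_all flip: G.m_assoc)
  note carrier = C[OF u(1)] C[OF v(1)] C[OF cu(1)] C[OF cv(1)] C[OF coxeter_B_rev]
  have \<beta>': "\<beta> = inv\<^bsub>?G\<^esub> C u \<otimes>\<^bsub>?G\<^esub> C v" unfolding \<beta> u(2) v(2) ..
  have "C ?r \<otimes>\<^bsub>?G\<^esub> \<beta> = C (?r \<circ> pinv u) \<otimes>\<^bsub>?G\<^esub> C u \<otimes>\<^bsub>?G\<^esub> \<beta>"
    unfolding mult[OF cu(1) u(1) cu(2)] ..
  also have "\<dots> = C (?r \<circ> pinv u) \<otimes>\<^bsub>?G\<^esub> C v"
    unfolding \<beta>' using carrier by (simp add: G.m_assoc cancel)
  finally have 1: "C ?r \<otimes>\<^bsub>?G\<^esub> \<beta> = C (?r \<circ> pinv u) \<otimes>\<^bsub>?G\<^esub> C v" .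
  \<comment> \<open>Complements work on either side in type B, so Delta commutes with
    \<open>C u\<close>.\<close>
  have "C u \<otimes>\<^bsub>?G\<^esub> C ?r = C u \<otimes>\<^bsub>?G\<^esub> (C (?r \<circ> pinv u) \<otimes>\<^bsub>?G\<^esub> C u)"
    unfolding mult[OF cu(1) u(1) cu(2)] ..
  also have "\<dots> = C ?r \<otimes>\<^bsub>?G\<^esub> C u"
    using carrier by (simp add: mult[OF u(1) cu(1,3)] flip: G.m_assoc)
  also have "\<dots> = C v \<otimes>\<^bsub>?G\<^esub> C (?r \<circ> pinv v) \<otimes>\<^bsub>?G\<^esub> C u"
    unfolding mult[OF v(1) cv(1,3)] ..
  finally have e: "C u \<otimes>\<^bsub>?G\<^esub> C ?r = C v \<otimes>\<^bsub>?G\<^esub> C (?r \<circ> pinv v) \<otimes>\<^bsub>?G\<^esub> C u" .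
  have "inv\<^bsub>?G\<^esub> \<beta> \<otimes>\<^bsub>?G\<^esub> C ?r = inv\<^bsub>?G\<^esub> C v \<otimes>\<^bsub>?G\<^esub> (C u \<otimes>\<^bsub>?G\<^esub> C ?r)"
    unfolding \<beta>' using carrier by (simp add: G.inv_mult_group G.m_assoc)
  also have "\<dots> = C (?r \<circ> pinv v) \<otimes>\<^bsub>?G\<^esub> C u"
    unfolding e using carrier by (simp add: G.m_assoc cancel)
  finally have 2: "inv\<^bsub>?G\<^esub> \<beta> \<otimes>\<^bsub>?G\<^esub> C ?r = C (?r \<circ> pinv v) \<otimes>\<^bsub>?G\<^esub> C u" .
  have "inv\<^bsub>?G\<^esub> (inv\<^bsub>?G\<^esub> C ?r) = C ?r" using carrier by simp
  then show ?thesis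
    unfolding rational_permutation_braid_B_def left_divides_B_def \<Delta>
    using assms(1) 1 2 positive_braids_B_mult[OF pos pos] cu(1) cv(1) u(1) v(1) by simp
qed

lemma rational_mikado_B:
  assumes "n \<ge> 1" "rational_permutation_braid_B n \<beta>"
  shows "mikado_B n \<beta>"
proof -
  let ?m = "2 * n" and ?r = "rev_perm (2 * n)"
  let ?G = "braid_group ?m"
  interpret G: group ?G by (rule group_braid_group)
  define R where "R = perm_word ?m ?r"
  note PR = perm_word[OF perm_rev, of ?m, folded R_def]
  have \<Delta>: "Delta_B n = braid_class ?m R" unfolding Delta_B_eq R_def ..
  have \<beta>_B: "\<beta> \<in> braids_B n"
    and div: "inv\<^bsub>?G\<^esub> (inv\<^bsub>?G\<^esub> braid_class ?m R) \<otimes>\<^bsub>?G\<^esub> \<beta> \<in> positive_braids_B n"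
      "inv\<^bsub>?G\<^esub> \<beta> \<otimes>\<^bsub>?G\<^esub> braid_class ?m R \<in> positive_braids_B n"
    using assms(2) unfolding rational_permutation_braid_B_def left_divides_B_def \<Delta> by blast+
  obtain D where D: "D \<in> braid_words ?m" "\<beta> = braid_class ?m D"
    using \<beta>_B unfolding braids_B_def braid_group_def by auto
  have D': "word_inverse D \<in> braid_words ?m" by (rule word_inverse_words[OF D(1)])
  have "braid_class ?m R \<in> carrier ?G" using PR(1) by (simp add: braid_group_def)
  then have "inv\<^bsub>?G\<^esub> (inv\<^bsub>?G\<^esub> braid_class ?m R) = braid_class ?m R" by simp
  with div(1) have "braid_class ?m (R @ D) \<in> positive_braids_B n"
    unfolding D(2) by (simp add: braid_group_mult_class[OF PR(1) D(1)])
  then obtain P where P: "P \<in> braid_words ?m" "positive P = P"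
    "braid_class ?m (R @ D) = braid_class ?m P"
    by (rule positive_braids_B_words)
  have "braid_class ?m (word_inverse D @ R) \<in> positive_braids_B n"
    using div(2) unfolding D(2) braid_group_inv_class[OF D(1)] braid_group_mult_class[OF D' PR(1)] .
  then obtain Q where Q: "Q \<in> braid_words ?m" "positive Q = Q"
    "braid_class ?m (word_inverse D @ R) = braid_class ?m Q"
    by (rule positive_braids_B_words)
  have P': "braid_equiv ?m (R @ D) P" and Q': "braid_equiv ?m (word_inverse D @ R) Q"
    using P(3) Q(3) braid_class_eq_iff D(1) D' PR(1) by simp_all
  \<comment> \<open>Delta beta times beta^-1 Delta is Delta^2.\<close>
  have "braid_equiv ?m (P @ Q) ((R @ D) @ (word_inverse D @ R))"
    by (rule braid_equiv_append[OF braid_equiv.sym[OF P'] braid_equiv.sym[OF Q']])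
  also have "\<dots> = R @ (D @ word_inverse D) @ R" by simp
  also have "braid_equiv ?m \<dots> (R @ [] @ R)"
    by (intro braid_equiv_append braid_equiv.refl PR(1) braid_word_inverse_right D(1))
  finally have PQ: "braid_equiv ?m (P @ Q) (R @ R)" by simp
  from positive_divisor_Delta_squared[OF P(1,2) Q(1,2) this[unfolded R_def]]
  obtain w v where w: "w permutes {1..?m}" and v: "v permutes {1..?m}"
    and Pwv: "braid_equiv ?m P (perm_word ?m w @ perm_word ?m v)" by blast
  \<comment> \<open>Delta is the lift of \<open>w\<close> times the lift of \<open>z\<close>.
    Cancelling the lift of \<open>w\<close> from Delta beta = W V leaves Z beta = V.\<close>
  define z where "z = pinv w \<circ> ?r"
  have z: "z permutes {1..?m}"
    unfolding z_def by (rule permutes_comp[OF permutes_inv[OF w] perm_rev])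
  have wz: "w \<circ> z = ?r"
    using permutes_inverses(1)[OF w] by (simp add: z_def fun_eq_iff)
  define V W Z where "V = perm_word ?m v" and "W = perm_word ?m w" and "Z = perm_word ?m z"
  have words: "V \<in> braid_words ?m" "W \<in> braid_words ?m" "Z \<in> braid_words ?m"
    "word_inverse Z \<in> braid_words ?m"
    using perm_word(1) v w z word_inverse_words unfolding V_def W_def Z_def by blast+
  have WZ: "braid_equiv ?m (W @ Z) R"
    using perm_word_comp[OF w z adds_rev[OF wz z]] unfolding wz W_def Z_def R_def .
  have "braid_equiv ?m (W @ Z @ D) (R @ D)"
    using braid_equiv_append[OF WZ braid_equiv.refl[OF D(1)]] by simp
  also note P'
  also have "braid_equiv ?m P (W @ V)" using Pwv unfolding W_def V_def .
  finally have "braid_equiv ?m (Z @ D) V" by (rule braid_equiv_cancel_left)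
  then have "braid_equiv ?m (word_inverse Z @ Z @ D) (word_inverse Z @ V)"
    by (rule braid_equiv_append[OF braid_equiv.refl[OF words(4)]])
  then have "braid_equiv ?m D (word_inverse Z @ V)"
    using braid_equiv_word_inverse_append[OF words(3) D(1)] braid_equiv.sym braid_equiv.trans
    by blast
  then have "\<beta> = braid_class ?m (word_inverse Z @ V)"
    unfolding D(2) using braid_class_eq_iff[OF D(1)] by blast
  then have "layerable ?m \<beta>"
    using fraction_layerable[OF z v] unfolding Z_def V_def by simp
  moreover have "\<exists>m. ?m = Suc m" using assms(1) by (intro exI[of _ "2 * n - 1"]) simp
  ultimately have "mikado ?m \<beta>" using layerable_imp_mikado by metis
  with \<beta>_B show ?thesis by (simp add: mikado_B_def)
qed

theorem proposition6p2:
  fixes n :: nat and \<beta> :: braid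
  assumes "n \<ge> 1" and "\<beta> \<in> braids_B n"
  shows "(mikado_B n \<beta> \<longleftrightarrow>
           (\<exists>x\<in>positive_lift_B n. \<exists>y\<in>positive_lift_B n.
              \<beta> = inv\<^bsub>braid_group (2 * n)\<^esub> x \<otimes>\<^bsub>braid_group (2 * n)\<^esub> y))
       \<and> (mikado_B n \<beta> \<longleftrightarrow> rational_permutation_braid_B n \<beta>)"
  using mikado_B_fraction[OF assms(1)] fraction_rational[OF assms(2)] rational_mikado_B[OF assms(1)]
  by blast

end
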